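(* There exist constants $a>0$, $\varepsilon>0$ and $C>0$ such that the following holds. Let $u\in L^\infty(\mathbb{R})$ be a function for which there exist $x_1,x_2\in\mathbb{R}$ with $x_2-x_1>a$ and $$\|u-H_{0,1}(\cdot+x_1)-H_{-1,0}(\cdot+x_2)\|_{H^1(\mathbb{R})}<\varepsilon .$$ Then there exist constants $y_1,y_2\in\mathbb{R}$ such that $$\|u-H_{0,1}(\cdot+y_1)-H_{-1,0}(\cdot+y_2)\|_{H^1(\mathbb{R})}+e^{-\sqrt{2}(y_2-y_1)}\le C\,\|\mathscr{F}(u)\|_{L^2(\mathbb{R})},$$ where $\mathscr{F}(u):=u''-2u+8u^3-6u^5$.
   Context: All functions are real-valued on $\mathbb{R}$. The kinks of the stationary $\phi^6$ equation $-\phi''+2\phi-8\phi^3+6\phi^5=0$ are $$H_{0,1}(x)=\frac{e^{\sqrt{2}x}}{(1+e^{2\sqrt{2}x})^{1/2}},\qquad H_{-1,0}(x)=-\frac{e^{-\sqrt{2}x}}{(1+e^{-2\sqrt{2}x})^{1/2}} .$$ The notation $H(\cdot+y)$ means the function $x\mapsto H(x+y)$. The derivative $u''$ in $\mathscr{F}(u)$ is taken in the sense of distributions, and $\|\mathscr{F}(u)\|_{L^2}$ is understood as $+\infty$ if $\mathscr{F}(u)\notin L^2(\mathbb{R})$. *)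

theory Defs
  imports "HOL-Analysis.Analysis"
begin

definition kink01 :: "real \<Rightarrow> real" where
  "kink01 x = exp (sqrt 2 * x) / sqrt (1 + exp (2 * sqrt 2 * x))"

definition kink10 :: "real \<Rightarrow> real" where
  "kink10 x = - (exp (- sqrt 2 * x) / sqrt (1 + exp (- 2 * sqrt 2 * x)))"

text \<open>Elements of \<open>L\<^sup>\<infinity>\<close> and \<open>L\<^sup>2\<close> are represented by Lebesgue measurable functions; every notion
  below is invariant under changes on null sets.\<close>

definition Linf_fun :: "(real \<Rightarrow> real) set" where
  "Linf_fun = {f \<in> borel_measurable lebesgue. \<exists>B. AE x in lebesgue. \<bar>f x\<bar> \<le> B}"

definition L2_fun :: "(real \<Rightarrow> real) set" where
  "L2_fun = {f \<in> borel_measurable lebesgue. integrable lebesgue (\<lambda>x. (f x)\<^sup>2)}"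

definition L2_fun_norm :: "(real \<Rightarrow> real) \<Rightarrow> real" where
  "L2_fun_norm f = sqrt (LINT x|lebesgue. (f x)\<^sup>2)"

definition test_fun :: "(real \<Rightarrow> real) set" where
  "test_fun = {\<phi>. (\<forall>k x. (deriv ^^ k) \<phi> field_differentiable (at x)) \<and>
                  compact (closure {x. \<phi> x \<noteq> 0})}"

text \<open>Distributions are functionals of which only the values on \<open>test_fun\<close> matter.\<close>

type_synonym distrib = "(real \<Rightarrow> real) \<Rightarrow> real"

definition distrib_of :: "(real \<Rightarrow> real) \<Rightarrow> distrib" where
  "distrib_of f \<phi> = (LINT x|lebesgue. f x * \<phi> x)"

definition distrib_deriv :: "distrib \<Rightarrow> distrib" where
  "distrib_deriv T \<phi> = - T (deriv \<phi>)"

definition represents :: "(real \<Rightarrow> real) \<Rightarrow> distrib \<Rightarrow> bool" where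
  "represents g T \<longleftrightarrow> (\<forall>\<phi>\<in>test_fun. T \<phi> = distrib_of g \<phi>)"

text \<open>The \<open>L\<^sup>2\<close> function representing a distribution is unique up to null sets when it exists. The
  infima below therefore range over at most one value, and they are \<open>\<infinity>\<close> exactly when the
  distribution is not in \<open>L\<^sup>2\<close>.\<close>

definition L2_norm :: "distrib \<Rightarrow> ennreal" where
  "L2_norm T = (INF g \<in> {g \<in> L2_fun. represents g T}. ennreal (L2_fun_norm g))"

definition H1_norm :: "(real \<Rightarrow> real) \<Rightarrow> ennreal" where
  "H1_norm f =
    (if f \<in> L2_fun then
       INF g \<in> {g \<in> L2_fun. represents g (distrib_deriv (distrib_of f))}.
         ennreal (sqrt ((L2_fun_norm f)\<^sup>2 + (L2_fun_norm g)\<^sup>2))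
     else \<infinity>)"

definition phi6_op :: "(real \<Rightarrow> real) \<Rightarrow> distrib" where
  "phi6_op u \<phi> =
     distrib_deriv (distrib_deriv (distrib_of u)) \<phi>
     + distrib_of (\<lambda>x. - 2 * u x + 8 * u x ^ 3 - 6 * u x ^ 5) \<phi>"

end

theory Submission
  imports Defs
begin

text \<open>
  Write \<open>u = kink_pair y1 y2 + g\<close> with \<open>q = exp (- sqrt 2 * (y2 - y1))\<close>, and let \<open>N\<close> be the squared
  \<open>H\<^sup>1\<close> norm of \<open>g\<close> and \<open>d\<close> the \<open>L\<^sup>2\<close> norm of \<open>f = u'' - W'(u)\<close>, where \<open>W(s) = s\<^sup>2 (1 - s\<^sup>2)\<^sup>2\<close>.
  Two estimates bound \<open>q\<close> and \<open>N\<close> by each other.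

  Coercivity gives \<open>N \<le> C (d\<^sup>2 + q\<^sup>2)\<close>. Instead of orthogonality to the translation modes, \<open>y1\<close> and \<open>y2\<close>
  are chosen by the intermediate value theorem so that \<open>u = 1 / sqrt 3\<close> and \<open>u = - 1 / sqrt 3\<close> where the
  respective kinks take these values; there \<open>g\<close> is of order \<open>q\<close>. With such almost-Dirichlet conditions the
  linearised operator is coercive by Riccati subsolutions on four pieces of the line. Test the equation with \<open>g\<close>.

  The energy \<open>u'\<^sup>2 - 2 W(u)\<close> vanishes at infinity and has derivative \<open>2 f u'\<close>, hence is of order \<open>d\<close>;
  halfway between the kinks it is at least \<open>c q - C N\<close>. So \<open>q \<le> C (d + N)\<close>.

  As \<open>q\<close> is small, both together give \<open>sqrt N + q \<le> C d\<close>.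
\<close>

subsection \<open>Primitives of locally integrable functions\<close>

text \<open>Pinning \<open>u\<close> at \<open>1 / sqrt 3\<close> avoids both an implicit function
  theorem for the positions and a spectral gap computation. The value is the inflection value of the
  kink: there the slope is maximal and its logarithmic derivative, an exact Riccati solution for the
  linearisation, changes sign. Two different strict subsolutions may be glued at this point; their
  jump costs a multiple of \<open>g\<^sup>2\<close>, and \<open>g\<close> is there the tail of the
  other kink.

  The loop closes because coercivity is quadratic: inserted into the energy estimate it gives
  \<open>q \<le> C d + C (d\<^sup>2 + q\<^sup>2)\<close>, and the minimal separation makes the term
  in \<open>q\<^sup>2\<close> at most \<open>q / 2\<close>.

  Regularity is the other obstacle. As \<open>f\<close> is merely square integrable,
  \<open>u'\<close> is only absolutely continuous, and decay of \<open>g\<close> and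
  \<open>g'\<close> at infinity is not given pointwise. Calculus is therefore done with integral
  primitives, estimates are proved on finite intervals, and boundary terms vanish along suitable
  sequences of endpoints. All constants are explicit and far from optimal.\<close>

definition locally_integrable :: "(real \<Rightarrow> real) \<Rightarrow> bool" where
  "locally_integrable f \<longleftrightarrow> (\<forall>a b. f absolutely_integrable_on {a..b})"

text \<open>This encodes that \<open>F\<close> is locally absolutely continuous with almost
  everywhere derivative \<open>f\<close>. The integral form spares differentiation theorems and
  admits right hand sides that are only locally \<open>L\<^sup>2\<close>.\<close>

definition primitive :: "(real \<Rightarrow> real) \<Rightarrow> (real \<Rightarrow> real) \<Rightarrow> bool" where
  "primitive f F \<longleftrightarrow> locally_integrable f \<and> (\<forall>a b. a \<le> b \<longrightarrow> integral {a..b} f = F b - F a)"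

lemma locally_integrableD: "locally_integrable f \<Longrightarrow> f absolutely_integrable_on {a..b}"
  by (simp add: locally_integrable_def)

lemma locally_integrable_on: "locally_integrable f \<Longrightarrow> f integrable_on {a..b}"
  using locally_integrableD set_lebesgue_integral_eq_integral(1) by blast

lemma locally_integrable_abs_on: "locally_integrable f \<Longrightarrow> (\<lambda>x. \<bar>f x\<bar>) integrable_on {a..b}"
  using locally_integrableD[of f a b] unfolding absolutely_integrable_on_def by simp

lemma locally_integrable_continuous:
  "continuous_on UNIV f \<Longrightarrow> locally_integrable f"
  unfolding locally_integrable_def
  by (meson absolutely_integrable_continuous_real continuous_on_subset subset_UNIV)

lemma locally_integrable_add:
  "locally_integrable f \<Longrightarrow> locally_integrable g \<Longrightarrow> locally_integrable (\<lambda>x. f x + g x)"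
  unfolding locally_integrable_def by (auto intro: set_integral_add(1))

lemma locally_integrable_diff:
  "locally_integrable f \<Longrightarrow> locally_integrable g \<Longrightarrow> locally_integrable (\<lambda>x. f x - g x)"
  unfolding locally_integrable_def by (auto intro: set_integral_diff(1))

lemma locally_integrable_cmult_continuous:
  assumes h: "continuous_on UNIV h" and f: "locally_integrable f"
  shows "locally_integrable (\<lambda>x. h x * f x)"
  unfolding locally_integrable_def
proof (intro allI)
  fix a b :: real
  have h': "continuous_on {a..b} h" using h continuous_on_subset by blast
  show "(\<lambda>x. h x * f x) absolutely_integrable_on {a..b}"
  proof (rule absolutely_integrable_bounded_measurable_product_real)
    show "h \<in> borel_measurable (lebesgue_on {a..b})"
      by (rule continuous_imp_measurable_on_sets_lebesgue[OF h']) simp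
    show "bounded (h ` {a..b})"
      by (rule compact_imp_bounded[OF compact_continuous_image[OF h']]) simp
  qed (use f in \<open>auto simp: locally_integrable_def\<close>)
qed

lemma locally_integrable_mult_continuous:
  "locally_integrable f \<Longrightarrow> continuous_on UNIV h \<Longrightarrow> locally_integrable (\<lambda>x. f x * h x)"
  using locally_integrable_cmult_continuous[of h f] by (simp add: mult.commute)

lemma primitiveD:
  assumes "primitive f F"
  shows "locally_integrable f" "a \<le> b \<Longrightarrow> integral {a..b} f = F b - F a"
  using assms by (auto simp: primitive_def)

lemma primitive_continuous:
  assumes "primitive f F"
  shows "continuous_on UNIV F"
proof (rule continuous_at_imp_continuous_on, rule ballI)
  fix x :: real
  have "continuous_on {x-1..x+1} (\<lambda>t. F (x-1) + integral {x-1..t} f)"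
    by (intro continuous_intros indefinite_integral_continuous_1
        locally_integrable_on primitiveD[OF assms])
  then have "continuous_on {x-1..x+1} F"
    by (rule continuous_on_eq) (use primitiveD(2)[OF assms, of "x-1"] in auto)
  then have "continuous_on {x-1<..<x+1} F" by (rule continuous_on_subset) auto
  then show "isCont F x" by (subst (asm) continuous_on_eq_continuous_at) auto
qed

lemma primitive_deriv:
  assumes "\<And>x. (F has_real_derivative f x) (at x)" "continuous_on UNIV f"
  shows "primitive f F"
  unfolding primitive_def
proof (intro conjI allI impI)
  fix a b :: real assume "a \<le> b"
  then have "(f has_integral F b - F a) {a..b}"
    by (intro fundamental_theorem_of_calculus)
       (auto simp: has_real_derivative_iff_has_vector_derivative[symmetric]
         intro: assms(1)[THEN DERIV_subset])
  then show "integral {a..b} f = F b - F a" by blast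
qed (rule locally_integrable_continuous[OF assms(2)])

lemma primitive_imp_deriv:
  assumes "primitive f F" "continuous_on UNIV f"
  shows "(F has_real_derivative f x) (at x)"
proof -
  have c: "continuous_on {x-1..x+1} f" using assms(2) continuous_on_subset by blast
  have "((\<lambda>t. integral {x-1..t} f) has_real_derivative f x) (at x within {x-1..x+1})"
    by (rule integral_has_real_derivative[OF c]) auto
  then have "((\<lambda>t. F (x-1) + integral {x-1..t} f) has_real_derivative f x) (at x within {x-1..x+1})"
    by (auto intro!: derivative_eq_intros)
  then have "(F has_real_derivative f x) (at x within {x-1..x+1})"
    by (rule has_field_derivative_transform_within[where d=1])
       (use primitiveD(2)[OF assms(1), of "x-1"] in \<open>auto simp: dist_real_def\<close>)
  then show ?thesis
    by (simp add: at_within_Icc_at)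
qed

lemma primitive_exists:
  assumes "locally_integrable f"
  obtains F where "primitive f F"
proof
  \<comment> \<open>The integral over an empty interval is 0, so at most one of the two terms is
    nonzero and the difference is the signed integral from 0 to \<open>x\<close>.\<close>
  show "primitive f (\<lambda>x. integral {0..x} f - integral {x..0} f)"
    unfolding primitive_def
  proof (intro conjI allI impI)
    fix a b :: real assume ab: "a \<le> b"
    note i = locally_integrable_on[OF assms]
    consider "0 \<le> a" | "b \<le> 0" | "a < 0" "0 < b" by linarith
    then show "integral {a..b} f
      = integral {0..b} f - integral {b..0} f - (integral {0..a} f - integral {a..0} f)"
    proof cases
      case 1
      then show ?thesis using ab Henstock_Kurzweil_Integration.integral_combine[of 0 a b f, OF _ _ i]
        by (cases "a = 0"; cases "b = 0") auto
    next
      case 2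
      then show ?thesis using ab Henstock_Kurzweil_Integration.integral_combine[of a b 0 f, OF _ _ i]
        by (cases "a = 0"; cases "b = 0") auto
    next
      case 3
      then show ?thesis using ab Henstock_Kurzweil_Integration.integral_combine[of a 0 b f, OF _ _ i] by auto
    qed
  qed (rule assms)
qed

lemma primitive_add:
  assumes "primitive f F" "primitive g G"
  shows "primitive (\<lambda>x. f x + g x) (\<lambda>x. F x + G x)"
  using assms locally_integrable_on[of f] locally_integrable_on[of g]
  by (auto simp: primitive_def locally_integrable_add integral_add)

lemma primitive_diff:
  assumes "primitive f F" "primitive g G"
  shows "primitive (\<lambda>x. f x - g x) (\<lambda>x. F x - G x)"
  using assms locally_integrable_on[of f] locally_integrable_on[of g]
  by (auto simp: primitive_def locally_integrable_diff integral_diff)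

lemma primitive_cong:
  assumes "primitive f F" "\<And>x. f x = f' x" "\<And>x. F x = F' x"
  shows "primitive f' F'"
proof -
  have "f = f'" "F = F'" using assms by auto
  then show ?thesis using assms by simp
qed

text \<open>Cut \<open>{a..b}\<close> into \<open>Suc n\<close> pieces on each of which
  \<open>S\<close> grows by \<open>D / Suc n\<close>. Each contributes at most
  \<open>K * (D / Suc n)\<^sup>2\<close>, so the total is at most
  \<open>K * D\<^sup>2 / Suc n\<close>, which tends to 0.\<close>

lemma quadratic_variation_zero:
  fixes \<Phi> S :: "real \<Rightarrow> real"
  assumes ab: "a \<le> b" and S: "continuous_on {a..b} S" "mono_on {a..b} S"
    and le: "\<And>x y. a \<le> x \<Longrightarrow> x \<le> y \<Longrightarrow> y \<le> b \<Longrightarrow> \<bar>\<Phi> y - \<Phi> x\<bar> \<le> K * (S y - S x)\<^sup>2"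
  shows "\<Phi> b = \<Phi> a"
proof -
  define D where "D = S b - S a"
  have D0: "D \<ge> 0" using S(2) ab by (auto simp: D_def mono_on_def)
  have bound: "\<bar>\<Phi> b - \<Phi> a\<bar> \<le> K * D\<^sup>2 / real (Suc n)" for n
  proof -
    define N where "N = real (Suc n)"
    have N0: "N > 0" by (simp add: N_def)
    \<comment> \<open>The partition points have equal steps in the value of \<open>S\<close>, not in
      the argument, since no modulus of continuity of \<open>S\<close> is at hand.\<close>
    have "\<exists>t. a \<le> t \<and> t \<le> b \<and> S t = S a + real i * D / N" if "i \<le> Suc n" for i
    proof (rule IVT'[OF _ _ ab S(1)])
      show "S a \<le> S a + real i * D / N" using D0 N0 by simp
      have "real i * D \<le> N * D" using that D0 by (intro mult_right_mono) (auto simp: N_def)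
      then have "real i * D / N \<le> D" using N0 by (simp add: field_simps)
      then show "S a + real i * D / N \<le> S b" by (simp add: D_def)
    qed
    then obtain t where t: "\<And>i. i \<le> Suc n \<Longrightarrow> a \<le> t i \<and> t i \<le> b \<and> S (t i) = S a + real i * D / N"
      by metis
    have near: "\<bar>\<Phi> y - \<Phi> x\<bar> \<le> K * (S y - S x)\<^sup>2" if "x \<in> {a..b}" "y \<in> {a..b}" for x y
    proof (cases "x \<le> y")
      case True then show ?thesis using le that by auto
    next
      case False
      then show ?thesis using le[of y x] that by (auto simp: abs_minus_commute power2_commute)
    qed
    \<comment> \<open>The extreme partition points may differ from \<open>a\<close> and
      \<open>b\<close>, but \<open>S\<close> takes the same values there, hence so does
      \<open>\<Phi>\<close>.\<close>
    have eqb: "\<Phi> (t (Suc n)) = \<Phi> b" and eqa: "\<Phi> (t 0) = \<Phi> a"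
      using near[of "t (Suc n)" b] near[of "t 0" a] t[of 0] t[of "Suc n"] ab
      by (auto simp: D_def N_def)
    have step: "\<bar>\<Phi> (t (Suc i)) - \<Phi> (t i)\<bar> \<le> K * (D/N)\<^sup>2" if "i \<le> n" for i
    proof -
      have "S (t (Suc i)) - S (t i) = D / N"
        using t[of i] t[of "Suc i"] that N0 by (simp add: field_simps)
      then show ?thesis using near[of "t i" "t (Suc i)"] t[of i] t[of "Suc i"] that by auto
    qed
    have "\<bar>\<Phi> (t k) - \<Phi> (t 0)\<bar> \<le> real k * (K * (D/N)\<^sup>2)" if "k \<le> Suc n" for k
      using that
    proof (induction k)
      case (Suc k)
      then show ?case using step[of k] by (auto simp: algebra_simps)
    qed simp
    from this[of "Suc n"] show ?thesis
      using N0 unfolding eqa eqb N_def[symmetric] by (simp add: power2_eq_square)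
  qed
  have "(\<lambda>n. K * D\<^sup>2 / real (Suc n)) \<longlonglongrightarrow> 0"
    by (intro LIMSEQ_Suc lim_const_over_n)
  then have "\<bar>\<Phi> b - \<Phi> a\<bar> \<le> 0"
    by (rule LIMSEQ_le_const) (use bound in auto)
  then show ?thesis by simp
qed

text \<open>Let \<open>P\<close> be a primitive of \<open>f G + F g\<close>. Over
  \<open>{x..y}\<close> the function \<open>F G - P\<close> changes by an integral whose integrand
  contains a difference of \<open>F\<close> or of \<open>G\<close>, and both are dominated by
  increments of a primitive \<open>S\<close> of \<open>\<bar>f\<bar> + \<bar>g\<bar>\<close>. The
  change is thus quadratic in the increment of \<open>S\<close>, and
  \<open>quadratic_variation_zero\<close> applies.\<close>

lemma primitive_mult:
  assumes F: "primitive f F" and G: "primitive g G"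
  shows "primitive (\<lambda>x. f x * G x + F x * g x) (\<lambda>x. F x * G x)"
proof -
  note cF = primitive_continuous[OF F] and cG = primitive_continuous[OF G]
  note lf = primitiveD(1)[OF F] and lg = primitiveD(1)[OF G]
  have lfG: "locally_integrable (\<lambda>x. f x * G x)" 
    using locally_integrable_mult_continuous lf cG by blast
  have lFg: "locally_integrable (\<lambda>x. F x * g x)" 
    using locally_integrable_cmult_continuous lg cF by blast
  have li: "locally_integrable (\<lambda>x. f x * G x + F x * g x)"
    by (intro locally_integrable_add lfG lFg)
  obtain P where P: "primitive (\<lambda>x. f x * G x + F x * g x) P" using primitive_exists[OF li] .
  have laf: "locally_integrable (\<lambda>x. \<bar>f x\<bar> + \<bar>g x\<bar>)"
    using lf lg unfolding locally_integrable_def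
    by (auto intro!: set_integral_add(1) set_integrable_abs)
  obtain S where S: "primitive (\<lambda>x. \<bar>f x\<bar> + \<bar>g x\<bar>) S" using primitive_exists[OF laf] .
  have Smono: "S x \<le> S y" if "x \<le> y" for x y
  proof -
    have "0 \<le> integral {x..y} (\<lambda>x. \<bar>f x\<bar> + \<bar>g x\<bar>)"
      by (rule integral_nonneg[OF locally_integrable_on[OF laf]]) auto
    then show ?thesis using primitiveD(2)[OF S that] by linarith
  qed
  have fS: "\<bar>F y - F x\<bar> \<le> S y - S x" if xy: "x \<le> y" for x y
  proof -
    have "norm (integral {x..y} f) \<le> integral {x..y} (\<lambda>x. \<bar>f x\<bar> + \<bar>g x\<bar>)"
      by (rule integral_norm_bound_integral[OF locally_integrable_on[OF lf] locally_integrable_on[OF laf]]) auto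
    then show ?thesis using primitiveD(2)[OF S xy] primitiveD(2)[OF F xy] by simp
  qed
  have gS: "\<bar>G y - G x\<bar> \<le> S y - S x" if xy: "x \<le> y" for x y
  proof -
    have "norm (integral {x..y} g) \<le> integral {x..y} (\<lambda>x. \<bar>f x\<bar> + \<bar>g x\<bar>)"
      by (rule integral_norm_bound_integral[OF locally_integrable_on[OF lg] locally_integrable_on[OF laf]]) auto
    then show ?thesis using primitiveD(2)[OF S xy] primitiveD(2)[OF G xy] by simp
  qed
  have "F b * G b - P b = F a * G a - P a" if ab: "a \<le> b" for a b
  proof (rule quadratic_variation_zero[OF ab, where K=1 and \<Phi> = "\<lambda>x. F x * G x - P x" and S=S])
    show "continuous_on {a..b} S" using primitive_continuous[OF S] continuous_on_subset by blast
    show "mono_on {a..b} S" using Smono by (auto simp: mono_on_def)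
  next
    fix x y assume "a \<le> x" "x \<le> y" "y \<le> b"
    \<comment> \<open>This comes from \<open>F y * G y - F x * G x = (F y - F x) * G y + F x * (G y
      - G x)\<close>, with the increments written as integrals of \<open>f\<close> and
      \<open>g\<close> and the integrand of \<open>P\<close> subtracted.\<close>
    let ?k = "\<lambda>t. f t * (G y - G t) + (F x - F t) * g t"
    have l1: "locally_integrable (\<lambda>t. f t * (G y - G t))"
      by (intro locally_integrable_mult_continuous lf continuous_intros cG)
    have l2: "locally_integrable (\<lambda>t. (F x - F t) * g t)"
      by (intro locally_integrable_cmult_continuous lg continuous_intros cF)
    have lk: "locally_integrable ?k"
      using locally_integrable_add[OF l1 l2] .
    have 1: "integral {x..y} (\<lambda>t. f t * G y) = (F y - F x) * G y"
      using primitiveD(2)[OF F \<open>x \<le> y\<close>] by simp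
    have 2: "integral {x..y} (\<lambda>t. F x * g t) = F x * (G y - G x)"
      using primitiveD(2)[OF G \<open>x \<le> y\<close>] by simp
    have "integral {x..y} ?k = integral {x..y} (\<lambda>t. (f t * G y + F x * g t) - (f t * G t + F t * g t))"
      by (rule arg_cong[where f="integral _"]) (auto simp: algebra_simps)
    also have "\<dots> = integral {x..y} (\<lambda>t. f t * G y + F x * g t) - (P y - P x)"
      using primitiveD(2)[OF P \<open>x \<le> y\<close>]
      by (subst integral_diff)
         (use locally_integrable_on[OF lf] locally_integrable_on[OF lg] locally_integrable_on[OF li]
            in \<open>auto intro!: integrable_add integrable_on_mult_left integrable_on_mult_right\<close>)
    also have "integral {x..y} (\<lambda>t. f t * G y + F x * g t) = (F y - F x) * G y + F x * (G y - G x)"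
      using 1 2 by (subst integral_add)
         (use locally_integrable_on[OF lf] locally_integrable_on[OF lg]
            in \<open>auto intro!: integrable_on_mult_left integrable_on_mult_right\<close>)
    finally have eq: "(F y * G y - P y) - (F x * G x - P x) = integral {x..y} ?k"
      by (simp add: algebra_simps)
    have "norm (integral {x..y} ?k) \<le> integral {x..y} (\<lambda>t. (S y - S x) * (\<bar>f t\<bar> + \<bar>g t\<bar>))"
    proof (rule integral_norm_bound_integral)
      show "?k integrable_on {x..y}" by (rule locally_integrable_on[OF lk])
      show "(\<lambda>t. (S y - S x) * (\<bar>f t\<bar> + \<bar>g t\<bar>)) integrable_on {x..y}"
        by (intro integrable_on_mult_right locally_integrable_on[OF laf])
      fix t assume t: "t \<in> {x..y}"
      have "\<bar>G y - G t\<bar> \<le> S y - S x" using gS[of t y] Smono[of x t] t by auto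
      moreover have "\<bar>F x - F t\<bar> \<le> S y - S x" using fS[of x t] Smono[of t y] t by auto
      ultimately have "\<bar>f t * (G y - G t)\<bar> \<le> \<bar>f t\<bar> * (S y - S x)" "\<bar>(F x - F t) * g t\<bar> \<le> (S y - S x) * \<bar>g t\<bar>"
        by (auto simp: abs_mult intro!: mult_left_mono mult_right_mono)
      then have "\<bar>f t * (G y - G t) + (F x - F t) * g t\<bar> \<le> \<bar>f t\<bar> * (S y - S x) + (S y - S x) * \<bar>g t\<bar>"
        by linarith
      then show "norm (?k t) \<le> (S y - S x) * (\<bar>f t\<bar> + \<bar>g t\<bar>)"
        by (simp add: distrib_left mult.commute)
    qed
    also have "\<dots> = (S y - S x)\<^sup>2"
      using primitiveD(2)[OF S \<open>x \<le> y\<close>] by (simp add: power2_eq_square)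
    finally show "\<bar>F y * G y - P y - (F x * G x - P x)\<bar> \<le> 1 * (S y - S x)\<^sup>2"
      by (simp add: eq)
  qed
  then have "F b * G b - F a * G a = P b - P a" if "a \<le> b" for a b
    using that by (simp add: algebra_simps)
  then show ?thesis using P unfolding primitive_def by simp
qed

subsection \<open>Test functions and the lemma of du Bois-Reymond\<close>

text \<open>A derivative is exhibited at each level, so closure under sums, products and affine
  substitution is an induction with explicit witnesses instead of a computation with iterated
  \<open>deriv\<close>.\<close>

fun diff_times :: "nat \<Rightarrow> (real \<Rightarrow> real) \<Rightarrow> bool" where
  "diff_times 0 f \<longleftrightarrow> True"
| "diff_times (Suc k) f \<longleftrightarrow> (\<exists>f'. (\<forall>x. (f has_real_derivative f' x) (at x)) \<and> diff_times k f')"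

lemma diff_times_Suc_imp: "diff_times (Suc k) f \<Longrightarrow> diff_times k f"
proof (induction k arbitrary: f)
  case (Suc k)
  then show ?case by (metis diff_times.simps(2))
qed simp

lemma diff_times_const: "diff_times k (\<lambda>x. c)"
proof (induction k arbitrary: c)
  case (Suc k)
  show ?case unfolding diff_times.simps
    by (rule exI[of _ "\<lambda>_. 0"]) (use Suc[of 0] in auto)
qed simp

lemma diff_times_add: "diff_times k f \<Longrightarrow> diff_times k g \<Longrightarrow> diff_times k (\<lambda>x. f x + g x)"
proof (induction k arbitrary: f g)
  case (Suc k)
  from Suc.prems obtain f' g' where "\<forall>x. (f has_real_derivative f' x) (at x)" "diff_times k f'"
    "\<forall>x. (g has_real_derivative g' x) (at x)" "diff_times k g'" by auto
  then show ?case unfolding diff_times.simps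
    by (intro exI[of _ "\<lambda>x. f' x + g' x"]) (use Suc.IH in \<open>auto intro: DERIV_add\<close>)
qed simp

lemma diff_times_mult: "diff_times k f \<Longrightarrow> diff_times k g \<Longrightarrow> diff_times k (\<lambda>x. f x * g x)"
proof (induction k arbitrary: f g)
  case (Suc k)
  from Suc.prems obtain f' g' where d: "\<forall>x. (f has_real_derivative f' x) (at x)" "diff_times k f'"
    "\<forall>x. (g has_real_derivative g' x) (at x)" "diff_times k g'" by auto
  have "diff_times k f" "diff_times k g" using Suc.prems diff_times_Suc_imp by blast+
  then have "diff_times k (\<lambda>x. f' x * g x + f x * g' x)"
    using d Suc.IH diff_times_add by simp
  moreover have "\<forall>x. ((\<lambda>x. f x * g x) has_real_derivative (f' x * g x + f x * g' x)) (at x)"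
    using d by (auto intro!: derivative_eq_intros)
  ultimately show ?case unfolding diff_times.simps by (intro exI conjI)
qed simp

lemma diff_times_affine: "diff_times k f \<Longrightarrow> diff_times k (\<lambda>x. f (a * x + b))"
proof (induction k arbitrary: f)
  case (Suc k)
  from Suc.prems obtain f' where d: "\<And>x. (f has_real_derivative f' x) (at x)" "diff_times k f'" by auto
  have "diff_times k (\<lambda>x. a * f' (a * x + b))"
    using d Suc.IH diff_times_mult[OF diff_times_const] by simp
  moreover have "\<forall>x. ((\<lambda>x. f (a * x + b)) has_real_derivative (a * f' (a * x + b))) (at x)"
  proof
    fix x
    have "((\<lambda>x. a * x + b) has_real_derivative a) (at x)"
      by (auto intro!: derivative_eq_intros)
    then show "((\<lambda>x. f (a * x + b)) has_real_derivative (a * f' (a * x + b))) (at x)"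
      using DERIV_chain2[OF d(1), of "\<lambda>x. a * x + b" a x UNIV] by (simp add: mult.commute[of a "f' _"])
  qed
  ultimately show ?case unfolding diff_times.simps by (intro exI conjI)
qed simp

lemma diff_times_imp_field_differentiable:
  "diff_times (Suc k) f \<Longrightarrow> (deriv ^^ k) f field_differentiable (at x)"
proof (induction k arbitrary: f)
  case 0
  then show ?case by (auto simp: field_differentiable_def)
next
  case (Suc k)
  then obtain f' where f': "\<forall>x. (f has_real_derivative f' x) (at x)" "diff_times (Suc k) f'"
    by (subst (asm) diff_times.simps) blast
  then have "deriv f = f'" by (auto intro: DERIV_imp_deriv)
  then show ?case using Suc.IH[OF f'(2)] by (simp add: funpow_swap1)
qed

lemma test_funI:
  assumes "\<And>k. diff_times k \<phi>" "\<And>x. \<bar>x\<bar> > R \<Longrightarrow> \<phi> x = 0"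
  shows "\<phi> \<in> test_fun"
proof -
  have "bounded {x. \<phi> x \<noteq> 0}"
    unfolding bounded_iff using assms(2) by (intro exI[of _ R]) force
  then show ?thesis
    using diff_times_imp_field_differentiable[OF assms(1)] by (auto simp: test_fun_def)
qed

lemma test_fun_DERIV:
  assumes "\<phi> \<in> test_fun"
  shows "(\<phi> has_real_derivative deriv \<phi> x) (at x)"
proof -
  have "(deriv ^^ 0) \<phi> field_differentiable (at x)" using assms unfolding test_fun_def by blast
  then show ?thesis by (simp add: DERIV_deriv_iff_field_differentiable)
qed

lemma test_fun_support:
  assumes "\<phi> \<in> test_fun"
  obtains R where "R > 0" "\<And>x. \<bar>x\<bar> \<ge> R \<Longrightarrow> \<phi> x = 0" "\<And>x. \<bar>x\<bar> \<ge> R \<Longrightarrow> deriv \<phi> x = 0"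
proof -
  have "bounded {x. \<phi> x \<noteq> 0}" using assms by (auto simp: test_fun_def)
  then obtain R where R: "R > 0" "\<And>x. \<phi> x \<noteq> 0 \<Longrightarrow> \<bar>x\<bar> \<le> R"
    by (auto simp: bounded_pos)
  \<comment> \<open>Enlarging the radius by 1 leaves a unit ball around \<open>x\<close> on which
    \<open>\<phi>\<close> vanishes.\<close>
  have "deriv \<phi> x = 0" if "\<bar>x\<bar> \<ge> R + 1" for x
  proof -
    have "(\<phi> has_real_derivative 0) (at x)"
    proof (rule has_field_derivative_transform_within[where d=1 and f="\<lambda>_. 0"])
      fix y assume "dist y x < 1"
      then have "\<bar>y\<bar> > R" using that by (auto simp: dist_real_def)
      then show "0 = \<phi> y" using R(2)[of y] by force
    qed auto
    then show ?thesis by (rule DERIV_imp_deriv)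
  qed
  then show ?thesis using that[of "R+1"] R by force
qed

lemma test_fun_deriv:
  assumes "\<phi> \<in> test_fun"
  shows "deriv \<phi> \<in> test_fun"
proof -
  obtain R where R: "R > 0" "\<And>x. \<bar>x\<bar> \<ge> R \<Longrightarrow> deriv \<phi> x = 0"
    using test_fun_support[OF assms] by metis
  have "bounded {x. deriv \<phi> x \<noteq> 0}"
    unfolding bounded_iff using R(2) by (intro exI[of _ R]) force
  moreover have "(deriv ^^ k) (deriv \<phi>) field_differentiable (at x)" for k x
  proof -
    have "(deriv ^^ (Suc k)) \<phi> field_differentiable (at x)" using assms unfolding test_fun_def by blast
    then show ?thesis by (simp add: funpow_swap1)
  qed
  ultimately show ?thesis by (auto simp: test_fun_def)
qed

lemma test_fun_continuous:
  assumes "\<phi> \<in> test_fun"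
  shows "continuous_on UNIV \<phi>"
  using test_fun_DERIV[OF assms] DERIV_continuous_on by blast

section \<open>Smooth bump functions\<close>

definition exp_inv :: "real poly \<Rightarrow> real \<Rightarrow> real" where
  "exp_inv p x = (if x > 0 then poly p (1/x) * exp (- (1/x)) else 0)"

lemma poly_exp_minus_tendsto_0:
  fixes p :: "real poly"
  shows "((\<lambda>t. poly p t * exp (- t)) \<longlongrightarrow> 0) at_top"
proof -
  have "((\<lambda>t::real. \<Sum>i\<le>degree p. coeff p i * (t ^ i / exp t)) \<longlongrightarrow> (\<Sum>i\<le>degree p. coeff p i * 0)) at_top"
    by (intro tendsto_sum tendsto_mult tendsto_const tendsto_power_div_exp_0)
  then show ?thesis
    by (simp add: poly_altdef exp_minus field_simps sum_distrib_right sum_divide_distrib)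
qed

text \<open>With \<open>t = 1 / x\<close>, the derivative of \<open>p(t) exp(-t)\<close> in
  \<open>x\<close> is \<open>t\<^sup>2 (p(t) - p'(t)) exp(-t)\<close>, so the class
  \<open>exp_inv\<close> is closed under differentiation. At 0 the right difference quotient is
  \<open>t p(t) exp(-t)\<close>, which tends to 0.\<close>

lemma exp_inv_DERIV:
  "(exp_inv p has_real_derivative exp_inv ([:0,0,1:] * (p - pderiv p)) x) (at x)"
proof -
  consider "x < 0" | "x > 0" | "x = 0" by linarith
  then show ?thesis
  proof cases
    case 1
    have "(exp_inv p has_real_derivative 0) (at x)"
      by (rule has_field_derivative_transform_within[where d="-x" and f="\<lambda>_. 0"])
         (use 1 in \<open>auto simp: exp_inv_def dist_real_def\<close>)
    then show ?thesis using 1 by (simp add: exp_inv_def)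
  next
    case 2
    have "((\<lambda>x. poly p (1/x) * exp (- (1/x))) has_real_derivative
        exp_inv ([:0,0,1:] * (p - pderiv p)) x) (at x)"
      using 2 by (auto intro!: derivative_eq_intros DERIV_chain2[OF poly_DERIV]
          simp: exp_inv_def field_simps power2_eq_square)
    then show ?thesis
      by (rule has_field_derivative_transform_within[where d=x])
         (use 2 in \<open>auto simp: exp_inv_def dist_real_def\<close>)
  next
    case 3
    have "((\<lambda>h. (exp_inv p h) / h) \<longlongrightarrow> 0) (at_right 0)"
    proof -
      have "((\<lambda>h. poly (pCons 0 p) (inverse h) * exp (- inverse h)) \<longlongrightarrow> 0) (at_right 0)"
        by (rule filterlim_compose[OF poly_exp_minus_tendsto_0 filterlim_inverse_at_top_right])
      then show ?thesis
        by (rule Lim_transform_eventually)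
           (auto simp: eventually_at_right_less exp_inv_def field_simps
             intro!: eventually_mono[OF eventually_at_right_less])
    qed
    moreover have "((\<lambda>h. (exp_inv p h) / h) \<longlongrightarrow> 0) (at_left 0)"
      by (rule Lim_transform_eventually[of "\<lambda>_. 0"])
         (auto simp: exp_inv_def eventually_at_left_field intro!: exI[of _ "-1"])
    ultimately have "((\<lambda>h. (exp_inv p h) / h) \<longlongrightarrow> 0) (at 0)"
      by (simp add: filterlim_split_at)
    then show ?thesis using 3 by (simp add: DERIV_def exp_inv_def)
  qed
qed

lemma exp_inv_diff_times: "diff_times k (exp_inv p)"
  by (induction k arbitrary: p) (use exp_inv_DERIV in auto)

lemma exp_inv_1: "0 \<le> exp_inv 1 x" "exp_inv 1 x \<le> 1" "x \<le> 0 \<Longrightarrow> exp_inv 1 x = 0"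
  by (auto simp: exp_inv_def)

text \<open>A smooth stand-in for the indicator of the open interval from \<open>s\<close> to
  \<open>t\<close>: it vanishes outside and tends to 1 inside as \<open>n\<close> grows, because the
  rescaled arguments of \<open>exp_inv 1\<close> tend to infinity.\<close>

definition bump :: "real \<Rightarrow> real \<Rightarrow> nat \<Rightarrow> real \<Rightarrow> real" where
  "bump s t n x = exp_inv 1 (real (Suc n) * x + - real (Suc n) * s) * exp_inv 1 (- real (Suc n) * x + real (Suc n) * t)"

lemma bump_diff_times: "diff_times k (bump s t n)"
  unfolding bump_def[abs_def] by (intro diff_times_mult diff_times_affine exp_inv_diff_times)

lemma bump_bounds: "0 \<le> bump s t n x" "bump s t n x \<le> 1"
  unfolding bump_def by (auto intro!: mult_nonneg_nonneg mult_le_one exp_inv_1)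

lemma bump_zero: "x \<le> s \<or> x \<ge> t \<Longrightarrow> bump s t n x = 0"
proof -
  assume "x \<le> s \<or> x \<ge> t"
  then have "real (Suc n) * x + - real (Suc n) * s \<le> 0 \<or> - real (Suc n) * x + real (Suc n) * t \<le> 0"
    using mult_left_mono[of x s "real (Suc n)"] mult_left_mono[of t x "real (Suc n)"]
    by (auto simp del: of_nat_Suc)
  then show ?thesis unfolding bump_def by (metis exp_inv_1(3) mult_eq_0_iff)
qed

lemma exp_inv_1_scaled_tendsto:
  assumes "c > 0"
  shows "(\<lambda>n. exp_inv 1 (real (Suc n) * c)) \<longlonglongrightarrow> 1"
proof -
  have "(\<lambda>n. exp (- ((1/c) / real (Suc n)))) \<longlonglongrightarrow> exp (- 0)"
    by (intro tendsto_exp tendsto_minus LIMSEQ_Suc lim_const_over_n)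
  then show ?thesis using assms by (simp add: exp_inv_def zero_less_mult_iff mult.commute del: of_nat_Suc)
qed

lemma bump_tendsto:
  assumes "s < x" "x < t"
  shows "(\<lambda>n. bump s t n x) \<longlonglongrightarrow> 1"
proof -
  have "(\<lambda>n. exp_inv 1 (real (Suc n) * (x - s)) * exp_inv 1 (real (Suc n) * (t - x))) \<longlonglongrightarrow> 1 * 1"
    using assms by (intro tendsto_mult exp_inv_1_scaled_tendsto) auto
  then show ?thesis by (simp add: bump_def algebra_simps del: of_nat_Suc)
qed

lemma bump_continuous: "continuous_on UNIV (bump s t n)"
proof -
  have "diff_times (Suc 0) (bump s t n)" by (rule bump_diff_times)
  then show ?thesis by (auto intro: DERIV_continuous_on)
qed

lemma bump_integral_tendsto:
  assumes h: "locally_integrable h" and A: "-A \<le> s" "s \<le> t" "t \<le> A"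
  shows "(\<lambda>n. integral {-A..A} (\<lambda>x. h x * bump s t n x)) \<longlonglongrightarrow> integral {s..t} h"
proof -
  let ?g = "\<lambda>x. if x \<in> {s<..<t} then h x else 0"
  have "(\<lambda>n. integral {-A..A} (\<lambda>x. h x * bump s t n x)) \<longlonglongrightarrow> integral {-A..A} ?g"
  proof (rule dominated_convergence(2))
    show "(\<lambda>x. h x * bump s t n x) integrable_on {-A..A}" for n
      by (intro locally_integrable_on locally_integrable_mult_continuous h bump_continuous)
    show "(\<lambda>x. \<bar>h x\<bar>) integrable_on {-A..A}"
      by (rule locally_integrable_abs_on[OF h])
    show "norm (h x * bump s t n x) \<le> \<bar>h x\<bar>" for n x
      using bump_bounds[of s t n x] by (simp add: abs_mult mult_left_le)
    show "(\<lambda>n. h x * bump s t n x) \<longlonglongrightarrow> ?g x" for x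
    proof (cases "x \<in> {s<..<t}")
      case True
      then have "(\<lambda>n. h x * bump s t n x) \<longlonglongrightarrow> h x * 1"
        by (intro tendsto_mult bump_tendsto) auto
      with True show ?thesis by simp
    next
      case False
      then have "bump s t n x = 0" for n by (intro bump_zero) auto
      then show ?thesis using False by auto
    qed
  qed
  also have "integral {-A..A} ?g = integral ({-A..A} \<inter> {s<..<t}) h"
    by (subst Henstock_Kurzweil_Integration.integral_restrict_Int) (simp add: Int_commute)
  also have "{-A..A} \<inter> {s<..<t} = {s<..<t}" using A by auto
  also have "integral {s<..<t} h = integral {s..t} h" by (simp add: integral_open_interval_real)
  finally show ?thesis .
qed

lemma LINT_bounded_support:
  assumes k: "locally_integrable k" and z: "\<And>x. \<bar>x\<bar> > R \<Longrightarrow> k x = 0"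
  shows "(LINT x|lebesgue. k x) = integral {-R..R} k"
proof -
  have "(\<lambda>x. indicator {-R..R} x *\<^sub>R k x) = k"
    using z by (force simp: indicator_def)
  then have "(LINT x|lebesgue. k x) = (LINT x:{-R..R}|lebesgue. k x)"
    by (simp add: set_lebesgue_integral_def)
  then show ?thesis using set_lebesgue_integral_eq_integral(2)[OF locally_integrableD[OF k]] by simp
qed

text \<open>Henstock's lemma replaces Lebesgue differentiation: as the integrals of \<open>h\<close>
  over intervals vanish, the error terms of a fine tagged division are exactly the terms of the
  Riemann sum of \<open>\<bar>h\<bar>\<close>. Hence \<open>\<bar>h\<bar>\<close> has integral 0 on
  every interval.\<close>

lemma zero_integrals_imp_AE_zero:
  assumes h: "locally_integrable h" and z: "\<And>a b. a \<le> b \<Longrightarrow> integral {a..b} h = 0"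
  shows "AE x in lebesgue. h x = 0"
proof -
  have z': "integral {a..b} h = 0" for a b using z[of a b] by (cases "a \<le> b") auto
  have "((\<lambda>x. \<bar>h x\<bar>) has_integral 0) (cbox a b)" for a b
    unfolding has_integral
  proof (intro allI impI)
    fix e :: real assume "e > 0"
    have hi: "h integrable_on cbox a b" using locally_integrable_on[OF h] by simp
    obtain \<gamma> where \<gamma>: "gauge \<gamma>"
      "\<And>p. p tagged_partial_division_of cbox a b \<Longrightarrow> \<gamma> fine p \<Longrightarrow>
        (\<Sum>(x,k)\<in>p. norm (measure lborel k *\<^sub>R h x - integral k h)) < e"
      using Henstock_lemma[OF hi \<open>e > 0\<close>] by blast
    show "\<exists>\<gamma>. gauge \<gamma> \<and> (\<forall>\<D>. \<D> tagged_division_of cbox a b \<and> \<gamma> fine \<D> \<longrightarrow>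
        norm ((\<Sum>(x,k)\<in>\<D>. measure lborel k *\<^sub>R \<bar>h x\<bar>) - 0) < e)"
    proof (intro exI[of _ \<gamma>] conjI allI impI \<gamma>(1))
      fix \<D> assume D: "\<D> tagged_division_of cbox a b \<and> \<gamma> fine \<D>"
      have "(\<Sum>(x,k)\<in>\<D>. measure lborel k *\<^sub>R \<bar>h x\<bar>) = (\<Sum>(x,k)\<in>\<D>. norm (measure lborel k *\<^sub>R h x - integral k h))"
      proof (rule sum.cong, rule refl, clarify)
        fix x k assume xk: "(x, k) \<in> \<D>"
        then obtain c d where "k = cbox c d" using D tagged_division_ofD(4) by metis
        then show "measure lborel k *\<^sub>R \<bar>h x\<bar> = norm (measure lborel k *\<^sub>R h x - integral k h)"
          by (simp add: z' abs_mult)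
      qed
      moreover have "\<dots> < e" using \<gamma>(2) D tagged_division_of_def by blast
      moreover have "(\<Sum>(x,k)\<in>\<D>. measure lborel k *\<^sub>R \<bar>h x\<bar>) \<ge> 0" by (rule sum_nonneg) auto
      ultimately show "norm ((\<Sum>(x,k)\<in>\<D>. measure lborel k *\<^sub>R \<bar>h x\<bar>) - 0) < e" by simp
    qed
  qed
  then have i0: "integral {a..b} (\<lambda>x. \<bar>h x\<bar>) = 0" for a b :: real
    using integral_unique by (metis box_real(2))
  have "AE x in lebesgue. x \<in> {-real n..real n} \<longrightarrow> h x = 0" for n
  proof -
    have ai: "(\<lambda>x. \<bar>h x\<bar>) absolutely_integrable_on {-real n..real n}"
      using locally_integrableD[OF h] by (rule set_integrable_abs)
    have "(LINT x:{-real n..real n}|lebesgue. \<bar>h x\<bar>) = 0"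
      using set_lebesgue_integral_eq_integral(2)[OF ai] i0 by simp
    then have "AE x in lebesgue. indicator {-real n..real n} x *\<^sub>R \<bar>h x\<bar> = 0"
      unfolding set_lebesgue_integral_def
      by (subst (asm) integral_nonneg_eq_0_iff_AE) (use ai in \<open>auto simp: set_integrable_def\<close>)
    then show ?thesis by (rule AE_mp) (auto simp: indicator_def)
  qed
  then have "AE x in lebesgue. \<forall>n. x \<in> {-real n..real n} \<longrightarrow> h x = 0"
    unfolding AE_all_countable by blast
  then show ?thesis
  proof (rule AE_mp, intro AE_I2 impI)
    fix x assume "\<forall>n. x \<in> {-real n..real n} \<longrightarrow> h x = 0"
    moreover obtain n where "\<bar>x\<bar> \<le> real n" using real_arch_simple by blast
    ultimately show "h x = 0" by (metis abs_le_iff atLeastAtMost_iff minus_le_iff)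
  qed
qed

text \<open>Derivatives of test functions have mean zero. Weighting a bump on \<open>{s..t}\<close>
  and one on \<open>{0..1}\<close> to total mean zero and sharpening both gives
  \<open>integral {s..t} h = (t - s) * c\<close>, with \<open>c\<close> the mean of \<open>h\<close>
  over the unit interval; so \<open>h - c\<close> has vanishing integrals.\<close>

lemma du_Bois_Reymond:
  assumes h: "locally_integrable h"
    and z: "\<And>\<phi>. \<phi> \<in> test_fun \<Longrightarrow> (LINT x|lebesgue. h x * deriv \<phi> x) = 0"
  shows "\<exists>c. AE x in lebesgue. h x = c"
proof -
  define c where "c = integral {0..1} h"
  have "integral {s..t} h = (t - s) * c" if st: "s \<le> t" for s t
  proof -
    define A where "A = \<bar>s\<bar> + \<bar>t\<bar> + 1"
    define \<alpha> where "\<alpha> n = integral {-A..A} (bump s t n)" for n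
    define \<beta> where "\<beta> n = integral {-A..A} (bump 0 1 n)" for n
    have A: "-A \<le> s" "t \<le> A" "-A \<le> 0" "1 \<le> A" by (auto simp: A_def)
    have key: "\<beta> n * integral {-A..A} (\<lambda>x. h x * bump s t n x)
        = \<alpha> n * integral {-A..A} (\<lambda>x. h x * bump 0 1 n x)" for n
    proof -
      \<comment> \<open>Each bump is weighted by the mass of the other, so \<open>b\<close> has
        integral 0 and its primitive starting at \<open>- A\<close> vanishes outside
        \<open>{-A..A}\<close>.\<close>
      define b where "b x = \<beta> n * bump s t n x + - \<alpha> n * bump 0 1 n x" for x
      have bk: "diff_times k b" for k
        unfolding b_def by (intro diff_times_add diff_times_mult diff_times_const bump_diff_times)
      have cb: "continuous_on UNIV b"
        unfolding b_def by (intro continuous_intros bump_continuous)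
      obtain P where P: "primitive b P" using primitive_exists[OF locally_integrable_continuous[OF cb]] .
      define \<phi> where "\<phi> x = P x + - P (-A)" for x
      have b0: "b x = 0" if "x \<le> -A \<or> x \<ge> A" for x
        unfolding b_def using that A by (subst bump_zero, force, subst bump_zero) auto
      have d: "(\<phi> has_real_derivative b x) (at x)" for x
        unfolding \<phi>_def by (auto intro!: derivative_eq_intros primitive_imp_deriv[OF P cb])
      have "\<phi> \<in> test_fun"
      proof (rule test_funI)
        fix k
        have "diff_times (Suc k) \<phi>" using d bk by auto
        then show "diff_times k \<phi>" by (rule diff_times_Suc_imp)
      next
        fix x assume x: "\<bar>x\<bar> > A"
        show "\<phi> x = 0"
        proof (cases "x < - A")
          case True
          then have "integral {x..-A} b = integral {x..-A} (\<lambda>_. 0)"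
            by (intro integral_cong) (use b0 in auto)
          then show ?thesis using primitiveD(2)[OF P, of x "-A"] True by (simp add: \<phi>_def)
        next
          case False
          then have x: "x > A" using x by auto
          have 1: "integral {A..x} b = integral {A..x} (\<lambda>_. 0)"
            by (intro integral_cong) (use b0 in auto)
          have "integral {-A..A} b = \<beta> n * \<alpha> n + - \<alpha> n * \<beta> n"
            unfolding b_def \<alpha>_def \<beta>_def
            by (subst integral_add)
               (auto intro!: locally_integrable_on locally_integrable_continuous continuous_intros
                 bump_continuous integrable_neg)
          then show ?thesis using 1 primitiveD(2)[OF P, of A x] primitiveD(2)[OF P, of "-A" A] x A
            by (simp add: \<phi>_def)
        qed
      qed
      moreover have "deriv \<phi> = b" using d by (auto intro: DERIV_imp_deriv)
      ultimately have "(LINT x|lebesgue. h x * b x) = 0" using z by metis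
      moreover have "(LINT x|lebesgue. h x * b x) = integral {-A..A} (\<lambda>x. h x * b x)"
        by (rule LINT_bounded_support)
           (auto intro!: locally_integrable_mult_continuous h cb simp: b0 abs_if split: if_splits)
      moreover have "integral {-A..A} (\<lambda>x. h x * b x) =
          integral {-A..A} (\<lambda>x. \<beta> n * (h x * bump s t n x) + - \<alpha> n * (h x * bump 0 1 n x))"
        by (simp add: b_def algebra_simps)
      moreover have "\<dots> = \<beta> n * integral {-A..A} (\<lambda>x. h x * bump s t n x)
        + - \<alpha> n * integral {-A..A} (\<lambda>x. h x * bump 0 1 n x)"
        by (subst integral_add, (intro integrable_on_mult_right locally_integrable_on
              locally_integrable_mult_continuous h bump_continuous)+) simp
      ultimately show ?thesis by simp
    qed
    have c1: "locally_integrable (\<lambda>_. 1)" by (simp add: locally_integrable_continuous)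
    have a: "\<alpha> \<longlonglongrightarrow> t - s" and b: "\<beta> \<longlonglongrightarrow> 1"
      using bump_integral_tendsto[OF c1, of A s t] bump_integral_tendsto[OF c1, of A 0 1] A st
      by (auto simp: \<alpha>_def[abs_def] \<beta>_def[abs_def])
    have "(\<lambda>n. \<beta> n * integral {-A..A} (\<lambda>x. h x * bump s t n x)) \<longlonglongrightarrow> 1 * integral {s..t} h"
      using A st by (intro tendsto_mult b bump_integral_tendsto h) auto
    moreover have "(\<lambda>n. \<alpha> n * integral {-A..A} (\<lambda>x. h x * bump 0 1 n x)) \<longlonglongrightarrow> (t - s) * c"
      unfolding c_def using A by (intro tendsto_mult a bump_integral_tendsto h) auto
    ultimately show ?thesis using LIMSEQ_unique by (simp add: key)
  qed
  then have "integral {s..t} (\<lambda>x. h x - c) = 0" if "s \<le> t" for s t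
    using that locally_integrable_on[OF h] by (subst integral_diff) auto
  then have "AE x in lebesgue. h x - c = 0"
    by (intro zero_integrals_imp_AE_zero locally_integrable_diff h locally_integrable_continuous) auto
  then show ?thesis by auto
qed

lemma integral_by_parts_test_fun:
  assumes G: "primitive g G" and \<phi>: "\<phi> \<in> test_fun"
  shows "(LINT x|lebesgue. G x * deriv \<phi> x) = - (LINT x|lebesgue. g x * \<phi> x)"
proof -
  obtain R where R: "R > 0" "\<And>x. \<bar>x\<bar> \<ge> R \<Longrightarrow> \<phi> x = 0" "\<And>x. \<bar>x\<bar> \<ge> R \<Longrightarrow> deriv \<phi> x = 0"
    using test_fun_support[OF \<phi>] by metis
  have c: "continuous_on UNIV \<phi>" "continuous_on UNIV (deriv \<phi>)"
    using test_fun_continuous \<phi> test_fun_deriv by auto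
  have p: "primitive (deriv \<phi>) \<phi>"
    by (rule primitive_deriv[OF test_fun_DERIV[OF \<phi>] c(2)])
  have l1: "locally_integrable (\<lambda>x. g x * \<phi> x)"
    using locally_integrable_mult_continuous[OF primitiveD(1)[OF G] c(1)] .
  have l2: "locally_integrable (\<lambda>x. G x * deriv \<phi> x)"
    by (intro locally_integrable_continuous continuous_intros c primitive_continuous[OF G])
  have "integral {-R..R} (\<lambda>x. g x * \<phi> x + G x * deriv \<phi> x) = 0"
    using primitiveD(2)[OF primitive_mult[OF G p], of "-R" R] R by simp
  then have "integral {-R..R} (\<lambda>x. g x * \<phi> x) + integral {-R..R} (\<lambda>x. G x * deriv \<phi> x) = 0"
    by (subst (asm) integral_add) (use locally_integrable_on l1 l2 in auto)
  then show ?thesis using LINT_bounded_support[OF l1, of R] LINT_bounded_support[OF l2, of R] R by simp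
qed

text \<open>Any primitive of \<open>g\<close> has weak derivative \<open>g\<close>, so
  \<open>f\<close> minus it is almost everywhere constant; the constant goes into
  \<open>G\<close>.\<close>

lemma weak_derivative_primitive:
  assumes f: "locally_integrable f" and g: "locally_integrable g"
    and w: "\<And>\<phi>. \<phi> \<in> test_fun \<Longrightarrow> - (LINT x|lebesgue. f x * deriv \<phi> x) = (LINT x|lebesgue. g x * \<phi> x)"
  obtains G where "primitive g G" "AE x in lebesgue. f x = G x"
proof -
  obtain G where G: "primitive g G" using primitive_exists[OF g] .
  have "\<exists>c. AE x in lebesgue. f x - G x = c"
  proof (rule du_Bois_Reymond)
    note cG = primitive_continuous[OF G]
    show "locally_integrable (\<lambda>x. f x - G x)"
      by (intro locally_integrable_diff f locally_integrable_continuous cG)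
    fix \<phi> assume \<phi>: "\<phi> \<in> test_fun"
    obtain R where R: "R > 0" "\<And>x. \<bar>x\<bar> \<ge> R \<Longrightarrow> deriv \<phi> x = 0"
      using test_fun_support[OF \<phi>] by metis
    have c: "continuous_on UNIV (deriv \<phi>)"
      using test_fun_continuous \<phi> test_fun_deriv by auto
    have l1: "locally_integrable (\<lambda>x. f x * deriv \<phi> x)" "locally_integrable (\<lambda>x. G x * deriv \<phi> x)"
      by (intro locally_integrable_mult_continuous f c locally_integrable_continuous cG)+
    then have l2: "locally_integrable (\<lambda>x. (f x - G x) * deriv \<phi> x)"
      using locally_integrable_diff by (simp add: left_diff_distrib)
    have "(LINT x|lebesgue. (f x - G x) * deriv \<phi> x) = integral {-R..R} (\<lambda>x. (f x - G x) * deriv \<phi> x)"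
      by (rule LINT_bounded_support[OF l2]) (use R in auto)
    also have "\<dots> = integral {-R..R} (\<lambda>x. f x * deriv \<phi> x) - integral {-R..R} (\<lambda>x. G x * deriv \<phi> x)"
      unfolding left_diff_distrib by (rule integral_diff) (use l1 locally_integrable_on in auto)
    also have "\<dots> = (LINT x|lebesgue. f x * deriv \<phi> x) - (LINT x|lebesgue. G x * deriv \<phi> x)"
      by (subst (1 2) LINT_bounded_support[where R=R]) (use R l1 in auto)
    also have "\<dots> = 0" using w[OF \<phi>] integral_by_parts_test_fun[OF G \<phi>] by simp
    finally show "(LINT x|lebesgue. (f x - G x) * deriv \<phi> x) = 0" .
  qed
  then obtain c where "AE x in lebesgue. f x - G x = c" by blast
  then have "AE x in lebesgue. f x = G x + c" by (rule AE_mp) auto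
  moreover have "primitive g (\<lambda>x. G x + c)" using G by (simp add: primitive_def)
  ultimately show ?thesis using that by blast
qed

subsection \<open>Kinks\<close>

lemma small_value_in_interval:
  fixes k :: "real \<Rightarrow> real"
  assumes k: "continuous_on UNIV k" and pq: "p \<le> q"
  obtains m where "p \<le> m" "m \<le> q" "(q - p) * k m \<le> integral {p..q} k"
proof -
  have kc: "continuous_on {p..q} k" using k continuous_on_subset by blast
  obtain m where m: "m \<in> {p..q}" "\<And>x. x \<in> {p..q} \<Longrightarrow> k m \<le> k x"
    using continuous_attains_inf[OF compact_Icc _ kc] pq by auto
  have "integral {p..q} (\<lambda>_. k m) \<le> integral {p..q} k"
    by (rule integral_le) (use m integrable_continuous_interval[OF kc] in auto)
  then show ?thesis using that[of m] m pq by simp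
qed

lemma integral_mono_interval:
  fixes k :: "real \<Rightarrow> real"
  assumes "locally_integrable k" "\<And>x. 0 \<le> k x" "c \<le> a" "b \<le> d"
  shows "integral {a..b} k \<le> integral {c..d} k"
  by (rule integral_subset_le) (use assms locally_integrable_on in auto)

text \<open>A window of length \<open>Suc n\<close> beyond \<open>n\<close> on either side contains
  a point where \<open>k\<close> is at most its mean, hence at most \<open>B / Suc n\<close>.
  Boundary terms of integrations by parts vanish along such endpoints without any pointwise
  decay.\<close>

lemma vanishing_sequences:
  fixes k :: "real \<Rightarrow> real"
  assumes k: "continuous_on UNIV k" and nn: "\<And>x. 0 \<le> k x"
    and B: "\<And>a b. a \<le> b \<Longrightarrow> integral {a..b} k \<le> B"
  obtains L R :: "nat \<Rightarrow> real" where "filterlim R at_top sequentially" "filterlim L at_bot sequentially"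
    "(\<lambda>n. k (R n)) \<longlonglongrightarrow> 0" "(\<lambda>n. k (L n)) \<longlonglongrightarrow> 0"
proof -
  have ex: "\<exists>m. p \<le> m \<and> m \<le> p + real (Suc n) \<and> k m \<le> B / real (Suc n)" for p n
  proof -
    obtain m where m: "p \<le> m" "m \<le> p + real (Suc n)"
      "(p + real (Suc n) - p) * k m \<le> integral {p..p + real (Suc n)} k"
      using small_value_in_interval[OF k, of p "p + real (Suc n)"] by auto
    then have "real (Suc n) * k m \<le> B" using B[of p "p + real (Suc n)"] by (simp del: of_nat_Suc)
    then have "k m \<le> B / real (Suc n)" by (simp add: field_simps del: of_nat_Suc)
    then show ?thesis using m by blast
  qed
  have "\<exists>m. real n \<le> m \<and> k m \<le> B / real (Suc n)" for n
    using ex[of "real n" n] by blast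
  then obtain R where R: "\<And>n. real n \<le> R n" "\<And>n. k (R n) \<le> B / real (Suc n)"
    by metis
  have "\<exists>m. m \<le> - real n \<and> k m \<le> B / real (Suc n)" for n
    using ex[of "- real n - real (Suc n)" n] by auto
  then obtain L where L: "\<And>n. L n \<le> - real n" "\<And>n. k (L n) \<le> B / real (Suc n)" by metis
  have B0: "(\<lambda>n. B / real (Suc n)) \<longlonglongrightarrow> 0" by (intro LIMSEQ_Suc lim_const_over_n)
  show ?thesis
  proof (rule that[of R L])
    show "filterlim R at_top sequentially"
      by (rule filterlim_at_top_mono[OF filterlim_real_sequentially]) (use R in auto)
    have "filterlim (\<lambda>n. - L n) at_top sequentially"
      by (rule filterlim_at_top_mono[OF filterlim_real_sequentially])
         (use L in \<open>auto simp: le_minus_iff\<close>)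
    then show "filterlim L at_bot sequentially" by (simp add: filterlim_uminus_at_bot)
    show "(\<lambda>n. k (R n)) \<longlonglongrightarrow> 0"
      by (rule tendsto_sandwich[OF _ _ tendsto_const B0]) (use R nn in auto)
    show "(\<lambda>n. k (L n)) \<longlonglongrightarrow> 0"
      by (rule tendsto_sandwich[OF _ _ tendsto_const B0]) (use L nn in auto)
  qed
qed

text \<open>Monotone convergence along \<open>{-n..n}\<close> passes bounds that are uniform over
  finite intervals to the whole line.\<close>

lemma integrable_bounded_integrals:
  fixes k :: "real \<Rightarrow> real"
  assumes k: "continuous_on UNIV k" and nn: "\<And>x. 0 \<le> k x"
    and B: "\<And>a b. a \<le> b \<Longrightarrow> integral {a..b} k \<le> B"
  shows "integrable lebesgue k" "(LINT x|lebesgue. k x) \<le> B"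
proof -
  have li: "locally_integrable k" by (rule locally_integrable_continuous[OF k])
  let ?f = "\<lambda>n::nat. \<lambda>x. indicator {-real n..real n} x *\<^sub>R k x"
  have fi: "integrable lebesgue (?f n)" for n
    using locally_integrableD[OF li, of "-real n" "real n"] by (simp add: set_integrable_def)
  have eq: "(LINT x|lebesgue. ?f n x) = integral {-real n..real n} k" for n
    using set_lebesgue_integral_eq_integral(2)[OF locally_integrableD[OF li], of "-real n" "real n"]
    by (simp add: set_lebesgue_integral_def)
  have inc: "incseq (\<lambda>n. LINT x|lebesgue. ?f n x)"
    unfolding eq incseq_def by (auto intro!: integral_mono_interval li nn)
  have bd: "\<And>n. (LINT x|lebesgue. ?f n x) \<le> B" unfolding eq using B by simp
  obtain I where I: "(\<lambda>n. LINT x|lebesgue. ?f n x) \<longlonglongrightarrow> I"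
    using incseq_convergent[OF inc] bd by metis
  have mono: "AE x in lebesgue. mono (\<lambda>n. ?f n x)"
    by (rule AE_I2) (auto simp: mono_def indicator_def nn)
  have lim: "AE x in lebesgue. (\<lambda>n. ?f n x) \<longlonglongrightarrow> k x"
  proof (rule AE_I2)
    fix x :: real
    obtain N where N: "\<bar>x\<bar> \<le> real N" using real_arch_simple by blast
    have "\<forall>\<^sub>F n in sequentially. ?f n x = k x"
      by (rule eventually_sequentiallyI[of N]) (use N in \<open>auto simp: indicator_def\<close>)
    then show "(\<lambda>n. ?f n x) \<longlonglongrightarrow> k x" by (rule tendsto_eventually)
  qed
  have meas: "k \<in> borel_measurable lebesgue"
    by (rule measurable_completion) (use borel_measurable_continuous_onI[OF k] in simp)
  show "integrable lebesgue k"
    using integrable_monotone_convergence[of lebesgue ?f k I, OF fi mono lim I meas] .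
  have "(LINT x|lebesgue. k x) = I"
    using integral_monotone_convergence[of lebesgue ?f k I, OF fi mono lim I meas] .
  moreover have "I \<le> B"
    by (rule LIMSEQ_le_const2[OF I]) (intro exI allI impI bd)
  ultimately show "(LINT x|lebesgue. k x) \<le> B" by simp
qed

lemma integral_le_LINT:
  fixes k :: "real \<Rightarrow> real"
  assumes k: "integrable lebesgue k" and nn: "\<And>x. 0 \<le> k x"
  shows "k integrable_on {a..b}" "integral {a..b} k \<le> (LINT x|lebesgue. k x)"
proof -
  have ai: "k absolutely_integrable_on {a..b}"
    unfolding set_integrable_def using k by (intro integrable_mult_indicator) auto
  show "k integrable_on {a..b}" using set_lebesgue_integral_eq_integral(1)[OF ai] .
  have "(LINT x|lebesgue. indicator {a..b} x *\<^sub>R k x) \<le> (LINT x|lebesgue. k x)"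
    using ai k nn by (intro integral_mono) (auto simp: set_integrable_def indicator_def)
  then show "integral {a..b} k \<le> (LINT x|lebesgue. k x)"
    using set_lebesgue_integral_eq_integral(2)[OF ai] by (simp add: set_lebesgue_integral_def)
qed

section \<open>Explicit properties of the kinks\<close>

lemma kink10_eq: "kink10 x = - kink01 (- x)"
  by (simp add: kink10_def kink01_def)

lemma exp_double_sqrt2: "exp (2 * sqrt 2 * x) = (exp (sqrt 2 * x))\<^sup>2"
  by (simp add: exp_double[symmetric] mult.assoc)

lemma kink01_alt: "kink01 x = exp (sqrt 2 * x) / sqrt (1 + (exp (sqrt 2 * x))\<^sup>2)"
  by (simp add: kink01_def exp_double_sqrt2)

lemma kink01_pos: "0 < kink01 x"
  unfolding kink01_alt by (intro divide_pos_pos real_sqrt_gt_zero add_pos_nonneg) auto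

lemma kink01_sq: "(kink01 x)\<^sup>2 = (exp (sqrt 2 * x))\<^sup>2 / (1 + (exp (sqrt 2 * x))\<^sup>2)"
  unfolding kink01_alt by (simp add: power_divide add_nonneg_nonneg)

lemma one_minus_kink01_sq: "1 - (kink01 x)\<^sup>2 = 1 / (1 + (exp (sqrt 2 * x))\<^sup>2)"
proof -
  have "1 + (exp (sqrt 2 * x))\<^sup>2 \<noteq> 0"
    by (metis add_nonneg_eq_0_iff zero_le_one zero_le_power2 zero_neq_one)
  then show ?thesis unfolding kink01_sq by (simp add: field_simps)
qed

lemma kink01_less_1: "kink01 x < 1"
proof -
  have "0 < 1 - (kink01 x)\<^sup>2" unfolding one_minus_kink01_sq by (auto intro!: divide_pos_pos add_pos_nonneg)
  then have "(kink01 x)\<^sup>2 < 1\<^sup>2" by simp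
  then show ?thesis by (rule power2_less_imp_less) simp
qed

lemma kink01_le_exp: "kink01 x \<le> exp (sqrt 2 * x)"
proof -
  have "1 \<le> sqrt (1 + (exp (sqrt 2 * x))\<^sup>2)" by simp
  then show ?thesis unfolding kink01_alt
    using frac_le[of "exp (sqrt 2 * x)" "exp (sqrt 2 * x)" 1 "sqrt (1 + (exp (sqrt 2 * x))\<^sup>2)"] by simp
qed

text \<open>This reflection links the approach to 1 on the right with the decay to 0 on the left;
  the limit at \<open>at_top\<close> is derived from it.\<close>

lemma one_minus_kink01_sq_eq: "1 - (kink01 x)\<^sup>2 = (kink01 (- x))\<^sup>2"
proof -
  have "exp (sqrt 2 * x) > 0" by simp
  then show ?thesis
  unfolding one_minus_kink01_sq kink01_sq by (simp add: exp_minus field_simps add_pos_nonneg add_nonneg_eq_0_iff)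
qed

text \<open>This is the square root of the zero-energy equation \<open>h'\<^sup>2 = 2 W(h)\<close>.
  It makes derivatives of kinks polynomials in the kink, so later identities reduce to
  algebra.\<close>

lemma kink01_DERIV: "(kink01 has_real_derivative sqrt 2 * kink01 x * (1 - (kink01 x)\<^sup>2)) (at x)"
proof -
  define E where "E = exp (sqrt 2 * x)"
  define s where "s = sqrt (1 + E\<^sup>2)"
  have s: "s > 0" "s\<^sup>2 = 1 + E\<^sup>2" unfolding s_def by (auto intro!: add_pos_nonneg)
  have pos: "1 + (exp (sqrt 2 * x))\<^sup>2 > 0" by (auto intro!: add_pos_nonneg)
  have d1: "((\<lambda>x. exp (sqrt 2 * x)) has_real_derivative sqrt 2 * E) (at x)"
    unfolding E_def by (auto intro!: derivative_eq_intros)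
  have d2: "((\<lambda>x. 1 + (exp (sqrt 2 * x))\<^sup>2) has_real_derivative 2 * sqrt 2 * E\<^sup>2) (at x)"
    unfolding E_def by (auto intro!: derivative_eq_intros simp: power2_eq_square)
  have d3: "((\<lambda>x. sqrt (1 + (exp (sqrt 2 * x))\<^sup>2)) has_real_derivative sqrt 2 * E\<^sup>2 / s) (at x)"
  proof (rule DERIV_cong)
    show "((\<lambda>x. sqrt (1 + (exp (sqrt 2 * x))\<^sup>2)) has_real_derivative inverse s / 2 * (2 * sqrt 2 * E\<^sup>2)) (at x)"
      using DERIV_chain2[where f = sqrt and g = "\<lambda>x. 1 + (exp (sqrt 2 * x))\<^sup>2", OF DERIV_real_sqrt[OF pos] d2]
      unfolding s_def E_def .
    show "inverse s / 2 * (2 * sqrt 2 * E\<^sup>2) = sqrt 2 * E\<^sup>2 / s"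
      using s(1) by (simp add: field_simps)
  qed
  have "((\<lambda>x. exp (sqrt 2 * x) / sqrt (1 + (exp (sqrt 2 * x))\<^sup>2)) has_real_derivative
      (sqrt 2 * E * s - E * (sqrt 2 * E\<^sup>2 / s)) / (s * s)) (at x)"
    using DERIV_divide[OF d1 d3] s(1) unfolding E_def[symmetric] s_def[symmetric] by simp
  also have "sqrt 2 * E * s - E * (sqrt 2 * E\<^sup>2 / s) = sqrt 2 * E / s"
  proof -
    have "sqrt 2 * E * s = sqrt 2 * E * s\<^sup>2 / s" using s(1) by (simp add: power2_eq_square)
    then show ?thesis unfolding s(2) by (simp add: ring_distribs add_divide_distrib)
  qed
  also have "sqrt 2 * E / s / (s * s) = sqrt 2 * (E / s) * (1 / s\<^sup>2)"
    by (simp add: power2_eq_square)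
  also have "\<dots> = sqrt 2 * kink01 x * (1 - (kink01 x)\<^sup>2)"
    unfolding one_minus_kink01_sq s(2) by (simp add: kink01_alt E_def s_def)
  finally show ?thesis by (simp add: kink01_alt[abs_def])
qed

lemma kink01_shift_DERIV:
  "((\<lambda>x. kink01 (x + y)) has_real_derivative sqrt 2 * kink01 (x + y) * (1 - (kink01 (x + y))\<^sup>2)) (at x)"
  using kink01_DERIV[of "x + y"] by (simp add: DERIV_shift)

lemma kink10_DERIV: "(kink10 has_real_derivative - sqrt 2 * kink10 x * (1 - (kink10 x)\<^sup>2)) (at x)"
  unfolding kink10_eq[abs_def]
  by (auto intro!: derivative_eq_intros DERIV_chain2[OF kink01_DERIV])

lemma kink10_shift_DERIV:
  "((\<lambda>x. kink10 (x + y)) has_real_derivative - sqrt 2 * kink10 (x + y) * (1 - (kink10 (x + y))\<^sup>2)) (at x)"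
  using kink10_DERIV[of "x + y"] by (simp add: DERIV_shift)

lemma kink01_continuous: "continuous_on UNIV (\<lambda>x. kink01 (x + y))"
  by (rule DERIV_continuous_on) (rule kink01_shift_DERIV)

lemma kink10_continuous: "continuous_on UNIV (\<lambda>x. kink10 (x + y))"
  by (rule DERIV_continuous_on) (rule kink10_shift_DERIV)

lemma sqrt2_bounds: "1 \<le> sqrt 2" "sqrt 2 \<le> 3/2"
proof -
  show "sqrt 2 \<le> 3/2" by (rule real_le_lsqrt) (auto simp: power2_eq_square)
qed simp

lemma kink_slope_bounds:
  fixes s :: real assumes "0 \<le> s" "s \<le> 1"
  shows "0 \<le> sqrt 2 * s * (1 - s\<^sup>2)" "sqrt 2 * s * (1 - s\<^sup>2) \<le> 1"
proof -
  have "s\<^sup>2 \<le> 1" using assms by (simp add: power_le_one)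
  then have nn: "0 \<le> s * (1 - s\<^sup>2)" using assms by simp
  then show "0 \<le> sqrt 2 * s * (1 - s\<^sup>2)" by (simp add: mult.assoc)
  \<comment> \<open>The point 1/2 is a rational substitute for the maximiser
    \<open>1 / sqrt 3\<close>, and 2/3 is the bound that compensates the factor
    \<open>sqrt 2 \<le> 3/2\<close>.\<close>
  have "2/3 - s * (1 - s\<^sup>2) = (s - 1/2)\<^sup>2 * (s + 1) + (5/12 - s/4)"
    by (simp add: power2_eq_square algebra_simps add_divide_distrib)
  moreover have "0 \<le> (s - 1/2)\<^sup>2 * (s + 1)" using assms by simp
  ultimately have "s * (1 - s\<^sup>2) \<le> 2/3" using assms by linarith
  then have "sqrt 2 * (s * (1 - s\<^sup>2)) \<le> 3/2 * (2/3)" using sqrt2_bounds nn by (intro mult_mono) auto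
  then show "sqrt 2 * s * (1 - s\<^sup>2) \<le> 1" by (simp add: mult.assoc)
qed

lemma kink01_strict_mono: "x < y \<Longrightarrow> kink01 x < kink01 y"
proof (rule DERIV_pos_imp_increasing, assumption)
  fix t :: real
  have "(kink01 t)\<^sup>2 < 1" using kink01_pos[of t] kink01_less_1[of t] by (simp add: abs_square_less_1)
  then show "\<exists>d. (kink01 has_real_derivative d) (at t) \<and> 0 < d"
    using kink01_DERIV[of t] kink01_pos[of t]
    by (intro exI[of _ "sqrt 2 * kink01 t * (1 - (kink01 t)\<^sup>2)"]) auto
qed

lemma kink01_mono: "x \<le> y \<Longrightarrow> kink01 x \<le> kink01 y"
  using kink01_strict_mono[of x y] by (cases "x = y") auto

lemma kink01_lipschitz: "\<bar>kink01 x - kink01 y\<bar> \<le> \<bar>x - y\<bar>"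
proof -
  have *: "kink01 b - kink01 a \<le> b - a" if ab: "a \<le> b" for a b
  proof -
    have "a - kink01 a \<le> b - kink01 b"
    proof (rule DERIV_nonneg_imp_nondecreasing[OF ab])
      fix t
      show "\<exists>d. ((\<lambda>x. x - kink01 x) has_real_derivative d) (at t) \<and> 0 \<le> d"
        using kink_slope_bounds[of "kink01 t"] kink01_pos[of t] kink01_less_1[of t]
        by (intro exI[of _ "1 - sqrt 2 * kink01 t * (1 - (kink01 t)\<^sup>2)"] conjI
            DERIV_diff[OF DERIV_ident kink01_DERIV]) auto
    qed
    then show ?thesis by simp
  qed
  show ?thesis using *[of x y] *[of y x] kink01_mono[of x y] kink01_mono[of y x] by (cases "x \<le> y") auto
qed

lemma kink01_tendsto_bot: "(kink01 \<longlongrightarrow> 0) at_bot"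
proof (rule tendsto_sandwich[OF _ _ tendsto_const])
  have "filterlim (\<lambda>x::real. sqrt 2 * x) at_bot at_bot"
    by (rule filterlim_tendsto_pos_mult_at_bot[OF tendsto_const _ filterlim_ident]) simp
  then show "((\<lambda>x. exp (sqrt 2 * x)) \<longlongrightarrow> 0) at_bot"
    by (rule filterlim_compose[OF exp_at_bot])
qed (auto intro!: always_eventually kink01_le_exp less_imp_le[OF kink01_pos])

lemma kink01_tendsto_top: "(kink01 \<longlongrightarrow> 1) at_top"
proof -
  have b: "((\<lambda>x. kink01 (- x)) \<longlongrightarrow> 0) at_top"
    by (rule filterlim_compose[OF kink01_tendsto_bot filterlim_uminus_at_bot_at_top])
  show ?thesis
  proof (rule tendsto_sandwich[OF _ _ _ tendsto_const])
    show "((\<lambda>x. 1 - (kink01 (- x))\<^sup>2) \<longlongrightarrow> 1) at_top"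
      using tendsto_diff[OF tendsto_const[of 1] tendsto_power[OF b, of 2]] by simp
    have "1 - (kink01 (- x))\<^sup>2 \<le> kink01 x" for x
    proof -
      have "(kink01 x)\<^sup>2 \<le> kink01 x"
        using kink01_pos[of x] kink01_less_1[of x] by (simp add: power2_eq_square mult_left_le)
      then show ?thesis using one_minus_kink01_sq_eq[of x] by simp
    qed
    then show "\<forall>\<^sub>F x in at_top. 1 - (kink01 (- x))\<^sup>2 \<le> kink01 x" by simp
    show "\<forall>\<^sub>F x in at_top. kink01 x \<le> 1" using less_imp_le[OF kink01_less_1] by simp
  qed
qed

text \<open>This is \<open>1 / (2 cosh (sqrt 2 x))\<close>, and also \<open>kink01\<^sup>2\<close>
  times \<open>exp (- sqrt 2 x)\<close>: what remains when the square of one kink meets the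
  exponential tail of the other.\<close>

definition bell :: "real \<Rightarrow> real" where
  "bell x = exp (sqrt 2 * x) / (1 + (exp (sqrt 2 * x))\<^sup>2)"

lemma bell_bounds: "0 \<le> bell x" "bell x \<le> 1/2"
proof -
  define E where "E = exp (sqrt 2 * x)"
  have "0 \<le> (E - 1)\<^sup>2" by simp
  then have "2 * E \<le> 1 + E\<^sup>2" by (simp add: power2_eq_square algebra_simps)
  moreover have "0 < 1 + E\<^sup>2" by (auto intro!: add_pos_nonneg)
  moreover have "bell x = E / (1 + E\<^sup>2)" by (simp add: bell_def E_def)
  moreover have "0 \<le> E" by (simp add: E_def)
  ultimately show "0 \<le> bell x" "bell x \<le> 1/2" by (simp_all add: divide_le_eq)
qed

lemma kink01_sq_times_exp: "(kink01 x)\<^sup>2 * exp (- (sqrt 2 * x)) = bell x"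
  unfolding kink01_sq bell_def by (simp add: exp_minus power2_eq_square)

lemma bell_minus: "bell (- x) = bell x"
  unfolding bell_def
  by (simp add: exp_minus field_simps power2_eq_square add_pos_pos add_nonneg_eq_0_iff)

lemma bell_primitive: "primitive (\<lambda>x. bell (x + y)) (\<lambda>x. arctan (exp (sqrt 2 * (x + y))) / sqrt 2)"
proof (rule primitive_deriv)
  show "((\<lambda>x. arctan (exp (sqrt 2 * (x + y))) / sqrt 2) has_real_derivative bell (x + y)) (at x)" for x
  proof -
    have "((\<lambda>x. arctan (exp (sqrt 2 * (x + y)))) has_real_derivative sqrt 2 * bell (x + y)) (at x)"
      unfolding bell_def by (auto intro!: derivative_eq_intros simp: divide_inverse)
    from DERIV_cdivide[OF this, of "sqrt 2"] show ?thesis by simp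
  qed
  have "1 + (exp (sqrt 2 * (x + y)))\<^sup>2 \<noteq> 0" for x
    by (metis add_nonneg_eq_0_iff zero_le_one zero_le_power2 zero_neq_one)
  then show "continuous_on UNIV (\<lambda>x. bell (x + y))"
    unfolding bell_def by (intro continuous_intros) auto
qed

lemma bell_integral: "a \<le> b \<Longrightarrow> integral {a..b} (\<lambda>x. bell (x + y)) \<le> 2"
proof -
  assume ab: "a \<le> b"
  have "arctan (exp (sqrt 2 * (b + y))) \<le> 2" "0 \<le> arctan (exp (sqrt 2 * (a + y)))"
    using arctan_ubound[of "exp (sqrt 2 * (b + y))"] pi_less_4 by (auto simp: zero_le_arctan_iff)
  then have "arctan (exp (sqrt 2 * (b + y))) / sqrt 2 \<le> 2 / 1" "0 \<le> arctan (exp (sqrt 2 * (a + y))) / sqrt 2"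
    using sqrt2_bounds by (intro frac_le; simp) simp
  then show ?thesis using primitiveD(2)[OF bell_primitive ab, of y] by linarith
qed

lemma kink01_primitive: "primitive (\<lambda>x. kink01 (x + y)) (\<lambda>x. arsinh (exp (sqrt 2 * (x + y))) / sqrt 2)"
proof (rule primitive_deriv[OF _ kink01_continuous])
  fix x
  show "((\<lambda>x. arsinh (exp (sqrt 2 * (x + y))) / sqrt 2) has_real_derivative kink01 (x + y)) (at x)"
  proof -
    have "((\<lambda>x. exp (sqrt 2 * (x + y))) has_real_derivative sqrt 2 * exp (sqrt 2 * (x + y))) (at x)"
      by (auto intro!: derivative_eq_intros)
    from DERIV_chain2[OF arsinh_real_has_field_derivative[of "exp (sqrt 2 * (x + y))" UNIV] this]
    have "((\<lambda>x. arsinh (exp (sqrt 2 * (x + y)))) has_real_derivative sqrt 2 * kink01 (x + y)) (at x)"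
      unfolding kink01_alt by (simp add: add.commute)
    from DERIV_cdivide[OF this, of "sqrt 2"] show ?thesis by simp
  qed
qed

text \<open>The difference has absolute value at most 1 and constant sign, so its square is at most
  its absolute value. The integral of the latter telescopes through a primitive \<open>P\<close>,
  which grows by at most the length of the shift because \<open>kink01\<close> lies between 0 and
  1.\<close>

lemma kink01_diff_square_integral:
  assumes ab: "a \<le> b"
  shows "integral {a..b} (\<lambda>x. (kink01 (x + s) - kink01 (x + t))\<^sup>2) \<le> \<bar>s - t\<bar>"
proof -
  have main: "integral {a..b} (\<lambda>x. (kink01 (x + s) - kink01 (x + t))\<^sup>2) \<le> s - t" if st: "t \<le> s" for s t
  proof -
    define P where "P x = arsinh (exp (sqrt 2 * x)) / sqrt 2" for x
    have P: "primitive (\<lambda>x. kink01 (x + y)) (\<lambda>x. P (x + y))" for y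
      using kink01_primitive[of y] by (simp add: P_def)
    have p0: "primitive kink01 P" using P[of 0] by simp
    have pos: "P (a + t) \<le> P (a + s)" 
      using integral_nonneg[OF locally_integrable_on[OF primitiveD(1)[OF p0]], of "a + t" "a + s"]
        primitiveD(2)[OF p0, of "a + t" "a + s"] st less_imp_le[OF kink01_pos] by simp
    have le: "P (b + s) - P (b + t) \<le> s - t"
    proof -
      have "integral {b+t..b+s} kink01 \<le> integral {b+t..b+s} (\<lambda>_. 1)"
        by (rule integral_le[OF locally_integrable_on[OF primitiveD(1)[OF p0]]])
           (auto intro: less_imp_le[OF kink01_less_1])
      then show ?thesis using primitiveD(2)[OF p0, of "b+t" "b+s"] st by simp
    qed
    have pd: "primitive (\<lambda>x. kink01 (x + s) - kink01 (x + t)) (\<lambda>x. P (x + s) - P (x + t))"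
      by (rule primitive_diff[OF P P])
    have "integral {a..b} (\<lambda>x. (kink01 (x + s) - kink01 (x + t))\<^sup>2)
        \<le> integral {a..b} (\<lambda>x. kink01 (x + s) - kink01 (x + t))"
    proof (rule integral_le)
      show "(\<lambda>x. (kink01 (x + s) - kink01 (x + t))\<^sup>2) integrable_on {a..b}"
        by (intro locally_integrable_on locally_integrable_continuous continuous_intros kink01_continuous)
      show "(\<lambda>x. kink01 (x + s) - kink01 (x + t)) integrable_on {a..b}"
        by (intro locally_integrable_on locally_integrable_continuous continuous_intros kink01_continuous)
      fix x
      have "0 \<le> kink01 (x + s) - kink01 (x + t)" "kink01 (x + s) - kink01 (x + t) \<le> 1"
        using kink01_mono[of "x + t" "x + s"] st kink01_pos[of "x + t"] kink01_less_1[of "x + s"] by auto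
      then show "(kink01 (x + s) - kink01 (x + t))\<^sup>2 \<le> kink01 (x + s) - kink01 (x + t)"
        by (simp add: power2_eq_square mult_left_le)
    qed
    also have "\<dots> = (P (b + s) - P (b + t)) - (P (a + s) - P (a + t))"
      using primitiveD(2)[OF pd ab] .
    finally show ?thesis using pos le by simp
  qed
  show ?thesis
  proof (cases "t \<le> s")
    case True then show ?thesis using main[of t s] by simp
  next
    case False then show ?thesis using main[of s t] by (simp add: power2_commute)
  qed
qed

lemma kink10_diff_square_integral:
  assumes ab: "a \<le> b"
  shows "integral {a..b} (\<lambda>x. (kink10 (x + s) - kink10 (x + t))\<^sup>2) \<le> \<bar>s - t\<bar>"
proof -
  have "integral {a..b} (\<lambda>x. (kink10 (x + s) - kink10 (x + t))\<^sup>2)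
      = integral {-b..-a} (\<lambda>x. (kink10 (- x + s) - kink10 (- x + t))\<^sup>2)"
    using Henstock_Kurzweil_Integration.integral_reflect_real[of b a "\<lambda>x. (kink10 (x + s) - kink10 (x + t))\<^sup>2"] by simp
  also have "\<dots> = integral {-b..-a} (\<lambda>x. (kink01 (x + - s) - kink01 (x + - t))\<^sup>2)"
    by (simp add: kink10_eq power2_commute)
  also have "\<dots> \<le> \<bar>- s - - t\<bar>" by (rule kink01_diff_square_integral) (use ab in auto)
  finally show ?thesis by simp
qed

text \<open>The slope lies in the unit interval, so its square is at most the slope, whose integral
  is an increment of the kink.\<close>

lemma kink01_slope_square_integral:
  assumes ab: "a \<le> b"
  shows "integral {a..b} (\<lambda>x. (sqrt 2 * kink01 (x + y) * (1 - (kink01 (x + y))\<^sup>2))\<^sup>2) \<le> 1"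
proof -
  let ?s = "\<lambda>x. sqrt 2 * kink01 (x + y) * (1 - (kink01 (x + y))\<^sup>2)"
  have c: "continuous_on UNIV ?s" by (intro continuous_intros kink01_continuous)
  have p: "primitive ?s (\<lambda>x. kink01 (x + y))"
    by (rule primitive_deriv) (rule kink01_shift_DERIV, rule c)
  have "integral {a..b} (\<lambda>x. (?s x)\<^sup>2) \<le> integral {a..b} ?s"
  proof (rule integral_le)
    show "(\<lambda>x. (?s x)\<^sup>2) integrable_on {a..b}"
      by (intro locally_integrable_on locally_integrable_continuous continuous_intros kink01_continuous)
    show "?s integrable_on {a..b}"
      by (intro locally_integrable_on locally_integrable_continuous c)
    fix x
    have "0 \<le> ?s x" "?s x \<le> 1"
      using kink_slope_bounds[of "kink01 (x + y)"] kink01_pos[of "x + y"] kink01_less_1[of "x + y"] by auto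
    then show "(?s x)\<^sup>2 \<le> ?s x" by (simp only: power2_eq_square mult_left_le)
  qed
  also have "\<dots> = kink01 (b + y) - kink01 (a + y)" using primitiveD(2)[OF p ab] .
  also have "\<dots> \<le> 1" using kink01_pos[of "a + y"] kink01_less_1[of "b + y"] by simp
  finally show ?thesis .
qed

lemma kink10_slope_square_integral:
  assumes ab: "a \<le> b"
  shows "integral {a..b} (\<lambda>x. (- sqrt 2 * kink10 (x + y) * (1 - (kink10 (x + y))\<^sup>2))\<^sup>2) \<le> 1"
proof -
  have "integral {a..b} (\<lambda>x. (- sqrt 2 * kink10 (x + y) * (1 - (kink10 (x + y))\<^sup>2))\<^sup>2)
      = integral {-b..-a} (\<lambda>x. (- sqrt 2 * kink10 (- x + y) * (1 - (kink10 (- x + y))\<^sup>2))\<^sup>2)"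
    using Henstock_Kurzweil_Integration.integral_reflect_real[of b a
        "\<lambda>x. (- sqrt 2 * kink10 (x + y) * (1 - (kink10 (x + y))\<^sup>2))\<^sup>2"] by simp
  also have "\<dots> = integral {-b..-a} (\<lambda>x. (sqrt 2 * kink01 (x + - y) * (1 - (kink01 (x + - y))\<^sup>2))\<^sup>2)"
    by (simp add: kink10_eq)
  also have "\<dots> \<le> 1" by (rule kink01_slope_square_integral) (use ab in auto)
  finally show ?thesis .
qed

subsection \<open>The linearised operator\<close>

text \<open>This is \<open>W\<close>; \<open>phi6_force\<close> and \<open>phi6_curvature\<close>
  are its first and second derivatives. The stationary equation reads
  \<open>u'' = phi6_force u\<close>, and its linearisation at \<open>s\<close> is
  \<open>- g'' + phi6_curvature s * g\<close>.\<close>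

definition phi6_potential :: "real \<Rightarrow> real" where
  "phi6_potential s = s\<^sup>2 * (1 - s\<^sup>2)\<^sup>2"

definition phi6_force :: "real \<Rightarrow> real" where
  "phi6_force s = 2 * s - 8 * s^3 + 6 * s^5"

definition phi6_curvature :: "real \<Rightarrow> real" where
  "phi6_curvature s = 2 - 24 * s\<^sup>2 + 30 * s^4"

definition kink_pair :: "real \<Rightarrow> real \<Rightarrow> real \<Rightarrow> real" where
  "kink_pair y1 y2 x = kink01 (x + y1) + kink10 (x + y2)"

definition kink_pair_deriv :: "real \<Rightarrow> real \<Rightarrow> real \<Rightarrow> real" where
  "kink_pair_deriv y1 y2 x = sqrt 2 * kink01 (x + y1) * (1 - (kink01 (x + y1))\<^sup>2)
     + (- sqrt 2 * kink10 (x + y2) * (1 - (kink10 (x + y2))\<^sup>2))"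

text \<open>Each kink solves the stationary equation, so the second derivative of the pair is a sum
  of forces. It differs from the force of the sum by the interaction of the kinks.\<close>

definition kink_pair_deriv2 :: "real \<Rightarrow> real \<Rightarrow> real \<Rightarrow> real" where
  "kink_pair_deriv2 y1 y2 x = phi6_force (kink01 (x + y1)) + phi6_force (kink10 (x + y2))"

lemma phi6_potential_DERIV: "(phi6_potential has_real_derivative phi6_force s) (at s)"
  unfolding phi6_potential_def phi6_force_def
  by (auto intro!: derivative_eq_intros simp: power2_eq_square algebra_simps eval_nat_numeral)

lemma kink_pair_DERIV: "(kink_pair y1 y2 has_real_derivative kink_pair_deriv y1 y2 x) (at x)"
  unfolding kink_pair_def[abs_def] kink_pair_deriv_def
  by (rule DERIV_add[OF kink01_shift_DERIV kink10_shift_DERIV])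

lemma kink_pair_deriv_DERIV: "(kink_pair_deriv y1 y2 has_real_derivative kink_pair_deriv2 y1 y2 x) (at x)"
proof -
  have sq: "sqrt 2 * sqrt 2 = (2::real)" by simp
  have "((\<lambda>x. sqrt 2 * kink01 (x + y1) * (1 - (kink01 (x + y1))\<^sup>2)) has_real_derivative
      phi6_force (kink01 (x + y1))) (at x)"
  proof (rule DERIV_cong)
    show "((\<lambda>x. sqrt 2 * kink01 (x + y1) * (1 - (kink01 (x + y1))\<^sup>2)) has_real_derivative
      sqrt 2 * (1 - 3 * (kink01 (x + y1))\<^sup>2) * (sqrt 2 * kink01 (x + y1) * (1 - (kink01 (x + y1))\<^sup>2))) (at x)"
      by (auto intro!: derivative_eq_intros kink01_shift_DERIV simp: algebra_simps power2_eq_square)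
    have "sqrt 2 * (1 - 3 * (kink01 (x + y1))\<^sup>2) * (sqrt 2 * kink01 (x + y1) * (1 - (kink01 (x + y1))\<^sup>2))
      = (sqrt 2 * sqrt 2) * ((1 - 3 * (kink01 (x + y1))\<^sup>2) * kink01 (x + y1) * (1 - (kink01 (x + y1))\<^sup>2))"
      by (simp only: mult_ac)
    then show "sqrt 2 * (1 - 3 * (kink01 (x + y1))\<^sup>2) * (sqrt 2 * kink01 (x + y1) * (1 - (kink01 (x + y1))\<^sup>2))
      = phi6_force (kink01 (x + y1))"
      unfolding sq phi6_force_def by (simp add: algebra_simps eval_nat_numeral)
  qed
  moreover have "((\<lambda>x. - sqrt 2 * kink10 (x + y2) * (1 - (kink10 (x + y2))\<^sup>2)) has_real_derivative
      phi6_force (kink10 (x + y2))) (at x)"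
  proof (rule DERIV_cong)
    show "((\<lambda>x. - sqrt 2 * kink10 (x + y2) * (1 - (kink10 (x + y2))\<^sup>2)) has_real_derivative
      - sqrt 2 * (1 - 3 * (kink10 (x + y2))\<^sup>2) * (- sqrt 2 * kink10 (x + y2) * (1 - (kink10 (x + y2))\<^sup>2))) (at x)"
      by (auto intro!: derivative_eq_intros kink10_shift_DERIV simp: algebra_simps power2_eq_square)
    have "- sqrt 2 * (1 - 3 * (kink10 (x + y2))\<^sup>2) * (- sqrt 2 * kink10 (x + y2) * (1 - (kink10 (x + y2))\<^sup>2))
      = (sqrt 2 * sqrt 2) * ((1 - 3 * (kink10 (x + y2))\<^sup>2) * kink10 (x + y2) * (1 - (kink10 (x + y2))\<^sup>2))"
      by (simp only: mult_ac mult_minus_left mult_minus_right minus_minus)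
    then show "- sqrt 2 * (1 - 3 * (kink10 (x + y2))\<^sup>2) * (- sqrt 2 * kink10 (x + y2) * (1 - (kink10 (x + y2))\<^sup>2))
      = phi6_force (kink10 (x + y2))"
      unfolding sq phi6_force_def by (simp add: algebra_simps eval_nat_numeral)
  qed
  ultimately show ?thesis
    unfolding kink_pair_deriv_def[abs_def] kink_pair_deriv2_def by (rule DERIV_add)
qed

lemma kink_pair_continuous:
  "continuous_on UNIV (kink_pair y1 y2)" "continuous_on UNIV (kink_pair_deriv y1 y2)"
  "continuous_on UNIV (kink_pair_deriv2 y1 y2)"
  unfolding kink_pair_def[abs_def] kink_pair_deriv_def[abs_def] kink_pair_deriv2_def[abs_def] phi6_force_def
  by (intro continuous_intros kink01_continuous kink10_continuous)+

lemma kink10_bounds: "-1 < kink10 x" "kink10 x < 0"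
  using kink01_pos[of "-x"] kink01_less_1[of "-x"] by (auto simp: kink10_eq)

lemma kink_pair_abs_le_1: "\<bar>kink_pair y1 y2 x\<bar> \<le> 1"
  using kink01_pos[of "x + y1"] kink01_less_1[of "x + y1"] kink10_bounds[of "x + y2"]
  by (auto simp: kink_pair_def)

text \<open>The minimum is -14/5, at \<open>s\<^sup>2 = 2/5\<close>. The bound serves to recover
  \<open>g'\<close> from the quadratic form.\<close>

lemma phi6_curvature_lower: "-3 \<le> phi6_curvature s"
proof -
  have "phi6_curvature s + 3 = 30 * (s\<^sup>2 - 2/5)\<^sup>2 + 1/5"
    by (simp add: phi6_curvature_def power2_eq_square algebra_simps eval_nat_numeral)
  moreover have "0 \<le> 30 * (s\<^sup>2 - 2/5)\<^sup>2" by simp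
  ultimately show ?thesis by linarith
qed

text \<open>The cofactor of \<open>a - b\<close> is bounded by
  \<open>24 * 2 + 30 * 4 = 168\<close>.\<close>

lemma phi6_curvature_diff:
  fixes a b :: real
  assumes "\<bar>a\<bar> \<le> 1" "\<bar>b\<bar> \<le> 1"
  shows "\<bar>phi6_curvature a - phi6_curvature b\<bar> \<le> 168 * \<bar>a - b\<bar>"
proof -
  have "phi6_curvature a - phi6_curvature b = (a - b) * (- 24 * (a + b) + 30 * ((a + b) * (a\<^sup>2 + b\<^sup>2)))"
    by (simp add: phi6_curvature_def power2_eq_square algebra_simps eval_nat_numeral)
  moreover have "\<bar>- 24 * (a + b) + 30 * ((a + b) * (a\<^sup>2 + b\<^sup>2))\<bar> \<le> 168"
  proof -
    have 1: "\<bar>a + b\<bar> \<le> 2" using assms by linarith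
    have "a\<^sup>2 \<le> 1" "b\<^sup>2 \<le> 1" using assms by (simp_all add: abs_square_le_1)
    then have "\<bar>a\<^sup>2 + b\<^sup>2\<bar> \<le> 2" by simp
    then have "\<bar>(a + b) * (a\<^sup>2 + b\<^sup>2)\<bar> \<le> 2 * 2" unfolding abs_mult using 1 by (intro mult_mono) auto
    moreover have "\<bar>- 24 * c + 30 * w\<bar> \<le> 168" if "\<bar>c\<bar> \<le> 2" "\<bar>w\<bar> \<le> 2 * 2" for c w :: real
      using that by linarith
    ultimately show ?thesis using 1 by blast
  qed
  ultimately show ?thesis
    using mult_left_mono[of _ 168 "\<bar>a - b\<bar>"] by (simp only: abs_mult mult.commute[of 168] abs_ge_zero)
qed

lemma abs_power_le_one: "\<bar>t\<bar> \<le> 1 \<Longrightarrow> \<bar>t ^ n\<bar> \<le> 1" for t :: real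
  by (simp add: power_abs power_le_one)

lemma abs_mult_le_one: "\<bar>s\<bar> \<le> 1 \<Longrightarrow> \<bar>t\<bar> \<le> 1 \<Longrightarrow> \<bar>s * t\<bar> \<le> 1" for s t :: real
  by (simp add: abs_mult mult_le_one)

text \<open>The remainder is divisible by \<open>g\<^sup>2\<close>; 188 is the sum of the absolute
  coefficients of the cofactor.\<close>

lemma phi6_force_taylor:
  fixes s g :: real
  assumes s: "\<bar>s\<bar> \<le> 1" and g: "\<bar>g\<bar> \<le> 1"
  shows "\<bar>phi6_force (s + g) - phi6_force s - phi6_curvature s * g\<bar> \<le> 188 * g\<^sup>2"
proof -
  define K where "K = - 24 * s - 8 * g + 60 * s^3 + 60 * (s\<^sup>2 * g) + 30 * (s * g\<^sup>2) + 6 * g^3"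
  have "phi6_force (s + g) - phi6_force s - phi6_curvature s * g = K * g\<^sup>2"
    by (simp add: phi6_force_def phi6_curvature_def K_def power2_eq_square algebra_simps eval_nat_numeral)
  moreover have "\<bar>K\<bar> \<le> 188"
  proof -
    note b = s g abs_power_le_one[OF s, of 3] abs_power_le_one[OF g, of 3]
      abs_mult_le_one[OF abs_power_le_one[OF s, of 2] g] abs_mult_le_one[OF s abs_power_le_one[OF g, of 2]]
    show ?thesis
      by (rule abs_leI; use b[THEN abs_le_D1] b[THEN abs_le_D2] in \<open>unfold K_def, linarith\<close>)
  qed
  ultimately show ?thesis by (simp add: abs_mult mult_right_mono)
qed

text \<open>The first-order term keeps its factor \<open>s\<close>: halfway between the kinks the
  pair is of order \<open>sqrt q\<close>, and bounding \<open>s\<close> by 1 would lose the estimate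
  for \<open>q\<close>. The constants are sums of absolute coefficients.\<close>

lemma phi6_potential_diff:
  fixes s g :: real
  assumes s: "\<bar>s\<bar> \<le> 1" and g: "\<bar>g\<bar> \<le> 1"
  shows "\<bar>phi6_potential (s + g) - phi6_potential s\<bar> \<le> 16 * \<bar>s * g\<bar> + 80 * g\<^sup>2"
proof -
  define K where "K = 2 - 8 * s\<^sup>2 + 6 * s^4"
  define M where "M = 1 - 12 * s\<^sup>2 - 8 * (s * g) - 2 * g\<^sup>2 + 15 * s^4 + 20 * (s^3 * g)
      + 15 * (s\<^sup>2 * g\<^sup>2) + 6 * (s * g^3) + g^4"
  have eq: "phi6_potential (s + g) - phi6_potential s = K * (s * g) + M * g\<^sup>2"
    unfolding phi6_potential_def K_def M_def by algebra
  note sp = abs_power_le_one[OF s] and gp = abs_power_le_one[OF g]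
  note b = sp[of 2] sp[of 4] gp[of 2] gp[of 4] abs_mult_le_one[OF s g] abs_mult_le_one[OF sp[of 3] g]
    abs_mult_le_one[OF sp[of 2] gp[of 2]] abs_mult_le_one[OF s gp[of 3]]
  note bb = b[THEN abs_le_D1] b[THEN abs_le_D2]
  have M: "\<bar>M\<bar> \<le> 80" by (rule abs_leI; use bb in \<open>unfold M_def, linarith\<close>)
  have K: "\<bar>K\<bar> \<le> 16" by (rule abs_leI; use bb in \<open>unfold K_def, linarith\<close>)
  have "\<bar>K * (s * g) + M * g\<^sup>2\<bar> \<le> \<bar>K\<bar> * \<bar>s * g\<bar> + \<bar>M\<bar> * g\<^sup>2"
    using abs_triangle_ineq[of "K * (s * g)" "M * g\<^sup>2"] by (simp add: abs_mult)
  also have "\<dots> \<le> 16 * \<bar>s * g\<bar> + 80 * g\<^sup>2"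
    by (intro add_mono mult_right_mono M K) auto
  finally show ?thesis unfolding eq .
qed

text \<open>For kink values \<open>a\<close> and \<open>- b\<close> the mixed terms of the force are
  \<open>a b (a - b)\<close> times a bounded polynomial. In \<open>a\<^sup>2 b\<close> the factor
  \<open>b\<close> is at most \<open>q exp (- sqrt 2 (x + y1))\<close>, and \<open>a\<^sup>2\<close>
  turns this exponential into a bell at the first kink; \<open>a b\<^sup>2\<close> is symmetric. The
  profile multiplying \<open>q\<close> thus has an integral bounded independently of the
  separation.\<close>

lemma kink_pair_interaction:
  "\<bar>phi6_force (kink_pair y1 y2 x) - kink_pair_deriv2 y1 y2 x\<bar>
     \<le> 36 * (exp (- sqrt 2 * (y2 - y1)) * (bell (x + y1) + bell (x + y2)))"
proof -
  define a where "a = kink01 (x + y1)"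
  define b where "b = kink01 (- (x + y2))"
  define q where "q = exp (- sqrt 2 * (y2 - y1))"
  have ab: "0 < a" "a < 1" "0 < b" "b < 1" unfolding a_def b_def by (simp_all only: kink01_pos kink01_less_1)
  have "phi6_force (kink_pair y1 y2 x) - kink_pair_deriv2 y1 y2 x = phi6_force (a - b) - phi6_force a - phi6_force (- b)"
    by (simp add: kink_pair_def kink_pair_deriv2_def a_def b_def kink10_eq)
  also have "\<dots> = (a\<^sup>2 * b - a * b\<^sup>2) * (24 - 30 * (a\<^sup>2 - a * b + b\<^sup>2))"
    by (simp add: phi6_force_def power2_eq_square algebra_simps eval_nat_numeral)
  finally have eq: "phi6_force (kink_pair y1 y2 x) - kink_pair_deriv2 y1 y2 x
      = (a\<^sup>2 * b - a * b\<^sup>2) * (24 - 30 * (a\<^sup>2 - a * b + b\<^sup>2))" .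
  have "b \<le> exp (sqrt 2 * (- (x + y2)))" unfolding b_def by (rule kink01_le_exp)
  also have "\<dots> = exp (- (sqrt 2 * (x + y1))) * q" unfolding q_def exp_add[symmetric] by (simp add: algebra_simps)
  finally have "a\<^sup>2 * b \<le> a\<^sup>2 * (exp (- (sqrt 2 * (x + y1))) * q)" by (intro mult_left_mono) auto
  then have 1: "a\<^sup>2 * b \<le> q * bell (x + y1)"
    using kink01_sq_times_exp[of "x + y1"] unfolding a_def[symmetric] by (metis mult.assoc mult.commute)
  have "a \<le> exp (sqrt 2 * (x + y1))" unfolding a_def by (rule kink01_le_exp)
  also have "\<dots> = exp (- (sqrt 2 * (- (x + y2)))) * q" unfolding q_def exp_add[symmetric] by (simp add: algebra_simps)
  finally have "b\<^sup>2 * a \<le> b\<^sup>2 * (exp (- (sqrt 2 * (- (x + y2)))) * q)" by (intro mult_left_mono) auto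
  then have 2: "a * b\<^sup>2 \<le> q * bell (x + y2)"
    using kink01_sq_times_exp[of "- (x + y2)"] bell_minus[of "x + y2"] unfolding b_def[symmetric]
    by (metis mult.assoc mult.commute)
  have nn: "0 \<le> a\<^sup>2 * b" "0 \<le> a * b\<^sup>2" using ab by auto
  have 3: "\<bar>a\<^sup>2 * b - a * b\<^sup>2\<bar> \<le> q * (bell (x + y1) + bell (x + y2))"
    using 1 2 nn by (simp add: distrib_left)
  \<comment> \<open>The bracket \<open>a\<^sup>2 - a * b + b\<^sup>2\<close> lies between 0 and 2,
    so the factor lies between -36 and 24.\<close>
  have 4: "\<bar>24 - 30 * (a\<^sup>2 - a * b + b\<^sup>2)\<bar> \<le> 36"
  proof -
    have "a\<^sup>2 \<le> 1" "b\<^sup>2 \<le> 1" using ab by (simp_all add: power_le_one)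
    moreover have "0 \<le> a * b" using ab by simp
    moreover have "0 \<le> (a - b)\<^sup>2" by simp
    then have "2 * (a * b) \<le> a\<^sup>2 + b\<^sup>2" by (simp add: power2_eq_square algebra_simps)
    moreover have "0 \<le> a\<^sup>2" "0 \<le> b\<^sup>2" by simp_all
    moreover have "\<bar>24 - 30 * (A - c + B)\<bar> \<le> 36"
      if "A \<le> 1" "B \<le> 1" "0 \<le> c" "2 * c \<le> A + B" "0 \<le> A" "0 \<le> B" for A B c :: real
      using that by (intro abs_leI) auto
    ultimately show ?thesis by blast
  qed
  have "\<bar>(a\<^sup>2 * b - a * b\<^sup>2) * (24 - 30 * (a\<^sup>2 - a * b + b\<^sup>2))\<bar> \<le> (q * (bell (x + y1) + bell (x + y2))) * 36"
    unfolding abs_mult by (intro mult_mono 3 4) (use bell_bounds in \<open>auto simp: q_def intro!: mult_nonneg_nonneg add_nonneg_nonneg\<close>)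
  then show ?thesis unfolding eq q_def by (simp add: mult.commute)
qed

text \<open>Expanding \<open>(g' - \<psi> g)\<^sup>2 \<ge> 0\<close> and completing to the exact
  derivative of \<open>\<psi> g\<^sup>2\<close> turns a pointwise Riccati inequality with slack
  \<open>c\<close> into a bound for the quadratic form, at the price of boundary values
  only.\<close>

lemma riccati_lower_bound:
  fixes g g' \<psi> \<psi>' V :: "real \<Rightarrow> real"
  assumes pq: "p \<le> q" and dg: "\<And>x. (g has_real_derivative g' x) (at x)" and cg': "continuous_on UNIV g'"
    and d\<psi>: "\<And>x. (\<psi> has_real_derivative \<psi>' x) (at x)" and c\<psi>': "continuous_on UNIV \<psi>'"
    and cV: "continuous_on UNIV V"
    and le: "\<And>x. x \<in> {p..q} \<Longrightarrow> \<psi>' x + (\<psi> x)\<^sup>2 + c \<le> V x"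
  shows "c * integral {p..q} (\<lambda>x. (g x)\<^sup>2) + \<psi> q * (g q)\<^sup>2 - \<psi> p * (g p)\<^sup>2
    \<le> integral {p..q} (\<lambda>x. (g' x)\<^sup>2 + V x * (g x)\<^sup>2)"
proof -
  have cg: "continuous_on UNIV g" by (rule DERIV_continuous_on) (rule dg)
  have c\<psi>: "continuous_on UNIV \<psi>" by (rule DERIV_continuous_on) (rule d\<psi>)
  let ?w = "\<lambda>x. \<psi>' x * (g x)\<^sup>2 + \<psi> x * (2 * g x * g' x)"
  have P: "primitive ?w (\<lambda>x. \<psi> x * (g x)\<^sup>2)"
  proof (rule primitive_deriv)
    fix x
    have "((\<lambda>x. (g x)\<^sup>2) has_real_derivative 2 * g x * g' x) (at x)"
      using DERIV_power[OF dg[of x], of 2] by (simp add: mult_ac)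
    from DERIV_mult[OF d\<psi> this]
    show "((\<lambda>x. \<psi> x * (g x)\<^sup>2) has_real_derivative ?w x) (at x)" by (simp add: algebra_simps)
    show "continuous_on UNIV ?w" by (intro continuous_intros cg cg' c\<psi> c\<psi>')
  qed
  have i1: "(\<lambda>x. c * (g x)\<^sup>2) integrable_on {p..q}"
    by (intro locally_integrable_on locally_integrable_continuous continuous_intros cg)
  have i2: "?w integrable_on {p..q}" by (rule locally_integrable_on[OF primitiveD(1)[OF P]])
  have "integral {p..q} (\<lambda>x. c * (g x)\<^sup>2 + ?w x) \<le> integral {p..q} (\<lambda>x. (g' x)\<^sup>2 + V x * (g x)\<^sup>2)"
  proof (rule integral_le)
    show "(\<lambda>x. c * (g x)\<^sup>2 + ?w x) integrable_on {p..q}" by (rule integrable_add[OF i1 i2])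
    show "(\<lambda>x. (g' x)\<^sup>2 + V x * (g x)\<^sup>2) integrable_on {p..q}"
      by (intro locally_integrable_on locally_integrable_continuous continuous_intros cg cg' cV)
    fix x assume "x \<in> {p..q}"
    then have "(\<psi>' x + (\<psi> x)\<^sup>2 + c) * (g x)\<^sup>2 \<le> V x * (g x)\<^sup>2"
      by (intro mult_right_mono le) auto
    moreover have "0 \<le> (g' x - \<psi> x * g x)\<^sup>2" by simp
    ultimately show "c * (g x)\<^sup>2 + ?w x \<le> (g' x)\<^sup>2 + V x * (g x)\<^sup>2"
      by (simp add: power2_eq_square algebra_simps)
  qed
  moreover have "integral {p..q} (\<lambda>x. c * (g x)\<^sup>2 + ?w x)
      = c * integral {p..q} (\<lambda>x. (g x)\<^sup>2) + (\<psi> q * (g q)\<^sup>2 - \<psi> p * (g p)\<^sup>2)"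
    using integral_add[OF i1 i2] primitiveD(2)[OF P pq] by simp
  ultimately show ?thesis by simp
qed

text \<open>The square \<open>T\<close> of the kink satisfies
  \<open>T' = 2 sqrt 2 T (1 - T)\<close>, so for candidates affine in \<open>T\<close> the Riccati
  expression is quadratic in \<open>T\<close>. The values \<open>\<alpha> = 1\<close>,
  \<open>\<beta> = 3\<close> belong to the exact ground state.\<close>

lemma kink01_riccati_DERIV:
  "((\<lambda>x. sqrt 2 * (\<alpha> - \<beta> * (kink01 (x + y))\<^sup>2)) has_real_derivative
     - (4 * \<beta> * (kink01 (x + y))\<^sup>2 * (1 - (kink01 (x + y))\<^sup>2))) (at x)"
proof (rule DERIV_cong)
  let ?h = "kink01 (x + y)"
  show "((\<lambda>x. sqrt 2 * (\<alpha> - \<beta> * (kink01 (x + y))\<^sup>2)) has_real_derivative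
     sqrt 2 * (0 - \<beta> * (2 * (sqrt 2 * ?h * (1 - ?h\<^sup>2)) * ?h))) (at x)"
    by (auto intro!: derivative_eq_intros kink01_shift_DERIV)
  have "sqrt 2 * (0 - \<beta> * (2 * (sqrt 2 * ?h * (1 - ?h\<^sup>2)) * ?h))
      = - (sqrt 2 * sqrt 2 * (2 * \<beta> * (?h * ?h) * (1 - ?h\<^sup>2)))"
    by (simp only: mult_ac mult_minus_right diff_0)
  then show "sqrt 2 * (0 - \<beta> * (2 * (sqrt 2 * ?h * (1 - ?h\<^sup>2)) * ?h)) = - (4 * \<beta> * ?h\<^sup>2 * (1 - ?h\<^sup>2))"
    by (simp add: power2_eq_square)
qed

text \<open>Near \<open>kink01\<close> the linearised operator has ground state \<open>kink01'\<close>, with logarithmic derivative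
  \<open>sqrt 2 * (1 - 3 * kink01\<^sup>2)\<close>. Perturbing it separately on both sides of the point where it vanishes
  yields a strict Riccati subsolution, at the price of a jump at that point only.\<close>

lemma kink01_half_line_coercive:
  fixes g g' V :: "real \<Rightarrow> real"
  assumes ord: "m \<le> \<xi>" "\<xi> \<le> R" and \<xi>: "(kink01 (\<xi> + y))\<^sup>2 = 1/3"
    and dg: "\<And>x. (g has_real_derivative g' x) (at x)" and cg': "continuous_on UNIV g'"
    and cV: "continuous_on UNIV V"
    and V: "\<And>x. m \<le> x \<Longrightarrow> phi6_curvature (kink01 (x + y)) - 1/25 \<le> V x"
  shows "1/25 * integral {m..R} (\<lambda>x. (g x)\<^sup>2)
    \<le> integral {m..R} (\<lambda>x. (g' x)\<^sup>2 + V x * (g x)\<^sup>2) + 3 * (g m)\<^sup>2 + 6 * (g \<xi>)\<^sup>2 + 3 * (g R)\<^sup>2"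
proof -
  have cg: "continuous_on UNIV g" by (rule DERIV_continuous_on) (rule dg)
  define T where "T x = (kink01 (x + y))\<^sup>2" for x
  have T01: "0 \<le> T x" "T x \<le> 1" for x
    using less_imp_le[OF kink01_pos[of "x + y"]] less_imp_le[OF kink01_less_1[of "x + y"]]
    unfolding T_def by (auto simp: power_le_one)
  have Tmono: "T x \<le> T z" if "x \<le> z" for x z
    unfolding T_def by (intro power_mono kink01_mono) (use that less_imp_le[OF kink01_pos] in auto)
  have curv: "phi6_curvature (kink01 (x + y)) = 2 - 24 * T x + 30 * (T x)\<^sup>2" for x
    by (simp add: phi6_curvature_def T_def)
  define \<psi> where "\<psi> \<alpha> \<beta> x = sqrt 2 * (\<alpha> - \<beta> * T x)" for \<alpha> \<beta> x :: real
  define \<psi>' where "\<psi>' \<beta> x = - (4 * \<beta> * T x * (1 - T x))" for \<beta> x :: real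
  have d\<psi>: "(\<psi> \<alpha> \<beta> has_real_derivative \<psi>' \<beta> x) (at x)" for \<alpha> \<beta> x
    unfolding \<psi>_def[abs_def] \<psi>'_def T_def by (rule kink01_riccati_DERIV)
  have c\<psi>': "continuous_on UNIV (\<psi>' \<beta>)" for \<beta>
    unfolding \<psi>'_def[abs_def] T_def by (intro continuous_intros kink01_continuous)
  have \<psi>sq: "(\<psi> \<alpha> \<beta> x)\<^sup>2 = 2 * (\<alpha> - \<beta> * T x)\<^sup>2" for \<alpha> \<beta> x
    by (simp add: \<psi>_def power_mult_distrib)
  have \<psi>bd: "\<bar>\<psi> \<alpha> \<beta> x\<bar> \<le> 3" if "\<bar>\<alpha> - \<beta> * T x\<bar> \<le> 2" for \<alpha> \<beta> x
  proof -
    have "\<bar>sqrt 2\<bar> * \<bar>\<alpha> - \<beta> * T x\<bar> \<le> 3/2 * 2" using that sqrt2_bounds by (intro mult_mono) auto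
    then show ?thesis by (simp add: \<psi>_def abs_mult)
  qed
  \<comment> \<open>Perturbing the ground state values 1, 3 to 9/10, 16/5 gives the Riccati
    inequality with slack 2/25 for \<open>0 \<le> T \<le> 1/3\<close>. Half of the slack pays for
    the error in \<open>V\<close>, the other half is the coercivity constant.\<close>
  have left: "1/25 * integral {m..\<xi>} (\<lambda>x. (g x)\<^sup>2) + \<psi> (9/10) (16/5) \<xi> * (g \<xi>)\<^sup>2 - \<psi> (9/10) (16/5) m * (g m)\<^sup>2
    \<le> integral {m..\<xi>} (\<lambda>x. (g' x)\<^sup>2 + V x * (g x)\<^sup>2)"
  proof (rule riccati_lower_bound[OF ord(1) dg cg' d\<psi> c\<psi>' cV])
    fix x assume x: "x \<in> {m..\<xi>}"
    have t: "0 \<le> T x" "T x \<le> 1/3" using T01 Tmono[of x \<xi>] x \<xi> by (auto simp: T_def)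
    have "T x * T x \<le> 1/3 * T x" using t by (intro mult_right_mono) auto
    moreover have "\<psi>' (16/5) x + (\<psi> (9/10) (16/5) x)\<^sup>2 = 81/50 - 608/25 * T x + 832/25 * (T x * T x)"
      unfolding \<psi>sq \<psi>'_def by (simp add: power2_eq_square field_simps)
    ultimately have "\<psi>' (16/5) x + (\<psi> (9/10) (16/5) x)\<^sup>2 + 2/25 \<le> 2 - 24 * T x + 30 * (T x)\<^sup>2"
      using t unfolding power2_eq_square[of "T x"] by linarith
    then show "\<psi>' (16/5) x + (\<psi> (9/10) (16/5) x)\<^sup>2 + 1/25 \<le> V x"
      using V[of x] x curv[of x] by auto
  qed
  \<comment> \<open>For \<open>1/3 \<le> T \<le> 1\<close> the values 6/5, 63/20 leave the same
    slack; bounding \<open>T\<^sup>2\<close> by its chord makes the check linear in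
    \<open>T\<close>.\<close>
  have right: "1/25 * integral {\<xi>..R} (\<lambda>x. (g x)\<^sup>2) + \<psi> (6/5) (63/20) R * (g R)\<^sup>2 - \<psi> (6/5) (63/20) \<xi> * (g \<xi>)\<^sup>2
    \<le> integral {\<xi>..R} (\<lambda>x. (g' x)\<^sup>2 + V x * (g x)\<^sup>2)"
  proof (rule riccati_lower_bound[OF ord(2) dg cg' d\<psi> c\<psi>' cV])
    fix x assume x: "x \<in> {\<xi>..R}"
    have t: "1/3 \<le> T x" "T x \<le> 1" using T01 Tmono[of \<xi> x] x \<xi> by (auto simp: T_def)
    have "0 \<le> (T x - 1/3) * (1 - T x)" using t by simp
    also have "\<dots> = 4/3 * T x - 1/3 - T x * T x" by (simp add: field_simps)
    finally have "T x * T x \<le> 4/3 * T x - 1/3" by simp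
    moreover have "\<psi>' (63/20) x + (\<psi> (6/5) (63/20) x)\<^sup>2 = 72/25 - 693/25 * T x + 6489/200 * (T x * T x)"
      unfolding \<psi>sq \<psi>'_def by (simp add: power2_eq_square field_simps)
    ultimately have "\<psi>' (63/20) x + (\<psi> (6/5) (63/20) x)\<^sup>2 + 2/25 \<le> 2 - 24 * T x + 30 * (T x)\<^sup>2"
      using t unfolding power2_eq_square[of "T x"] by linarith
    then show "\<psi>' (63/20) x + (\<psi> (6/5) (63/20) x)\<^sup>2 + 1/25 \<le> V x"
      using V[of x] x ord curv[of x] by auto
  qed
  have T\<xi>: "T \<xi> = 1/3" using \<xi> by (simp add: T_def)
  \<comment> \<open>Up to the factor \<open>sqrt 2\<close> the one-sided values at
    \<open>\<xi>\<close> are -1/6 and 3/20, so they do not match. The crude bound 3 is affordable,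
    since the lemma is applied with \<open>g \<xi>\<close> of order \<open>q\<close>.\<close>
  have "\<bar>\<psi> (9/10) (16/5) \<xi>\<bar> \<le> 3" "\<bar>\<psi> (6/5) (63/20) \<xi>\<bar> \<le> 3"
    by (rule \<psi>bd, simp add: T\<xi>)+
  moreover have "\<bar>\<psi> (9/10) (16/5) m\<bar> \<le> 3"
    by (rule \<psi>bd, rule abs_leI) (use T01[of m] Tmono[OF ord(1)] T\<xi> in linarith)+
  moreover have "\<bar>\<psi> (6/5) (63/20) R\<bar> \<le> 3"
    by (rule \<psi>bd, rule abs_leI) (use T01[of R] in linarith)+
  ultimately have "- 3 * (g \<xi>)\<^sup>2 \<le> \<psi> (9/10) (16/5) \<xi> * (g \<xi>)\<^sup>2" "\<psi> (9/10) (16/5) m * (g m)\<^sup>2 \<le> 3 * (g m)\<^sup>2"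
     "- 3 * (g R)\<^sup>2 \<le> \<psi> (6/5) (63/20) R * (g R)\<^sup>2" "\<psi> (6/5) (63/20) \<xi> * (g \<xi>)\<^sup>2 \<le> 3 * (g \<xi>)\<^sup>2"
    by - (rule mult_right_mono, linarith, rule zero_le_power2)+
  moreover have "integral {m..\<xi>} (\<lambda>x. (g x)\<^sup>2) + integral {\<xi>..R} (\<lambda>x. (g x)\<^sup>2) = integral {m..R} (\<lambda>x. (g x)\<^sup>2)"
    by (rule Henstock_Kurzweil_Integration.integral_combine[OF ord])
       (intro locally_integrable_on locally_integrable_continuous continuous_intros cg)
  moreover have "integral {m..\<xi>} (\<lambda>x. (g' x)\<^sup>2 + V x * (g x)\<^sup>2) + integral {\<xi>..R} (\<lambda>x. (g' x)\<^sup>2 + V x * (g x)\<^sup>2)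
      = integral {m..R} (\<lambda>x. (g' x)\<^sup>2 + V x * (g x)\<^sup>2)"
    by (rule Henstock_Kurzweil_Integration.integral_combine[OF ord])
       (intro locally_integrable_on locally_integrable_continuous continuous_intros cg cg' cV)
  ultimately show ?thesis using left right by linarith
qed

subsection \<open>A priori estimates near a pair of kinks\<close>

text \<open>The inflection point of \<open>kink01\<close>, a zero of its second derivative:
  \<open>kink01\<^sup>2 = 1/3\<close> amounts to \<open>exp (2 sqrt 2 x) = 1/2\<close>.\<close>

definition kink_zero :: real where
  "kink_zero = - ln 2 / (2 * sqrt 2)"

lemma exp_kink_zero: "(exp (sqrt 2 * kink_zero))\<^sup>2 = 1/2"
proof -
  have "(exp (sqrt 2 * kink_zero))\<^sup>2 = exp (- ln 2)"
    by (simp add: kink_zero_def exp_double[symmetric])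
  then show ?thesis by (simp add: exp_minus)
qed

lemma kink01_kink_zero: "(kink01 kink_zero)\<^sup>2 = 1/3"
  unfolding kink01_sq exp_kink_zero by simp

lemma kink_zero_abs: "\<bar>kink_zero\<bar> \<le> 1"
proof -
  have "0 \<le> ln (2::real)" "ln (2::real) \<le> 1" using ln_2_less_1 by auto
  then have "ln 2 / (2 * sqrt 2) \<le> 1 / 1" using sqrt2_bounds(1) by (intro frac_le; linarith)
  then show ?thesis using sqrt2_bounds \<open>0 \<le> ln 2\<close> by (simp add: kink_zero_def)
qed

text \<open>Giving up exponential decay for \<open>1 / t\<close> keeps the numerical constants
  rational; the price is the enormous separations demanded later.\<close>

lemma exp_minus_sqrt2_le: "0 \<le> t \<Longrightarrow> exp (- sqrt 2 * t) \<le> 1 / (1 + t)"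
proof -
  assume t: "0 \<le> t"
  have "1 + t \<le> exp t" by (rule exp_ge_add_one_self)
  also have "\<dots> \<le> exp (sqrt 2 * t)" using t sqrt2_bounds mult_right_mono[of 1 "sqrt 2" t] by simp
  finally show ?thesis using t by (simp add: exp_minus field_simps)
qed

lemma young_ineq: "0 < T \<Longrightarrow> \<bar>a * b\<bar> \<le> a\<^sup>2 / T + T / 4 * b\<^sup>2" for a b T :: real
proof -
  assume T: "0 < T"
  have "A\<^sup>2 / T + T / 4 * B\<^sup>2 - A * B = (2 * A - T * B)\<^sup>2 / (4 * T)" for A B
    using T by (simp add: field_simps power2_eq_square)
  from this[of "\<bar>a\<bar>" "\<bar>b\<bar>"] have "a\<^sup>2 / T + T / 4 * b\<^sup>2 - \<bar>a * b\<bar> = (2 * \<bar>a\<bar> - T * \<bar>b\<bar>)\<^sup>2 / (4 * T)"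
    by (simp only: power2_abs abs_mult)
  moreover have "0 \<le> (2 * \<bar>a\<bar> - T * \<bar>b\<bar>)\<^sup>2 / (4 * T)" using T by simp
  ultimately show ?thesis by linarith
qed

text \<open>As \<open>4200 = 168 * 25\<close>, such a tail changes the curvature by at most 1/25
  according to \<open>phi6_curvature_diff\<close>.\<close>

lemma kink_tail: "5000 \<le> t \<Longrightarrow> kink01 (- t) \<le> 1/4200"
proof -
  assume t: "5000 \<le> t"
  have "kink01 (- t) \<le> exp (- sqrt 2 * t)" using kink01_le_exp[of "- t"] by simp
  also have "\<dots> \<le> 1 / (1 + t)" by (rule exp_minus_sqrt2_le) (use t in simp)
  also have "\<dots> \<le> 1/4200" using t by (intro divide_left_mono) auto
  finally show ?thesis .
qed

lemma kink_pair_tendsto: "(kink_pair y1 y2 \<longlongrightarrow> 1) at_top" "(kink_pair_deriv y1 y2 \<longlongrightarrow> 0) at_top"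
proof -
  have sh: "filterlim (\<lambda>x::real. x + c) at_top at_top" for c
    using filterlim_tendsto_add_at_top[OF tendsto_const filterlim_ident, of c] by (simp add: add.commute)
  have a: "((\<lambda>x. kink01 (x + y1)) \<longlongrightarrow> 1) at_top"
    by (rule filterlim_compose[OF kink01_tendsto_top sh])
  have "((\<lambda>x. kink01 (- (x + y2))) \<longlongrightarrow> 0) at_top"
    by (rule filterlim_compose[OF kink01_tendsto_bot filterlim_compose[OF filterlim_uminus_at_bot_at_top sh]])
  from tendsto_minus[OF this] have b: "((\<lambda>x. kink10 (x + y2)) \<longlongrightarrow> 0) at_top"
    by (simp add: kink10_eq)
  show "(kink_pair y1 y2 \<longlongrightarrow> 1) at_top"
    using tendsto_add[OF a b] by (simp add: kink_pair_def[abs_def])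
  have "(kink_pair_deriv y1 y2 \<longlongrightarrow> sqrt 2 * 1 * (1 - 1\<^sup>2) + (- sqrt 2 * 0 * (1 - 0\<^sup>2))) at_top"
    unfolding kink_pair_deriv_def[abs_def] by (intro tendsto_intros a b)
  then show "(kink_pair_deriv y1 y2 \<longlongrightarrow> 0) at_top" by simp
qed

text \<open>Meant for \<open>s\<close> equal to minus half the separation, so that
  \<open>exp (sqrt 2 * s) = sqrt q\<close>. Displacing the midpoint by at most 1/2 changes the size
  of either tail only by a bounded factor.\<close>

lemma kink01_middle:
  assumes "\<bar>\<tau>\<bar> \<le> 1/2" "exp (sqrt 2 * s) \<le> 1/100"
  shows "exp (sqrt 2 * s) / 4 \<le> kink01 (s + \<tau>)" "kink01 (s + \<tau>) \<le> 3 * exp (sqrt 2 * s)"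
proof -
  define p where "p = exp (sqrt 2 * s)"
  define e where "e = exp (sqrt 2 * (s + \<tau>))"
  have p: "0 < p" "p \<le> 1/100" using assms by (auto simp: p_def)
  have "\<bar>sqrt 2 * \<tau>\<bar> \<le> 3/2 * (1/2)" unfolding abs_mult using assms(1) sqrt2_bounds by (intro mult_mono) auto
  then have "sqrt 2 * \<tau> \<le> 1" "- 1 \<le> sqrt 2 * \<tau>" by (auto simp: abs_le_iff)
  then have "exp (sqrt 2 * \<tau>) \<le> exp 1" "exp (- 1) \<le> exp (sqrt 2 * \<tau>)" by (simp_all only: exp_le_cancel_iff)
  moreover have "1/3 \<le> exp (- 1::real)" using exp_le by (simp add: exp_minus field_simps)
  ultimately have "exp (sqrt 2 * \<tau>) \<le> 3" "1/3 \<le> exp (sqrt 2 * \<tau>)" using exp_le by linarith+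
  moreover have "e = p * exp (sqrt 2 * \<tau>)" by (simp add: e_def p_def exp_add[symmetric] distrib_left)
  ultimately have e: "e \<le> p * 3" "p * (1/3) \<le> e"
    using p by (auto intro!: mult_left_mono)
  have k: "kink01 (s + \<tau>) = e / sqrt (1 + e\<^sup>2)" by (simp add: kink01_alt e_def)
  have "kink01 (s + \<tau>) \<le> e" unfolding e_def by (rule kink01_le_exp)
  then show "kink01 (s + \<tau>) \<le> 3 * exp (sqrt 2 * s)" using e by (simp add: p_def)
  have "e\<^sup>2 \<le> (3/100)\<^sup>2" using e p by (intro power_mono) auto
  then have "sqrt (1 + e\<^sup>2) \<le> 4/3" by (intro real_le_lsqrt) (auto simp: power2_eq_square)
  then have "e / (4/3) \<le> e / sqrt (1 + e\<^sup>2)"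
    by (intro divide_left_mono mult_pos_pos real_sqrt_gt_zero) (auto simp: e_def intro!: add_pos_nonneg)
  then show "exp (sqrt 2 * s) / 4 \<le> kink01 (s + \<tau>)" using e unfolding k p_def[symmetric] by simp
qed

text \<open>Here \<open>f\<close> is the residual, \<open>d\<close> a positive bound for its norm
  (the energy estimate divides by \<open>d\<close>), and \<open>N\<close> any bound for the squared
  \<open>H\<^sup>1\<close> norm of the error over finite intervals. The separation 15000 leaves room
  for a good cut between the kinks, and 1/160000 makes the Taylor remainder absorbable.\<close>

locale near_kink_pair =
  fixes u v f :: "real \<Rightarrow> real" and y1 y2 d N :: real
  assumes u_deriv: "\<And>x. (u has_real_derivative v x) (at x)"
    and v_prim: "primitive (\<lambda>x. phi6_force (u x) + f x) v"
    and f2_int: "\<And>a b. (\<lambda>x. (f x)\<^sup>2) integrable_on {a..b}"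
    and f2_le: "\<And>a b. a \<le> b \<Longrightarrow> integral {a..b} (\<lambda>x. (f x)\<^sup>2) \<le> d\<^sup>2"
    and d_pos: "0 < d" and d_le_1: "d \<le> 1"
    and sep: "15000 \<le> y2 - y1"
    and small: "\<And>x. \<bar>u x - kink_pair y1 y2 x\<bar> \<le> 1/160000"
    and at_zero1: "(u (kink_zero - y1) - kink_pair y1 y2 (kink_zero - y1))\<^sup>2 \<le> 2 * (exp (- sqrt 2 * (y2 - y1)))\<^sup>2"
    and at_zero2: "(u (- kink_zero - y2) - kink_pair y1 y2 (- kink_zero - y2))\<^sup>2 \<le> 2 * (exp (- sqrt 2 * (y2 - y1)))\<^sup>2"
    and N_bound: "\<And>a b. a \<le> b \<Longrightarrow>
      integral {a..b} (\<lambda>x. (u x - kink_pair y1 y2 x)\<^sup>2 + (v x - kink_pair_deriv y1 y2 x)\<^sup>2) \<le> N"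
begin

definition g where "g x = u x - kink_pair y1 y2 x"
definition g' where "g' x = v x - kink_pair_deriv y1 y2 x"
definition V where "V x = phi6_curvature (kink_pair y1 y2 x)"
definition q where "q = exp (- sqrt 2 * (y2 - y1))"
definition I where "I a b = integral {a..b} (\<lambda>x. (g x)\<^sup>2 + (g' x)\<^sup>2)"

lemma v_continuous: "continuous_on UNIV v" by (rule primitive_continuous[OF v_prim])

lemma u_continuous: "continuous_on UNIV u" by (rule DERIV_continuous_on) (rule u_deriv)

lemma g_deriv: "(g has_real_derivative g' x) (at x)"
  unfolding g_def[abs_def] g'_def by (rule DERIV_diff[OF u_deriv kink_pair_DERIV])

lemma g_continuous: "continuous_on UNIV g" by (rule DERIV_continuous_on) (rule g_deriv)

lemma g'_continuous: "continuous_on UNIV g'"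
  unfolding g'_def[abs_def] by (intro continuous_intros v_continuous kink_pair_continuous)

lemma V_continuous: "continuous_on UNIV V"
  unfolding V_def[abs_def] phi6_curvature_def by (intro continuous_intros kink_pair_continuous)

lemma g'_prim: "primitive (\<lambda>x. phi6_force (u x) + f x - kink_pair_deriv2 y1 y2 x) g'"
proof -
  have "primitive (kink_pair_deriv2 y1 y2) (kink_pair_deriv y1 y2)"
    by (rule primitive_deriv[OF kink_pair_deriv_DERIV kink_pair_continuous(3)])
  from primitive_diff[OF v_prim this] show ?thesis unfolding g'_def[abs_def] .
qed

lemma I_le: "a \<le> b \<Longrightarrow> I a b \<le> N"
  using N_bound by (simp add: I_def g_def g'_def)

lemma N_nonneg: "0 \<le> N"
  using I_le[of 0 0] by (simp add: I_def)

lemma I_split: "I a b = integral {a..b} (\<lambda>x. (g x)\<^sup>2) + integral {a..b} (\<lambda>x. (g' x)\<^sup>2)"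
  unfolding I_def
  by (rule integral_add; intro locally_integrable_on locally_integrable_continuous
      continuous_intros g_continuous g'_continuous)

lemma g2_le: "a \<le> b \<Longrightarrow> integral {a..b} (\<lambda>x. (g x)\<^sup>2) \<le> N"
proof -
  assume "a \<le> b"
  moreover have "0 \<le> integral {a..b} (\<lambda>x. (g' x)\<^sup>2)"
    by (rule integral_nonneg) (auto intro!: locally_integrable_on locally_integrable_continuous
      continuous_intros g'_continuous)
  ultimately show ?thesis using I_le[of a b] I_split[of a b] by simp
qed

lemma q_bounds: "0 < q" "q \<le> 1/15000"
proof -
  have "q \<le> 1 / (1 + (y2 - y1))" unfolding q_def by (rule exp_minus_sqrt2_le) (use sep in simp)
  also have "\<dots> \<le> 1/15000" using sep by (intro divide_left_mono) auto
  finally show "q \<le> 1/15000" .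
qed (simp add: q_def)

lemma g_zero: "(g (kink_zero - y1))\<^sup>2 \<le> 2 * q\<^sup>2" "(g (- kink_zero - y2))\<^sup>2 \<le> 2 * q\<^sup>2"
  using at_zero1 at_zero2 by (simp_all add: g_def q_def)

text \<open>The line is cut at a point \<open>m\<close> where \<open>g\<^sup>2\<close> is below its
  mean over a window of length 5000, so both sides together pay only \<open>6 / 5000 * N\<close> for
  the cut. The window keeps distance 5000 from both kinks, so each half sees a single kink up to
  1/25 in the curvature.\<close>

lemma coercive:
  assumes L: "L \<le> - kink_zero - y2" and R: "kink_zero - y1 \<le> R"
  shows "1/25 * integral {L..R} (\<lambda>x. (g x)\<^sup>2)
    \<le> integral {L..R} (\<lambda>x. (g' x)\<^sup>2 + V x * (g x)\<^sup>2)
      + 6/5000 * N + 24 * q\<^sup>2 + 3 * (g L)\<^sup>2 + 3 * (g R)\<^sup>2"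
proof -
  define p where "p = - y2 + 5000"
  have p: "p + 5000 \<le> - y1 - 5000" using sep by (simp add: p_def)
  obtain m where m: "p \<le> m" "m \<le> p + 5000" "(p + 5000 - p) * (g m)\<^sup>2 \<le> integral {p..p+5000} (\<lambda>x. (g x)\<^sup>2)"
    using small_value_in_interval[of "\<lambda>x. (g x)\<^sup>2" p "p + 5000"] g_continuous by (auto intro: continuous_intros)
  have gm: "(g m)\<^sup>2 \<le> N / 5000" using m(3) g2_le[of p "p+5000"] by simp
  have ord: "- kink_zero - y2 \<le> m" "m \<le> kink_zero - y1"
    using m p kink_zero_abs by (auto simp: p_def abs_le_iff)
  have right: "1/25 * integral {m..R} (\<lambda>x. (g x)\<^sup>2)
    \<le> integral {m..R} (\<lambda>x. (g' x)\<^sup>2 + V x * (g x)\<^sup>2)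
      + 3 * (g m)\<^sup>2 + 6 * (g (kink_zero - y1))\<^sup>2 + 3 * (g R)\<^sup>2"
  proof (rule kink01_half_line_coercive[OF ord(2) R _ g_deriv g'_continuous V_continuous, where y=y1])
    show "(kink01 (kink_zero - y1 + y1))\<^sup>2 = 1/3" using kink01_kink_zero by simp
    fix x assume x: "m \<le> x"
    have "kink01 (- (x + y2)) \<le> 1/4200" using x m by (intro kink_tail) (auto simp: p_def)
    then have "\<bar>kink_pair y1 y2 x - kink01 (x + y1)\<bar> \<le> 1/4200"
      using kink01_pos[of "- (x + y2)"] by (simp add: kink_pair_def kink10_eq)
    moreover have "\<bar>phi6_curvature (kink_pair y1 y2 x) - phi6_curvature (kink01 (x + y1))\<bar>
        \<le> 168 * \<bar>kink_pair y1 y2 x - kink01 (x + y1)\<bar>"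
      using kink01_pos[of "x + y1"] kink01_less_1[of "x + y1"]
      by (intro phi6_curvature_diff kink_pair_abs_le_1) auto
    ultimately have "\<bar>phi6_curvature (kink_pair y1 y2 x) - phi6_curvature (kink01 (x + y1))\<bar> \<le> 1/25"
      by simp
    from abs_le_D2[OF this] show "phi6_curvature (kink01 (x + y1)) - 1/25 \<le> V x"
      unfolding V_def by simp
  qed
  \<comment> \<open>The left half is treated after the reflection \<open>x \<mapsto> - x\<close>: it
    turns \<open>kink10\<close> into \<open>- kink01\<close>, and the curvature is even.\<close>
  have "1/25 * integral {- m..- L} (\<lambda>x. (g (- x))\<^sup>2)
    \<le> integral {- m..- L} (\<lambda>x. (- g' (- x))\<^sup>2 + V (- x) * (g (- x))\<^sup>2)
      + 3 * (g (- (- m)))\<^sup>2 + 6 * (g (- (kink_zero + y2)))\<^sup>2 + 3 * (g (- (- L)))\<^sup>2"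
  proof (rule kink01_half_line_coercive[where y="- y2" and g="\<lambda>x. g (- x)"])
    show "- m \<le> kink_zero + y2" "kink_zero + y2 \<le> - L" using ord L by auto
    show "(kink01 (kink_zero + y2 + - y2))\<^sup>2 = 1/3" using kink01_kink_zero by simp
    show "((\<lambda>x. g (- x)) has_real_derivative - g' (- x)) (at x)" for x
      using DERIV_chain2[where f=g and g=uminus, OF g_deriv DERIV_minus[OF DERIV_ident]] by simp
    show "continuous_on UNIV (\<lambda>x. - g' (- x))" "continuous_on UNIV (\<lambda>x. V (- x))"
      by (intro continuous_intros continuous_on_compose2[OF g'_continuous]
          continuous_on_compose2[OF V_continuous]; simp)+
    fix x assume x: "- m \<le> x"
    have "kink01 (- (x - y1)) \<le> 1/4200" using x m p by (intro kink_tail) auto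
    then have "\<bar>kink_pair y1 y2 (- x) - kink10 (- x + y2)\<bar> \<le> 1/4200"
      using kink01_pos[of "- (x - y1)"] by (simp add: kink_pair_def)
    moreover have "\<bar>phi6_curvature (kink_pair y1 y2 (- x)) - phi6_curvature (kink10 (- x + y2))\<bar>
        \<le> 168 * \<bar>kink_pair y1 y2 (- x) - kink10 (- x + y2)\<bar>"
      using kink10_bounds[of "- x + y2"]
      by (intro phi6_curvature_diff kink_pair_abs_le_1) auto
    ultimately have "\<bar>phi6_curvature (kink_pair y1 y2 (- x)) - phi6_curvature (kink10 (- x + y2))\<bar> \<le> 1/25"
      by simp
    moreover have "phi6_curvature (kink10 (- x + y2)) = phi6_curvature (kink01 (x + - y2))"
      by (simp add: kink10_eq phi6_curvature_def)
    ultimately show "phi6_curvature (kink01 (x + - y2)) - 1/25 \<le> V (- x)"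
      unfolding V_def using abs_le_D2 by fastforce
  qed
  moreover have "integral {- m..- L} (\<lambda>x. (g (- x))\<^sup>2) = integral {L..m} (\<lambda>x. (g x)\<^sup>2)"
    using Henstock_Kurzweil_Integration.integral_reflect_real[of m L "\<lambda>x. (g x)\<^sup>2"] by simp
  moreover have "integral {- m..- L} (\<lambda>x. (- g' (- x))\<^sup>2 + V (- x) * (g (- x))\<^sup>2)
      = integral {L..m} (\<lambda>x. (g' x)\<^sup>2 + V x * (g x)\<^sup>2)"
    using Henstock_Kurzweil_Integration.integral_reflect_real[of m L "\<lambda>x. (g' x)\<^sup>2 + V x * (g x)\<^sup>2"] by simp
  moreover have "integral {L..m} (\<lambda>x. (g x)\<^sup>2) + integral {m..R} (\<lambda>x. (g x)\<^sup>2) = integral {L..R} (\<lambda>x. (g x)\<^sup>2)"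
    by (rule Henstock_Kurzweil_Integration.integral_combine)
       (use ord L R in \<open>auto intro!: locally_integrable_on locally_integrable_continuous continuous_intros g_continuous\<close>)
  moreover have "integral {L..m} (\<lambda>x. (g' x)\<^sup>2 + V x * (g x)\<^sup>2) + integral {m..R} (\<lambda>x. (g' x)\<^sup>2 + V x * (g x)\<^sup>2)
      = integral {L..R} (\<lambda>x. (g' x)\<^sup>2 + V x * (g x)\<^sup>2)"
    by (rule Henstock_Kurzweil_Integration.integral_combine)
       (use ord L R in \<open>auto intro!: locally_integrable_on locally_integrable_continuous continuous_intros
          g_continuous g'_continuous V_continuous\<close>)
  moreover have "- (kink_zero + y2) = - kink_zero - y2" by simp
  ultimately show ?thesis using right gm g_zero by simp
qed

text \<open>Integrate \<open>(g' g)' = g'\<^sup>2 + g'' g\<close> with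
  \<open>g'' = phi6_force u + f - kink_pair_deriv2\<close>. Removing \<open>V g\<close> from
  \<open>g''\<close> leaves the Taylor remainder, \<open>f\<close> and the interaction, each tested
  with \<open>g\<close>.\<close>

lemma weak_form_bound:
  assumes "L \<le> R"
  shows "integral {L..R} (\<lambda>x. (g' x)\<^sup>2 + V x * (g x)\<^sup>2)
    \<le> g' R * g R - g' L * g L + 1/400 * N + 404 * d\<^sup>2 + 2094336 * q\<^sup>2"
proof -
  let ?w = "\<lambda>x. (phi6_force (u x) + f x - kink_pair_deriv2 y1 y2 x) * g x + g' x * g' x"
  let ?B = "\<lambda>x. bell (x + y1) + bell (x + y2)"
  have P: "primitive ?w (\<lambda>x. g' x * g x)"
    by (rule primitive_mult[OF g'_prim primitive_deriv[OF g_deriv g'_continuous]])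
  have pB: "primitive (\<lambda>x. bell (x + y)) (\<lambda>x. arctan (exp (sqrt 2 * (x + y))) / sqrt 2)" for y
    by (rule bell_primitive)
  have iB: "(\<lambda>x. bell (x + y)) integrable_on {L..R}" for y
    by (rule locally_integrable_on[OF primitiveD(1)[OF pB]])
  have i1: "?w integrable_on {L..R}" by (rule locally_integrable_on[OF primitiveD(1)[OF P]])
  have i2: "(\<lambda>x. 1/400 * (g x)\<^sup>2) integrable_on {L..R}"
    by (intro locally_integrable_on locally_integrable_continuous continuous_intros g_continuous)
  have i3: "(\<lambda>x. 404 * (f x)\<^sup>2) integrable_on {L..R}" by (intro integrable_on_mult_right f2_int)
  have i4: "(\<lambda>x. 523584 * q\<^sup>2 * ?B x) integrable_on {L..R}"
    by (intro integrable_on_mult_right integrable_add iB)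
  have "integral {L..R} (\<lambda>x. (g' x)\<^sup>2 + V x * (g x)\<^sup>2)
    \<le> integral {L..R} (\<lambda>x. ?w x + 1/400 * (g x)\<^sup>2 + 404 * (f x)\<^sup>2 + 523584 * q\<^sup>2 * ?B x)"
  proof (rule integral_le)
    show "(\<lambda>x. (g' x)\<^sup>2 + V x * (g x)\<^sup>2) integrable_on {L..R}"
      by (intro locally_integrable_on locally_integrable_continuous continuous_intros g_continuous g'_continuous V_continuous)
    show "(\<lambda>x. ?w x + 1/400 * (g x)\<^sup>2 + 404 * (f x)\<^sup>2 + 523584 * q\<^sup>2 * ?B x) integrable_on {L..R}"
      by (intro integrable_add i1 i2 i3 i4)
    fix x
    define J where "J = phi6_force (kink_pair y1 y2 x) - kink_pair_deriv2 y1 y2 x"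
    define K where "K = phi6_force (u x) - phi6_force (kink_pair y1 y2 x) - V x * g x"
    have eq: "(g' x)\<^sup>2 + V x * (g x)\<^sup>2 = ?w x - g x * f x - g x * K - g x * J"
      by (simp add: J_def K_def power2_eq_square algebra_simps)
    have sm: "\<bar>g x\<bar> \<le> 1/160000" using small[of x] by (simp add: g_def)
    have "\<bar>K\<bar> \<le> 188 * (g x)\<^sup>2"
    proof -
      have "u x = kink_pair y1 y2 x + g x" by (simp add: g_def)
      then show ?thesis unfolding K_def V_def
        using phi6_force_taylor[OF kink_pair_abs_le_1[of y1 y2 x], of "g x"] sm by simp
    qed
    then have "\<bar>g x\<bar> * \<bar>K\<bar> \<le> 1/160000 * (188 * (g x)\<^sup>2)" using sm by (intro mult_mono) auto
    then have K: "\<bar>g x * K\<bar> \<le> 188/160000 * (g x)\<^sup>2" by (simp add: abs_mult)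
    \<comment> \<open>The weight 1616 is such that two shares of 1/1616 and the remainder 188/160000
      stay below 1/400.\<close>
    have F: "\<bar>g x * f x\<bar> \<le> (g x)\<^sup>2 / 1616 + 404 * (f x)\<^sup>2" using young_ineq[of 1616 "g x" "f x"] by simp
    have B: "0 \<le> ?B x" "?B x \<le> 1" using bell_bounds[of "x + y1"] bell_bounds[of "x + y2"] by auto
    have "\<bar>J\<bar> \<le> 36 * (q * ?B x)" unfolding J_def q_def by (rule kink_pair_interaction)
    then have "\<bar>J\<bar>\<^sup>2 \<le> (36 * (q * ?B x))\<^sup>2" by (intro power_mono) auto
    then have "J\<^sup>2 \<le> 1296 * (q\<^sup>2 * (?B x)\<^sup>2)" by (simp add: power_mult_distrib)
    \<comment> \<open>Since \<open>?B x \<le> 1\<close>, its square is at most itself, and the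
      integral bound for bells applies directly.\<close>
    also have "\<dots> \<le> 1296 * (q\<^sup>2 * ?B x)"
      using B by (intro mult_left_mono) (auto simp: power2_eq_square mult_left_le)
    finally have "404 * J\<^sup>2 \<le> 523584 * q\<^sup>2 * ?B x" by simp
    then have J: "\<bar>g x * J\<bar> \<le> (g x)\<^sup>2 / 1616 + 523584 * q\<^sup>2 * ?B x" using young_ineq[of 1616 "g x" "J"] by simp
    show "(g' x)\<^sup>2 + V x * (g x)\<^sup>2 \<le> ?w x + 1/400 * (g x)\<^sup>2 + 404 * (f x)\<^sup>2 + 523584 * q\<^sup>2 * ?B x"
      unfolding eq using abs_le_D2[OF K] abs_le_D2[OF F] abs_le_D2[OF J] zero_le_power2[of "g x"] by linarith
  qed
  also have "\<dots> = (g' R * g R - g' L * g L) + 1/400 * integral {L..R} (\<lambda>x. (g x)\<^sup>2)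
      + 404 * integral {L..R} (\<lambda>x. (f x)\<^sup>2)
      + 523584 * q\<^sup>2 * (integral {L..R} (\<lambda>x. bell (x + y1)) + integral {L..R} (\<lambda>x. bell (x + y2)))"
    using integral_add[OF integrable_add[OF integrable_add[OF i1 i2] i3] i4]
      integral_add[OF integrable_add[OF i1 i2] i3] integral_add[OF i1 i2] integral_add[OF iB[of y1] iB[of y2]]
      primitiveD(2)[OF P assms] by simp
  also have "\<dots> \<le> (g' R * g R - g' L * g L) + 1/400 * N + 404 * d\<^sup>2 + 523584 * q\<^sup>2 * (2 + 2)"
    using g2_le[OF assms] f2_le[OF assms] bell_integral[OF assms]
    by (intro add_mono mult_left_mono order_refl) auto
  finally show ?thesis by simp
qed

text \<open>The form \<open>Q\<close> dominates \<open>G / 25\<close> up to errors, and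
  \<open>I \<le> Q + 4 G\<close> because the curvature is at least -3; so
  \<open>I \<le> 101 Q\<close> plus 100 times the errors. The resulting share of \<open>N\<close> is
  \<open>101 / 400 + 600 / 5000 < 1/2\<close>.\<close>

lemma H1_bound_finite:
  assumes L: "L \<le> - kink_zero - y2" and R: "kink_zero - y1 \<le> R"
  shows "I L R \<le> N / 2 + 300000000 * (d\<^sup>2 + q\<^sup>2)
    + 401 * (((g L)\<^sup>2 + (g' L)\<^sup>2) + ((g R)\<^sup>2 + (g' R)\<^sup>2))"
proof -
  have "- kink_zero - y2 \<le> kink_zero - y1" using sep kink_zero_abs by (auto simp: abs_le_iff)
  then have LR: "L \<le> R" using L R by linarith
  define Q where "Q = integral {L..R} (\<lambda>x. (g' x)\<^sup>2 + V x * (g x)\<^sup>2)"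
  define G where "G = integral {L..R} (\<lambda>x. (g x)\<^sup>2)"
  have iG: "(\<lambda>x. (g x)\<^sup>2) integrable_on {L..R}" "(\<lambda>x. (g' x)\<^sup>2 + V x * (g x)\<^sup>2) integrable_on {L..R}"
      "(\<lambda>x. (g x)\<^sup>2 + (g' x)\<^sup>2) integrable_on {L..R}"
    by (intro locally_integrable_on locally_integrable_continuous continuous_intros
        g_continuous g'_continuous V_continuous)+
  have "I L R \<le> integral {L..R} (\<lambda>x. ((g' x)\<^sup>2 + V x * (g x)\<^sup>2) + 4 * (g x)\<^sup>2)"
    unfolding I_def
  proof (rule integral_le[OF iG(3)])
    show "(\<lambda>x. ((g' x)\<^sup>2 + V x * (g x)\<^sup>2) + 4 * (g x)\<^sup>2) integrable_on {L..R}"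
      by (intro integrable_add iG integrable_on_mult_right)
    fix x
    have "-3 * (g x)\<^sup>2 \<le> V x * (g x)\<^sup>2"
      unfolding V_def by (intro mult_right_mono phi6_curvature_lower) auto
    then show "(g x)\<^sup>2 + (g' x)\<^sup>2 \<le> ((g' x)\<^sup>2 + V x * (g x)\<^sup>2) + 4 * (g x)\<^sup>2" by linarith
  qed
  also have "\<dots> = Q + 4 * G"
    unfolding Q_def G_def using integral_add[OF iG(2) integrable_on_mult_right[OF iG(1), of 4]] by simp
  finally have 1: "I L R \<le> Q + 4 * G" .
  have 2: "1/25 * G \<le> Q + 6/5000 * N + 24 * q\<^sup>2 + 3 * (g L)\<^sup>2 + 3 * (g R)\<^sup>2"
    unfolding Q_def G_def by (rule coercive[OF L R])
  have 3: "Q \<le> g' R * g R - g' L * g L + 1/400 * N + 404 * d\<^sup>2 + 2094336 * q\<^sup>2"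
    unfolding Q_def by (rule weak_form_bound[OF LR])
  have 4: "g' R * g R \<le> ((g R)\<^sup>2 + (g' R)\<^sup>2) / 2" "- (g' L * g L) \<le> ((g L)\<^sup>2 + (g' L)\<^sup>2) / 2"
    using zero_le_power2[of "g' R - g R"] zero_le_power2[of "g' L + g L"]
    by (auto simp: power2_eq_square algebra_simps)
  have nn: "0 \<le> (g R)\<^sup>2" "0 \<le> (g' R)\<^sup>2" "0 \<le> (g L)\<^sup>2" "0 \<le> (g' L)\<^sup>2" "0 \<le> q\<^sup>2" "0 \<le> d\<^sup>2" by simp_all
  have "I L R \<le> 101 * (((g R)\<^sup>2 + (g' R)\<^sup>2) / 2 + ((g L)\<^sup>2 + (g' L)\<^sup>2) / 2
      + 1/400 * N + 404 * d\<^sup>2 + 2094336 * q\<^sup>2)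
      + 100 * (6/5000 * N + 24 * q\<^sup>2 + 3 * (g L)\<^sup>2 + 3 * (g R)\<^sup>2)"
  proof -
    have comb: "J \<le> 101 * P + 100 * B" if "J \<le> Q + 4 * G" "1/25 * G \<le> Q + B" "Q \<le> P" for J P B :: real
      using that by linarith
    show ?thesis by (rule comb[OF 1]) (use 2 3 4 in linarith)+
  qed
  moreover have "J \<le> N / 2 + 300000000 * (D + E) + 401 * ((gL + hL) + (gR + hR))"
    if "J \<le> 101 * ((gR + hR) / 2 + (gL + hL) / 2 + 1/400 * N + 404 * D + 2094336 * E)
      + 100 * (6/5000 * N + 24 * E + 3 * gL + 3 * gR)"
      "0 \<le> gR" "0 \<le> hR" "0 \<le> gL" "0 \<le> hL" "0 \<le> E" "0 \<le> D" for J D E gL hL gR hR :: real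
    using that N_nonneg unfolding distrib_left add_divide_distrib by linarith
  ultimately show ?thesis using nn by blast
qed

lemma vanishing:
  obtains L R :: "nat \<Rightarrow> real" where "filterlim R at_top sequentially" "filterlim L at_bot sequentially"
    "(\<lambda>n. (g (R n))\<^sup>2 + (g' (R n))\<^sup>2) \<longlonglongrightarrow> 0" "(\<lambda>n. (g (L n))\<^sup>2 + (g' (L n))\<^sup>2) \<longlonglongrightarrow> 0"
proof -
  have c: "continuous_on UNIV (\<lambda>x. (g x)\<^sup>2 + (g' x)\<^sup>2)"
    by (intro continuous_intros g_continuous g'_continuous)
  show ?thesis
  proof (rule vanishing_sequences[OF c, of N])
    show "integral {a..b} (\<lambda>x. (g x)\<^sup>2 + (g' x)\<^sup>2) \<le> N" if "a \<le> b" for a b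
      using I_le[OF that] by (simp add: I_def)
  qed (simp, rule that)
qed

text \<open>Every interval lies in \<open>{L n..R n}\<close> for large \<open>n\<close>, and the
  boundary terms vanish along these endpoints.\<close>

lemma H1_bound:
  assumes ab: "a \<le> b"
  shows "I a b \<le> N / 2 + 300000000 * (d\<^sup>2 + q\<^sup>2)"
proof -
  obtain L R :: "nat \<Rightarrow> real" where LR: "filterlim R at_top sequentially" "filterlim L at_bot sequentially"
    "(\<lambda>n. (g (R n))\<^sup>2 + (g' (R n))\<^sup>2) \<longlonglongrightarrow> 0" "(\<lambda>n. (g (L n))\<^sup>2 + (g' (L n))\<^sup>2) \<longlonglongrightarrow> 0"
    using vanishing .
  let ?C = "N / 2 + 300000000 * (d\<^sup>2 + q\<^sup>2)"
  let ?r = "\<lambda>n. ?C + 401 * (((g (L n))\<^sup>2 + (g' (L n))\<^sup>2) + ((g (R n))\<^sup>2 + (g' (R n))\<^sup>2))"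
  have lim: "?r \<longlonglongrightarrow> ?C + 401 * (0 + 0)"
    by (intro tendsto_add tendsto_mult tendsto_const LR)
  have "\<forall>\<^sub>F n in sequentially. I a b \<le> ?r n"
  proof -
    have "\<forall>\<^sub>F n in sequentially. max b (kink_zero - y1) \<le> R n"
      using LR(1) unfolding filterlim_at_top by blast
    moreover have "\<forall>\<^sub>F n in sequentially. L n \<le> min a (- kink_zero - y2)"
      using LR(2) unfolding filterlim_at_bot by blast
    ultimately show ?thesis
    proof eventually_elim
      case (elim n)
      have "I a b \<le> I (L n) (R n)" unfolding I_def
        by (rule integral_mono_interval)
           (use elim in \<open>auto intro!: locally_integrable_continuous continuous_intros g_continuous g'_continuous\<close>)
      also have "\<dots> \<le> ?r n" using elim by (intro H1_bound_finite) auto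
      finally show ?case .
    qed
  qed
  then show ?thesis
    using tendsto_lowerbound[OF lim] by simp
qed

section \<open>The energy and the distance of the kinks\<close>

lemma energy_prim: "primitive (\<lambda>x. 2 * f x * v x) (\<lambda>x. (v x)\<^sup>2 - 2 * phi6_potential (u x))"
proof -
  have "((\<lambda>x. 2 * phi6_potential (u x)) has_real_derivative 2 * (phi6_force (u x) * v x)) (at x)" for x
    by (rule DERIV_cmult) (rule DERIV_chain2[OF phi6_potential_DERIV u_deriv])
  then have "primitive (\<lambda>x. 2 * (phi6_force (u x) * v x)) (\<lambda>x. 2 * phi6_potential (u x))"
    by (rule primitive_deriv) (unfold phi6_force_def, intro continuous_intros u_continuous v_continuous)
  from primitive_diff[OF primitive_mult[OF v_prim v_prim] this]
  show ?thesis by (rule primitive_cong) (auto simp: algebra_simps power2_eq_square)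
qed

text \<open>This controls the work \<open>2 f v\<close> in the energy balance: \<open>v\<close> is
  \<open>g'\<close> plus two kink slopes, each of square integral at most 1.\<close>

lemma v_square_integral:
  assumes ab: "a \<le> b"
  shows "integral {a..b} (\<lambda>x. (v x)\<^sup>2) \<le> 3 * (N + 2)"
proof -
  let ?s = "\<lambda>x. (sqrt 2 * kink01 (x + y1) * (1 - (kink01 (x + y1))\<^sup>2))\<^sup>2"
  let ?t = "\<lambda>x. (- sqrt 2 * kink10 (x + y2) * (1 - (kink10 (x + y2))\<^sup>2))\<^sup>2"
  have i: "(\<lambda>x. (g' x)\<^sup>2) integrable_on {a..b}" "?s integrable_on {a..b}" "?t integrable_on {a..b}"
    by (intro locally_integrable_on locally_integrable_continuous continuous_intros
        g'_continuous kink01_continuous kink10_continuous)+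
  have "integral {a..b} (\<lambda>x. (v x)\<^sup>2) \<le> integral {a..b} (\<lambda>x. 3 * ((g' x)\<^sup>2 + ?s x + ?t x))"
  proof (rule integral_le)
    show "(\<lambda>x. (v x)\<^sup>2) integrable_on {a..b}"
      by (intro locally_integrable_on locally_integrable_continuous continuous_intros v_continuous)
    show "(\<lambda>x. 3 * ((g' x)\<^sup>2 + ?s x + ?t x)) integrable_on {a..b}"
      by (intro integrable_on_mult_right integrable_add i)
    have sq3: "(p + r + w)\<^sup>2 \<le> 3 * (p\<^sup>2 + r\<^sup>2 + w\<^sup>2)" for p r w :: real
      using zero_le_power2[of "p - r"] zero_le_power2[of "p - w"] zero_le_power2[of "r - w"]
      by (simp add: power2_eq_square algebra_simps)
    fix x
    have "v x = g' x + sqrt 2 * kink01 (x + y1) * (1 - (kink01 (x + y1))\<^sup>2)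
        + - sqrt 2 * kink10 (x + y2) * (1 - (kink10 (x + y2))\<^sup>2)"
      by (simp add: g'_def kink_pair_deriv_def)
    then show "(v x)\<^sup>2 \<le> 3 * ((g' x)\<^sup>2 + ?s x + ?t x)" using sq3 by metis
  qed
  also have "\<dots> = 3 * (integral {a..b} (\<lambda>x. (g' x)\<^sup>2) + integral {a..b} ?s + integral {a..b} ?t)"
    using integral_add[OF integrable_add[OF i(1,2)] i(3)] integral_add[OF i(1,2)]
    by (simp only: integral_mult_right)
  also have "\<dots> \<le> 3 * (N + 2)"
  proof -
    have "0 \<le> integral {a..b} (\<lambda>x. (g x)\<^sup>2)"
      by (rule integral_nonneg) (auto intro!: locally_integrable_on locally_integrable_continuous
        continuous_intros g_continuous)
    then have "integral {a..b} (\<lambda>x. (g' x)\<^sup>2) \<le> N" using I_le[OF ab] I_split[of a b] by linarith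
    then show ?thesis
      using kink01_slope_square_integral[OF ab, of y1] kink10_slope_square_integral[OF ab, of y2]
      by (intro mult_left_mono) linarith+
  qed
  finally show ?thesis .
qed

text \<open>Integrate the energy balance from \<open>x\<close> to \<open>R n\<close>, where the
  energy tends to 0. Young's inequality with weights \<open>1 / d\<close> and \<open>d\<close> makes
  the contributions of \<open>f\<^sup>2\<close> and \<open>v\<^sup>2\<close> both of first order in
  \<open>d\<close>.\<close>

lemma energy_upper: "(v x)\<^sup>2 - 2 * phi6_potential (u x) \<le> d + 3 * d * (N + 2)"
proof -
  obtain L R :: "nat \<Rightarrow> real" where LR: "filterlim R at_top sequentially" "filterlim L at_bot sequentially"
    "(\<lambda>n. (g (R n))\<^sup>2 + (g' (R n))\<^sup>2) \<longlonglongrightarrow> 0" "(\<lambda>n. (g (L n))\<^sup>2 + (g' (L n))\<^sup>2) \<longlonglongrightarrow> 0"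
    using vanishing .
  have sq: "(\<lambda>n. sqrt ((g (R n))\<^sup>2 + (g' (R n))\<^sup>2)) \<longlonglongrightarrow> 0"
    using tendsto_real_sqrt[OF LR(3)] by simp
  have g0: "(\<lambda>n. g (R n)) \<longlonglongrightarrow> 0" "(\<lambda>n. g' (R n)) \<longlonglongrightarrow> 0"
    by (rule Lim_null_comparison[OF _ sq], rule always_eventually, auto simp: real_le_rsqrt abs_le_square_iff)+
  have "(\<lambda>n. kink_pair y1 y2 (R n) + g (R n)) \<longlonglongrightarrow> 1 + 0"
    by (intro tendsto_add g0 filterlim_compose[OF kink_pair_tendsto(1) LR(1)])
  then have uR: "(\<lambda>n. u (R n)) \<longlonglongrightarrow> 1" by (simp add: g_def)
  have "(\<lambda>n. kink_pair_deriv y1 y2 (R n) + g' (R n)) \<longlonglongrightarrow> 0 + 0"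
    by (intro tendsto_add g0 filterlim_compose[OF kink_pair_tendsto(2) LR(1)])
  then have vR: "(\<lambda>n. v (R n)) \<longlonglongrightarrow> 0" by (simp add: g'_def)
  have "(\<lambda>n. (v (R n))\<^sup>2 - 2 * ((u (R n))\<^sup>2 * (1 - (u (R n))\<^sup>2)\<^sup>2)) \<longlonglongrightarrow> 0\<^sup>2 - 2 * (1\<^sup>2 * (1 - 1\<^sup>2)\<^sup>2)"
    by (intro tendsto_intros uR vR)
  then have lim: "(\<lambda>n. ((v (R n))\<^sup>2 - 2 * phi6_potential (u (R n))) + (d + 3 * d * (N + 2))) \<longlonglongrightarrow> 0 + (d + 3 * d * (N + 2))"
    by (intro tendsto_add tendsto_const) (simp add: phi6_potential_def)
  have "\<forall>\<^sub>F n in sequentially. (v x)\<^sup>2 - 2 * phi6_potential (u x)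
      \<le> ((v (R n))\<^sup>2 - 2 * phi6_potential (u (R n))) + (d + 3 * d * (N + 2))"
  proof -
    have "\<forall>\<^sub>F n in sequentially. x \<le> R n" using LR(1) unfolding filterlim_at_top by blast
    then show ?thesis
    proof eventually_elim
      case (elim n)
      have iv: "(\<lambda>x. (v x)\<^sup>2) integrable_on {x..R n}"
        by (intro locally_integrable_on locally_integrable_continuous continuous_intros v_continuous)
      have "integral {x..R n} (\<lambda>t. - (2 * f t * v t)) \<le> integral {x..R n} (\<lambda>t. 1 / d * (f t)\<^sup>2 + d * (v t)\<^sup>2)"
      proof (rule integral_le)
        show "(\<lambda>t. - (2 * f t * v t)) integrable_on {x..R n}"
          by (rule integrable_neg[OF locally_integrable_on[OF primitiveD(1)[OF energy_prim]]])
        show "(\<lambda>t. 1 / d * (f t)\<^sup>2 + d * (v t)\<^sup>2) integrable_on {x..R n}"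
          by (intro integrable_add integrable_on_mult_right f2_int iv)
        fix t
        have "\<bar>f t * (2 * v t)\<bar> \<le> (f t)\<^sup>2 / d + d / 4 * (2 * v t)\<^sup>2" by (rule young_ineq[OF d_pos])
        from abs_le_D2[OF this] show "- (2 * f t * v t) \<le> 1 / d * (f t)\<^sup>2 + d * (v t)\<^sup>2"
          by (simp add: power_mult_distrib algebra_simps)
      qed
      also have "\<dots> = 1 / d * integral {x..R n} (\<lambda>t. (f t)\<^sup>2) + d * integral {x..R n} (\<lambda>t. (v t)\<^sup>2)"
        using integral_add[OF integrable_on_mult_right[OF f2_int, of "1/d"] integrable_on_mult_right[OF iv, of d]]
        by simp
      also have "\<dots> \<le> 1 / d * d\<^sup>2 + d * (3 * (N + 2))"
        by (intro add_mono mult_left_mono f2_le[OF elim] v_square_integral[OF elim]) (use d_pos in auto)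
      finally have "- integral {x..R n} (\<lambda>t. 2 * f t * v t) \<le> d + 3 * d * (N + 2)"
        using d_pos by (simp add: power2_eq_square algebra_simps)
      then show ?case using primitiveD(2)[OF energy_prim elim] by linarith
    qed
  qed
  then show ?thesis using tendsto_lowerbound[OF lim] by simp
qed

text \<open>Near the midpoint both kinks have size about \<open>p = sqrt q\<close>. There the energy
  of the pair is to leading order \<open>2 (a + b)\<^sup>2 - 2 (a - b)\<^sup>2 = 8 a b\<close>:
  slopes add while values cancel. The error changes this by a small multiple of \<open>q\<close>
  plus a multiple of \<open>g\<^sup>2 + g'\<^sup>2\<close>.\<close>

lemma separation_bound: "q \<le> 200000 * (d + N)"
proof -
  define M where "M = - (y1 + y2) / 2"
  define p where "p = exp (sqrt 2 * (- (y2 - y1) / 2))"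
  have pq: "p\<^sup>2 = q" by (simp add: p_def q_def exp_double[symmetric] field_simps)
  have p0: "0 < p" by (simp add: p_def)
  have "p\<^sup>2 \<le> (1/100)\<^sup>2" unfolding pq using q_bounds by (simp add: power2_eq_square)
  then have p1: "p \<le> 1/100" by (rule power2_le_imp_le) simp
  have "continuous_on UNIV (\<lambda>x. (g x)\<^sup>2 + (g' x)\<^sup>2)" by (intro continuous_intros g_continuous g'_continuous)
  \<comment> \<open>Averaging over a unit interval yields a point where \<open>N\<close> bounds
    \<open>g\<^sup>2 + g'\<^sup>2\<close>.\<close>
  from small_value_in_interval[OF this, of "M - 1/2" "M + 1/2"]
  obtain x where x: "M - 1/2 \<le> x" "x \<le> M + 1/2" "(g x)\<^sup>2 + (g' x)\<^sup>2 \<le> I (M - 1/2) (M + 1/2)"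
    by (auto simp: I_def)
  have gN: "(g x)\<^sup>2 + (g' x)\<^sup>2 \<le> N" using x(3) I_le[of "M - 1/2" "M + 1/2"] by simp
  define a where "a = kink01 (x + y1)"
  define b where "b = kink01 (- (x + y2))"
  have sh: "x + y1 = - (y2 - y1) / 2 + (x - M)" "- (x + y2) = - (y2 - y1) / 2 + - (x - M)"
    by (simp_all add: M_def field_simps)
  have xM: "\<bar>x - M\<bar> \<le> 1/2" "\<bar>- (x - M)\<bar> \<le> 1/2" by (rule abs_leI; use x in linarith)+
  have a: "p / 4 \<le> a" "a \<le> 3 * p" and b: "p / 4 \<le> b" "b \<le> 3 * p"
    unfolding a_def b_def sh p_def
    by (rule kink01_middle; use xM p1 in \<open>simp only: p_def\<close>)+
  define U where "U = kink_pair y1 y2 x"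
  define U' where "U' = kink_pair_deriv y1 y2 x"
  have U: "U = a - b" by (simp add: U_def kink_pair_def a_def b_def kink10_eq)
  have U': "U' = sqrt 2 * (a * (1 - a\<^sup>2) + b * (1 - b\<^sup>2))"
    by (simp add: U'_def kink_pair_deriv_def a_def b_def kink10_eq algebra_simps)
  have a0: "0 < a" "a < 1" "0 < b" "b < 1" unfolding a_def b_def by (simp_all only: kink01_pos kink01_less_1)
  have a2: "a\<^sup>2 \<le> 1" "b\<^sup>2 \<le> 1" using a0 by (simp_all add: power_le_one)
  have ab: "\<bar>a - b\<bar> \<le> 1" "\<bar>a - b\<bar> \<le> 3 * p" using a0 a b by (auto simp: abs_le_iff)
  \<comment> \<open>The leading part is at least \<open>8 * q / 16\<close>, and the cubic
    corrections cost at most \<open>4 * 324 / 15000 * q\<close>.\<close>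
  have EU: "2/5 * q \<le> U'\<^sup>2 - 2 * phi6_potential U"
  proof -
    have "(a - b)\<^sup>2 \<le> 1" using ab by (simp add: abs_square_le_1)
    then have "(1 - (a - b)\<^sup>2)\<^sup>2 \<le> 1" by (intro power_le_one) auto
    then have W: "phi6_potential U \<le> (a - b)\<^sup>2" unfolding phi6_potential_def U by (intro mult_left_le) auto
    have "a^3 \<le> (3 * p)^3" "b^3 \<le> (3 * p)^3"
      by (rule power_mono; use a b a0 in linarith)+
    then have c: "a^3 + b^3 \<le> 54 * p^3" by (simp add: power_mult_distrib)
    have "(a + b) * (a^3 + b^3) \<le> (6 * p) * (54 * p^3)"
      using a b a0 c by (intro mult_mono) auto
    also have "\<dots> = 324 * (q * q)" by (simp add: pq[symmetric] power2_eq_square eval_nat_numeral)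
    also have "q * q \<le> 1/15000 * q" using q_bounds by (intro mult_right_mono) auto
    finally have 1: "(a + b) * (a^3 + b^3) \<le> 324 * (1/15000 * q)" by simp
    have "p / 4 * (p / 4) \<le> a * b" using a b p0 by (intro mult_mono) auto
    then have 2: "q / 16 \<le> a * b" by (simp add: pq[symmetric] power2_eq_square)
    have "U'\<^sup>2 = 2 * ((a + b) - (a^3 + b^3))\<^sup>2"
      unfolding U' by (simp add: power_mult_distrib eval_nat_numeral algebra_simps)
    also have "((a + b) - (a^3 + b^3))\<^sup>2 = (a + b)\<^sup>2 - 2 * ((a + b) * (a^3 + b^3)) + (a^3 + b^3)\<^sup>2"
      by (simp add: power2_diff)
    finally have "2 * ((a + b)\<^sup>2 - 2 * ((a + b) * (a^3 + b^3))) \<le> U'\<^sup>2" by simp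
    moreover have "(a + b)\<^sup>2 = (a - b)\<^sup>2 + 4 * (a * b)" by (simp add: power2_eq_square algebra_simps)
    moreover have "2/5 * q \<le> A - 2 * P"
      if "2 * (S - 2 * X) \<le> A" "S = Y + 4 * m" "P \<le> Y" "X \<le> 324 * (1/15000 * q)" "q / 16 \<le> m" for A P S X Y m
      using that q_bounds(1) unfolding right_diff_distrib by linarith
    ultimately show ?thesis using W 1 2 by blast
  qed
  have U'bd: "\<bar>U'\<bar> \<le> 9 * p"
  proof -
    have "0 \<le> a * (1 - a\<^sup>2)" "0 \<le> b * (1 - b\<^sup>2)" using a0 a2 by simp_all
    moreover have "a * (1 - a\<^sup>2) \<le> a * 1" "b * (1 - b\<^sup>2) \<le> b * 1" using a0 by (intro mult_left_mono; simp)+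
    ultimately have s: "0 \<le> a * (1 - a\<^sup>2) + b * (1 - b\<^sup>2)" "a * (1 - a\<^sup>2) + b * (1 - b\<^sup>2) \<le> 6 * p"
      using a b by linarith+
    have "\<bar>U'\<bar> = sqrt 2 * (a * (1 - a\<^sup>2) + b * (1 - b\<^sup>2))"
      unfolding U' abs_mult using s(1) by simp
    also have "\<dots> \<le> 3/2 * (6 * p)" by (rule mult_mono[OF sqrt2_bounds(2) s(2) _ s(1)]) simp
    finally show ?thesis by simp
  qed
  have sm: "\<bar>g x\<bar> \<le> 1" using small[of x] by (simp add: g_def)
  have uv: "u x = U + g x" "v x = U' + g' x" by (simp_all add: g_def g'_def U_def U'_def)
  have W: "phi6_potential (u x) \<le> phi6_potential U + (16 * \<bar>U * g x\<bar> + 80 * (g x)\<^sup>2)"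
    using phi6_potential_diff[of U "g x"] ab(1) sm unfolding uv U[symmetric] by (auto simp: abs_le_iff)
  \<comment> \<open>Both cross terms carry a factor of order \<open>p\<close>, so Young's inequality
    splits each into \<open>p\<^sup>2 / 20 = q / 20\<close> and a squared error; together they
    reduce 2/5 to 3/10.\<close>
  have "\<bar>U * g x\<bar> \<le> \<bar>p * (3 * g x)\<bar>"
    unfolding abs_mult using ab(2) p0 U mult_right_mono[of "\<bar>U\<bar>" "3 * p" "\<bar>g x\<bar>"] by simp
  moreover have "\<bar>p * (96 * g x)\<bar> \<le> p\<^sup>2 / 20 + 20 / 4 * (96 * g x)\<^sup>2" by (rule young_ineq) simp
  ultimately have Ug: "32 * \<bar>U * g x\<bar> \<le> q / 20 + 46080 * (g x)\<^sup>2"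
    by (simp add: pq abs_mult power_mult_distrib)
  have "\<bar>U' * g' x\<bar> \<le> \<bar>p * (9 * g' x)\<bar>"
    unfolding abs_mult using U'bd p0 mult_right_mono[of "\<bar>U'\<bar>" "9 * p" "\<bar>g' x\<bar>"] by simp
  moreover have "\<bar>p * (18 * g' x)\<bar> \<le> p\<^sup>2 / 20 + 20 / 4 * (18 * g' x)\<^sup>2" by (rule young_ineq) simp
  ultimately have U'g: "2 * \<bar>U' * g' x\<bar> \<le> q / 20 + 1620 * (g' x)\<^sup>2"
    by (simp add: pq abs_mult power_mult_distrib)
  have vsq: "(v x)\<^sup>2 = U'\<^sup>2 + 2 * (U' * g' x) + (g' x)\<^sup>2" unfolding uv by (simp add: power2_sum)
  have "- (2 * (U' * g' x)) \<le> 2 * \<bar>U' * g' x\<bar>" by simp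
  then have "3/10 * q \<le> ((v x)\<^sup>2 - 2 * phi6_potential (u x)) + 50000 * ((g x)\<^sup>2 + (g' x)\<^sup>2)"
    using EU W Ug U'g vsq zero_le_power2[of "g x"] zero_le_power2[of "g' x"]
    unfolding distrib_left by linarith
  also have "\<dots> \<le> (d + 3 * d * (N + 2)) + 50000 * N"
    using energy_upper[of x] gN by simp
  also have "3 * d * (N + 2) \<le> 3 * N + 6 * d"
    using d_le_1 N_nonneg mult_right_mono[of d 1 N] by (simp add: algebra_simps)
  finally show ?thesis using d_pos N_nonneg by simp
qed

text \<open>The first hypothesis is available once \<open>N\<close> is the full squared norm, and
  \<open>N / 2\<close> is absorbed. Then \<open>q \<le> 200000 * (d + N)\<close> contains
  \<open>q\<^sup>2\<close> with the factor \<open>200000 * 600000000\<close>, and the assumed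
  smallness of \<open>q\<close> makes this term exactly at most \<open>q / 2\<close>.\<close>

lemma final_bound:
  assumes N: "N \<le> N / 2 + 300000000 * (d\<^sup>2 + q\<^sup>2)" and q: "q \<le> 1 / 240000000000000"
  shows "sqrt N + q \<le> 100000000000000000000 * d"
proof -
  have N1: "N \<le> 600000000 * (d\<^sup>2 + q\<^sup>2)" using N by simp
  have "d\<^sup>2 \<le> d" using d_pos d_le_1 by (simp add: power2_eq_square mult_left_le)
  moreover have "q\<^sup>2 \<le> 1 / 240000000000000 * q" 
    unfolding power2_eq_square using q q_bounds by (intro mult_right_mono) auto
  ultimately have "d\<^sup>2 + q\<^sup>2 \<le> d + 1 / 240000000000000 * q" by linarith
  then have "600000000 * (d\<^sup>2 + q\<^sup>2) \<le> 600000000 * (d + 1 / 240000000000000 * q)"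
    by (intro mult_left_mono) auto
  then have "N \<le> 600000000 * (d + 1 / 240000000000000 * q)" using N1 by (rule order_trans[rotated])
  then have "N \<le> 600000000 * d + 1 / 400000 * q" by simp
  then have qd: "q \<le> 300000000000000 * d"
    using separation_bound d_pos by simp
  have "N \<le> (30000 * (d + q))\<^sup>2"
  proof -
    have "d\<^sup>2 + q\<^sup>2 \<le> (d + q)\<^sup>2" using d_pos q_bounds by (simp add: power2_sum)
    then have "600000000 * (d\<^sup>2 + q\<^sup>2) \<le> 900000000 * (d + q)\<^sup>2"
      by (intro mult_mono) auto
    also have "\<dots> = (30000 * (d + q))\<^sup>2" by (simp only: power_mult_distrib) simp
    finally show ?thesis using N1 by linarith
  qed
  then have "sqrt N \<le> 30000 * (d + q)" using d_pos q_bounds by (intro real_le_lsqrt) auto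
  then have "sqrt N \<le> 30000 * d + 30000 * q" by (simp add: distrib_left)
  then show ?thesis using qd d_pos by linarith
qed

end

subsection \<open>Choice of the kink positions\<close>

text \<open>Strict monotonicity separates the values of \<open>kink01\<close> at
  \<open>kink_zero - \<eta>\<close> and \<open>kink_zero + \<eta>\<close> from the middle value by
  some \<open>\<mu>\<close>. At the left end the other kink is negative and helps; at the right end
  its tail and the error of \<open>u\<close> take at most \<open>\<mu> / 2\<close> each.\<close>

lemma kink_location:
  assumes \<eta>: "0 < \<eta>"
  obtains \<epsilon> a where "0 < \<epsilon>" "0 < a"
    "\<forall>u x1 x2. continuous_on UNIV u \<longrightarrow> x2 - x1 > a \<longrightarrow> (\<forall>x. \<bar>u x - kink_pair x1 x2 x\<bar> < \<epsilon>) \<longrightarrow>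
      (\<exists>y. \<bar>y - x1\<bar> \<le> \<eta> \<and> u (kink_zero - y) = kink01 kink_zero)"
proof -
  define \<mu> where "\<mu> = min (kink01 (kink_zero + \<eta>) - kink01 kink_zero) (kink01 kink_zero - kink01 (kink_zero - \<eta>))"
  have \<mu>: "0 < \<mu>" using kink01_strict_mono[of kink_zero "kink_zero + \<eta>"] kink01_strict_mono[of "kink_zero - \<eta>" kink_zero] \<eta>
    by (simp add: \<mu>_def)
  have \<mu>le: "\<mu> \<le> kink01 (kink_zero + \<eta>) - kink01 kink_zero" "\<mu> \<le> kink01 kink_zero - kink01 (kink_zero - \<eta>)"
    by (auto simp: \<mu>_def)
  show ?thesis
  \<comment> \<open>The separation \<open>2 / \<mu>\<close> makes the tail at most
    \<open>\<mu> / 2\<close>; the additional 1 covers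
    \<open>\<bar>kink_zero\<bar> \<le> 1\<close>.\<close>
  proof (rule that[of "\<mu> / 2" "2 / \<mu> + 1"]; (intro allI impI)?)
    show "0 < \<mu> / 2" "0 < 2 / \<mu> + 1" using \<mu> by (auto intro: add_pos_pos)
    fix u :: "real \<Rightarrow> real" and x1 x2 :: real
    assume c: "continuous_on UNIV u" and far: "x2 - x1 > 2 / \<mu> + 1"
      and "\<forall>x. \<bar>u x - kink_pair x1 x2 x\<bar> < \<mu> / 2"
    then have near: "\<And>x. \<bar>u x - kink_pair x1 x2 x\<bar> < \<mu> / 2" by blast
    define lo where "lo = kink_zero - \<eta> - x1"
    define hi where "hi = kink_zero + \<eta> - x1"
    have "u lo < kink_pair x1 x2 lo + \<mu> / 2" using near[of lo] by linarith
    also have "kink_pair x1 x2 lo < kink01 (kink_zero - \<eta>)"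
      using kink10_bounds[of "lo + x2"] by (simp add: kink_pair_def lo_def)
    finally have ulo: "u lo \<le> kink01 kink_zero" using \<mu>le \<mu> by linarith
    have t: "2 / \<mu> \<le> hi + x2" using far kink_zero_abs \<eta> by (auto simp: hi_def abs_le_iff)
    have t0: "0 < 2 / \<mu>" using \<mu> by simp
    have "- kink10 (hi + x2) \<le> exp (- sqrt 2 * (hi + x2))" 
      using kink01_le_exp[of "- (hi + x2)"] by (simp only: kink10_eq minus_minus mult_minus_left mult_minus_right)
    also have "\<dots> \<le> 1 / (1 + (hi + x2))" by (rule exp_minus_sqrt2_le) (use t t0 in linarith)
    also have "\<dots> \<le> 1 / (2 / \<mu>)" by (intro divide_left_mono mult_pos_pos; use t t0 in linarith)
    finally have "- kink10 (hi + x2) \<le> \<mu> / 2" by simp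
    moreover have "kink_pair x1 x2 hi - \<mu> / 2 < u hi" using near[of hi] by linarith
    moreover have "kink_pair x1 x2 hi = kink01 (kink_zero + \<eta>) + kink10 (hi + x2)" by (simp add: kink_pair_def hi_def)
    ultimately have uhi: "kink01 kink_zero \<le> u hi" using \<mu>le by linarith
    have "lo \<le> hi" using \<eta> by (simp add: lo_def hi_def)
    from IVT'[OF ulo uhi this continuous_on_subset[OF c subset_UNIV]]
    obtain x where x: "lo \<le> x" "x \<le> hi" "u x = kink01 kink_zero" by blast
    then show "\<exists>y. \<bar>y - x1\<bar> \<le> \<eta> \<and> u (kink_zero - y) = kink01 kink_zero"
      by (intro exI[of _ "kink_zero - x"]) (auto simp: lo_def hi_def abs_le_iff)
  qed
qed

lemma kink_pair_reflect: "kink_pair (- x2) (- x1) x = - kink_pair x1 x2 (- x)"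
  by (simp add: kink_pair_def kink10_eq)

lemma kink10_lipschitz: "\<bar>kink10 x - kink10 y\<bar> \<le> \<bar>x - y\<bar>"
  using kink01_lipschitz[of "- y" "- x"] by (simp add: kink10_eq abs_minus_commute)

lemma kink_pair_lipschitz: "\<bar>kink_pair x1 x2 x - kink_pair y1 y2 x\<bar> \<le> \<bar>y1 - x1\<bar> + \<bar>y2 - x2\<bar>"
  using kink01_lipschitz[of "x + x1" "x + y1"] kink10_lipschitz[of "x + x2" "x + y2"]
  by (simp add: kink_pair_def abs_minus_commute)

lemma sum_square_2: "(a + b)\<^sup>2 \<le> 2 * (a\<^sup>2 + b\<^sup>2)" for a b :: real
  using zero_le_power2[of "a - b"] by (simp add: power2_eq_square algebra_simps)

lemma kink_pair_diff_square_integral: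
  assumes "a \<le> b"
  shows "integral {a..b} (\<lambda>x. (kink_pair x1 x2 x - kink_pair y1 y2 x)\<^sup>2) \<le> 2 * (\<bar>x1 - y1\<bar> + \<bar>x2 - y2\<bar>)"
proof -
  let ?s = "\<lambda>x. (kink01 (x + x1) - kink01 (x + y1))\<^sup>2" and ?t = "\<lambda>x. (kink10 (x + x2) - kink10 (x + y2))\<^sup>2"
  have i: "?s integrable_on {a..b}" "?t integrable_on {a..b}"
    by (intro locally_integrable_on locally_integrable_continuous continuous_intros kink01_continuous kink10_continuous)+
  have "integral {a..b} (\<lambda>x. (kink_pair x1 x2 x - kink_pair y1 y2 x)\<^sup>2) \<le> integral {a..b} (\<lambda>x. 2 * (?s x + ?t x))"
  proof (rule integral_le)
    show "(\<lambda>x. (kink_pair x1 x2 x - kink_pair y1 y2 x)\<^sup>2) integrable_on {a..b}"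
      by (intro locally_integrable_on locally_integrable_continuous continuous_intros kink_pair_continuous)
    show "(\<lambda>x. 2 * (?s x + ?t x)) integrable_on {a..b}" by (intro integrable_on_mult_right integrable_add i)
    fix x
    have "kink_pair x1 x2 x - kink_pair y1 y2 x = (kink01 (x + x1) - kink01 (x + y1)) + (kink10 (x + x2) - kink10 (x + y2))"
      by (simp add: kink_pair_def)
    then show "(kink_pair x1 x2 x - kink_pair y1 y2 x)\<^sup>2 \<le> 2 * (?s x + ?t x)" using sum_square_2 by metis
  qed
  also have "\<dots> = 2 * (integral {a..b} ?s + integral {a..b} ?t)"
    using integral_add[OF i] by (simp only: integral_mult_right)
  also have "\<dots> \<le> 2 * (\<bar>x1 - y1\<bar> + \<bar>x2 - y2\<bar>)"
    using kink01_diff_square_integral[OF assms, of x1 y1] kink10_diff_square_integral[OF assms, of x2 y2]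
    by (intro mult_left_mono add_mono) auto
  finally show ?thesis .
qed

lemma kink_pair_deriv_square_integral:
  assumes "a \<le> b"
  shows "integral {a..b} (\<lambda>x. (kink_pair_deriv y1 y2 x)\<^sup>2) \<le> 4"
proof -
  let ?s = "\<lambda>x. (sqrt 2 * kink01 (x + y1) * (1 - (kink01 (x + y1))\<^sup>2))\<^sup>2"
  let ?t = "\<lambda>x. (- sqrt 2 * kink10 (x + y2) * (1 - (kink10 (x + y2))\<^sup>2))\<^sup>2"
  have i: "?s integrable_on {a..b}" "?t integrable_on {a..b}"
    by (intro locally_integrable_on locally_integrable_continuous continuous_intros kink01_continuous kink10_continuous)+
  have "integral {a..b} (\<lambda>x. (kink_pair_deriv y1 y2 x)\<^sup>2) \<le> integral {a..b} (\<lambda>x. 2 * (?s x + ?t x))"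
  proof (rule integral_le)
    show "(\<lambda>x. (kink_pair_deriv y1 y2 x)\<^sup>2) integrable_on {a..b}"
      by (intro locally_integrable_on locally_integrable_continuous continuous_intros kink_pair_continuous)
    show "(\<lambda>x. 2 * (?s x + ?t x)) integrable_on {a..b}" by (intro integrable_on_mult_right integrable_add i)
    show "(kink_pair_deriv y1 y2 x)\<^sup>2 \<le> 2 * (?s x + ?t x)" for x
      unfolding kink_pair_deriv_def by (rule sum_square_2)
  qed
  also have "\<dots> = 2 * (integral {a..b} ?s + integral {a..b} ?t)"
    using integral_add[OF i] by (simp only: integral_mult_right)
  also have "\<dots> \<le> 2 * (1 + 1)"
    using kink01_slope_square_integral[OF assms, of y1] kink10_slope_square_integral[OF assms, of y2]
    by (intro mult_left_mono add_mono) auto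
  finally show ?thesis by simp
qed

text \<open>Start far to the left, where \<open>h\<close> is nearly 0. The increase of
  \<open>h\<^sup>2\<close> up to \<open>x\<close> is the integral of \<open>2 h h'\<close>, at most
  that of \<open>h\<^sup>2 + h'\<^sup>2\<close>.\<close>

lemma H1_controls_sup:
  fixes h h' :: "real \<Rightarrow> real"
  assumes dh: "\<And>x. (h has_real_derivative h' x) (at x)" and ch': "continuous_on UNIV h'"
    and i: "integrable lebesgue (\<lambda>x. (h x)\<^sup>2)" "integrable lebesgue (\<lambda>x. (h' x)\<^sup>2)"
  shows "(h x)\<^sup>2 \<le> (LINT x|lebesgue. (h x)\<^sup>2) + (LINT x|lebesgue. (h' x)\<^sup>2)"
proof -
  define B where "B = (LINT x|lebesgue. (h x)\<^sup>2) + (LINT x|lebesgue. (h' x)\<^sup>2)"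
  have ch: "continuous_on UNIV h" by (rule DERIV_continuous_on) (rule dh)
  let ?k = "\<lambda>x. (h x)\<^sup>2 + (h' x)\<^sup>2"
  have ck: "continuous_on UNIV ?k" by (intro continuous_intros ch ch')
  have kB: "integral {a..b} ?k \<le> B" for a b
  proof -
    have "integral {a..b} ?k = integral {a..b} (\<lambda>x. (h x)\<^sup>2) + integral {a..b} (\<lambda>x. (h' x)\<^sup>2)"
      by (rule integral_add; rule integral_le_LINT(1)) (use i in auto)
    also have "\<dots> \<le> B" unfolding B_def by (intro add_mono integral_le_LINT(2) i) auto
    finally show ?thesis .
  qed
  obtain L R :: "nat \<Rightarrow> real" where LR: "filterlim R at_top sequentially" "filterlim L at_bot sequentially"
    "(\<lambda>n. ?k (R n)) \<longlonglongrightarrow> 0" "(\<lambda>n. ?k (L n)) \<longlonglongrightarrow> 0"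
    by (rule vanishing_sequences[OF ck _ kB]) auto
  have "\<forall>\<^sub>F n in sequentially. (h x)\<^sup>2 \<le> ?k (L n) + B"
  proof -
    have "\<forall>\<^sub>F n in sequentially. L n \<le> x" using LR(2) unfolding filterlim_at_bot by blast
    then show ?thesis
    proof eventually_elim
      case (elim n)
      have p: "primitive h' h" by (rule primitive_deriv[OF dh ch'])
      have "h x * h x - h (L n) * h (L n) = integral {L n..x} (\<lambda>x. h' x * h x + h x * h' x)"
        using primitiveD(2)[OF primitive_mult[OF p p] elim] by simp
      also have "\<dots> \<le> integral {L n..x} ?k"
      proof (rule integral_le)
        show "(\<lambda>x. h' x * h x + h x * h' x) integrable_on {L n..x}" "?k integrable_on {L n..x}"
          by (intro locally_integrable_on locally_integrable_continuous continuous_intros ch ch')+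
        show "h' t * h t + h t * h' t \<le> ?k t" for t
          using zero_le_power2[of "h t - h' t"] by (simp add: power2_eq_square algebra_simps)
      qed
      also have "\<dots> \<le> B" by (rule kB)
      finally have "(h x)\<^sup>2 - (h (L n))\<^sup>2 \<le> B" by (simp add: power2_eq_square)
      then show ?case using zero_le_power2[of "h' (L n)"] by linarith
    qed
  qed
  moreover have "(\<lambda>n. ?k (L n) + B) \<longlonglongrightarrow> 0 + B" by (intro tendsto_add LR(4) tendsto_const)
  ultimately show ?thesis using tendsto_lowerbound[of "\<lambda>n. ?k (L n) + B" "0 + B"] by (simp add: B_def)
qed

lemma square_integrable_shift:
  fixes h p :: "real \<Rightarrow> real"
  assumes c: "continuous_on UNIV h" "continuous_on UNIV p"
    and h: "integrable lebesgue (\<lambda>x. (h x)\<^sup>2)"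
    and p: "\<And>a b. a \<le> b \<Longrightarrow> integral {a..b} (\<lambda>x. (p x)\<^sup>2) \<le> B"
  shows "integrable lebesgue (\<lambda>x. (h x + p x)\<^sup>2)"
proof (rule integrable_bounded_integrals(1))
  show "continuous_on UNIV (\<lambda>x. (h x + p x)\<^sup>2)" by (intro continuous_intros c)
  fix a b :: real assume ab: "a \<le> b"
  have i: "(\<lambda>x. (h x)\<^sup>2) integrable_on {a..b}" "(\<lambda>x. (p x)\<^sup>2) integrable_on {a..b}"
    by (intro locally_integrable_on locally_integrable_continuous continuous_intros c)+
  have "integral {a..b} (\<lambda>x. (h x + p x)\<^sup>2) \<le> integral {a..b} (\<lambda>x. 2 * ((h x)\<^sup>2 + (p x)\<^sup>2))"
  proof (rule integral_le)
    show "(\<lambda>x. (h x + p x)\<^sup>2) integrable_on {a..b}"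
      by (intro locally_integrable_on locally_integrable_continuous continuous_intros c)
    show "(\<lambda>x. 2 * ((h x)\<^sup>2 + (p x)\<^sup>2)) integrable_on {a..b}" by (intro integrable_on_mult_right integrable_add i)
  qed (rule sum_square_2)
  also have "\<dots> = 2 * (integral {a..b} (\<lambda>x. (h x)\<^sup>2) + integral {a..b} (\<lambda>x. (p x)\<^sup>2))"
    using integral_add[OF i] by (simp only: integral_mult_right)
  also have "\<dots> \<le> 2 * ((LINT x|lebesgue. (h x)\<^sup>2) + B)"
    by (intro mult_left_mono add_mono p[OF ab] integral_le_LINT(2) h) auto
  finally show "integral {a..b} (\<lambda>x. (h x + p x)\<^sup>2) \<le> 2 * ((LINT x|lebesgue. (h x)\<^sup>2) + B)" .
qed simp

text \<open>The order of quantifiers matters: \<open>y1\<close> and \<open>y2\<close> are fixed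
  before \<open>f\<close> and \<open>d\<close>, so \<open>d\<close> can later decrease to the norm
  of \<open>f\<close>, which may be 0.\<close>

definition stability_constants :: "real \<Rightarrow> real \<Rightarrow> real \<Rightarrow> bool" where
  "stability_constants a \<epsilon> C \<longleftrightarrow>
    (\<forall>u v x1 x2. (\<forall>x. (u has_real_derivative v x) (at x)) \<longrightarrow> continuous_on UNIV v \<longrightarrow> x2 - x1 > a \<longrightarrow>
      (\<forall>x. \<bar>u x - kink_pair x1 x2 x\<bar> < \<epsilon>) \<longrightarrow>
      integrable lebesgue (\<lambda>x. (u x - kink_pair x1 x2 x)\<^sup>2) \<longrightarrow>
      integrable lebesgue (\<lambda>x. (v x - kink_pair_deriv x1 x2 x)\<^sup>2) \<longrightarrow>
      (\<exists>y1 y2. integrable lebesgue (\<lambda>x. (u x - kink_pair y1 y2 x)\<^sup>2) \<and>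
        integrable lebesgue (\<lambda>x. (v x - kink_pair_deriv y1 y2 x)\<^sup>2) \<and>
        (\<forall>f d. primitive (\<lambda>x. phi6_force (u x) + f x) v \<longrightarrow> integrable lebesgue (\<lambda>x. (f x)\<^sup>2) \<longrightarrow>
           (LINT x|lebesgue. (f x)\<^sup>2) \<le> d\<^sup>2 \<longrightarrow> 0 < d \<longrightarrow> d \<le> 1 \<longrightarrow>
           sqrt ((LINT x|lebesgue. (u x - kink_pair y1 y2 x)\<^sup>2) + (LINT x|lebesgue. (v x - kink_pair_deriv y1 y2 x)\<^sup>2))
             + exp (- sqrt 2 * (y2 - y1)) \<le> C * d)))"

lemma regular_stability:
  obtains a \<epsilon> :: real where "0 < a" "0 < \<epsilon>" "\<epsilon> \<le> 1" "stability_constants a \<epsilon> 100000000000000000000"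
proof -
  have \<eta>: "(0::real) < 1/1000000" by simp
  obtain \<epsilon>0 a0 where loc: "0 < \<epsilon>0" "0 < a0"
    "\<forall>u x1 x2. continuous_on UNIV u \<longrightarrow> x2 - x1 > a0 \<longrightarrow> (\<forall>x. \<bar>u x - kink_pair x1 x2 x\<bar> < \<epsilon>0) \<longrightarrow>
      (\<exists>y. \<bar>y - x1\<bar> \<le> 1/1000000 \<and> u (kink_zero - y) = kink01 kink_zero)"
    using kink_location[OF \<eta>] .
  \<comment> \<open>The initial error and the two shifts, each at most 1/1000000, add up to less
    than 1/160000. The size of \<open>a\<close> ensures \<open>q \<le> 1 / 240000000000000\<close>,
    as the final absorption requires.\<close>
  define \<epsilon> where "\<epsilon> = min \<epsilon>0 (1/1000000)"
  define a where "a = max a0 1000000000000000"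
  show ?thesis
  proof (rule that[of a \<epsilon>]; (unfold stability_constants_def, intro allI impI)?)
    show "0 < a" "0 < \<epsilon>" "\<epsilon> \<le> 1" using loc by (auto simp: a_def \<epsilon>_def)
    fix u v :: "real \<Rightarrow> real" and x1 x2 :: real
    assume "\<forall>x. (u has_real_derivative v x) (at x)" and cv: "continuous_on UNIV v" and far: "x2 - x1 > a"
      and "\<forall>x. \<bar>u x - kink_pair x1 x2 x\<bar> < \<epsilon>"
      and i: "integrable lebesgue (\<lambda>x. (u x - kink_pair x1 x2 x)\<^sup>2)"
        "integrable lebesgue (\<lambda>x. (v x - kink_pair_deriv x1 x2 x)\<^sup>2)"
    then have du: "\<And>x. (u has_real_derivative v x) (at x)" and near: "\<And>x. \<bar>u x - kink_pair x1 x2 x\<bar> < \<epsilon>"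
      by blast+
    have cu: "continuous_on UNIV u" by (rule DERIV_continuous_on) (rule du)
    have near0: "\<bar>u x - kink_pair x1 x2 x\<bar> < \<epsilon>0" "\<bar>u x - kink_pair x1 x2 x\<bar> < 1/1000000" for x
      using near[of x] by (auto simp: \<epsilon>_def)
    have far0: "x2 - x1 > a0" "x2 - x1 > 1000000000000000" using far by (auto simp: a_def)
    obtain y1 where y1: "\<bar>y1 - x1\<bar> \<le> 1/1000000" "u (kink_zero - y1) = kink01 kink_zero"
      using loc(3) cu far0(1) near0(1) by blast
    \<comment> \<open>The function \<open>x \<mapsto> - u (- x)\<close> exchanges the roles of the
      kinks, so the same lemma locates the second one.\<close>
    have "\<exists>y. \<bar>y - - x2\<bar> \<le> 1/1000000 \<and> - u (- (kink_zero - y)) = kink01 kink_zero"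
    proof (rule loc(3)[rule_format, of "\<lambda>x. - u (- x)" "- x1" "- x2"])
      show "continuous_on UNIV (\<lambda>x. - u (- x))"
        by (intro continuous_intros continuous_on_compose2[OF cu]; simp)
      show "- x1 - - x2 > a0" using far0 by simp
      show "\<bar>- u (- x) - kink_pair (- x2) (- x1) x\<bar> < \<epsilon>0" for x
        using near0(1)[of "- x"] by (simp add: kink_pair_reflect abs_minus_commute)
    qed
    then obtain y where y: "\<bar>y - - x2\<bar> \<le> 1/1000000" "- u (- (kink_zero - y)) = kink01 kink_zero" by blast
    define y2 where "y2 = - y"
    have "- kink_zero - y2 = - (kink_zero - y)" by (simp add: y2_def)
    then have y2: "u (- kink_zero - y2) = - kink01 kink_zero" using y(2) by (metis minus_minus)
    have y2x: "\<bar>y2 - x2\<bar> \<le> 1/1000000" unfolding y2_def by (rule abs_leI; use y(1) in linarith)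
    have z: "240000000000000 \<le> y2 - y1" using y1(1) y2x far0(2) by linarith
    define q where "q = exp (- sqrt 2 * (y2 - y1))"
    \<comment> \<open>A kink is not square integrable, so the positions are changed through the
      difference of two pairs.\<close>
    have iy1: "integrable lebesgue (\<lambda>x. (u x - kink_pair y1 y2 x)\<^sup>2)"
    proof -
      have "integrable lebesgue (\<lambda>x. ((u x - kink_pair x1 x2 x) + (kink_pair x1 x2 x - kink_pair y1 y2 x))\<^sup>2)"
        by (rule square_integrable_shift[OF _ _ i(1) kink_pair_diff_square_integral])
           (intro continuous_intros cu kink_pair_continuous)+
      then show ?thesis by simp
    qed
    \<comment> \<open>Derivatives of pairs are square integrable by themselves: the old one is added
      and the new one subtracted.\<close>
    have iy2: "integrable lebesgue (\<lambda>x. (v x - kink_pair_deriv y1 y2 x)\<^sup>2)"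
    proof -
      have "integrable lebesgue (\<lambda>x. ((v x - kink_pair_deriv x1 x2 x) + kink_pair_deriv x1 x2 x)\<^sup>2)"
        by (rule square_integrable_shift[OF _ _ i(2) kink_pair_deriv_square_integral])
           (intro continuous_intros cv kink_pair_continuous)+
      then have "integrable lebesgue (\<lambda>x. (v x + - kink_pair_deriv y1 y2 x)\<^sup>2)"
        by (intro square_integrable_shift[where B=4] continuous_intros cv kink_pair_continuous)
           (auto intro: kink_pair_deriv_square_integral)
      then show ?thesis by simp
    qed
    have small: "\<bar>u x - kink_pair y1 y2 x\<bar> \<le> 1/160000" for x
      using near0(2)[of x] kink_pair_lipschitz[of x1 x2 x y1 y2] y1(1) y2x by linarith
    \<comment> \<open>At a pinned point \<open>u\<close> has the exact value of the near kink, so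
      \<open>g\<close> is up to sign the tail of the other. The factor 2 comes from
      \<open>(exp (sqrt 2 * kink_zero))\<^sup>2 = 1/2\<close>.\<close>
    have eq2: "(exp (sqrt 2 * (- kink_zero - (y2 - y1))))\<^sup>2 = 2 * q\<^sup>2"
    proof -
      have "exp (sqrt 2 * (- kink_zero - (y2 - y1))) = q / exp (sqrt 2 * kink_zero)"
        by (simp add: q_def exp_diff[symmetric] algebra_simps)
      then show ?thesis by (simp add: power_divide exp_kink_zero)
    qed
    have tail: "(kink01 (- kink_zero - (y2 - y1)))\<^sup>2 \<le> 2 * q\<^sup>2"
      unfolding eq2[symmetric] by (intro power_mono kink01_le_exp less_imp_le[OF kink01_pos])
    have z1: "(u (kink_zero - y1) - kink_pair y1 y2 (kink_zero - y1))\<^sup>2 \<le> 2 * q\<^sup>2"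
    proof -
      have "u (kink_zero - y1) - kink_pair y1 y2 (kink_zero - y1) = kink01 (- kink_zero - (y2 - y1))"
        by (simp add: y1 kink_pair_def kink10_eq algebra_simps)
      then show ?thesis using tail by simp
    qed
    have z2: "(u (- kink_zero - y2) - kink_pair y1 y2 (- kink_zero - y2))\<^sup>2 \<le> 2 * q\<^sup>2"
    proof -
      have "u (- kink_zero - y2) - kink_pair y1 y2 (- kink_zero - y2) = - kink01 (- kink_zero - (y2 - y1))"
        by (simp add: y2 kink_pair_def kink10_eq algebra_simps)
      then show ?thesis using tail by simp
    qed
    define N where "N = (LINT x|lebesgue. (u x - kink_pair y1 y2 x)\<^sup>2) + (LINT x|lebesgue. (v x - kink_pair_deriv y1 y2 x)\<^sup>2)"
    have N_bound: "integral {a..b} (\<lambda>x. (u x - kink_pair y1 y2 x)\<^sup>2 + (v x - kink_pair_deriv y1 y2 x)\<^sup>2) \<le> N" for a b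
    proof -
      have "integral {a..b} (\<lambda>x. (u x - kink_pair y1 y2 x)\<^sup>2 + (v x - kink_pair_deriv y1 y2 x)\<^sup>2)
        = integral {a..b} (\<lambda>x. (u x - kink_pair y1 y2 x)\<^sup>2) + integral {a..b} (\<lambda>x. (v x - kink_pair_deriv y1 y2 x)\<^sup>2)"
        by (rule integral_add; rule integral_le_LINT(1)) (use iy1 iy2 in auto)
      also have "\<dots> \<le> N" unfolding N_def by (intro add_mono integral_le_LINT(2) iy1 iy2) auto
      finally show ?thesis .
    qed
    have fin: "sqrt N + q \<le> 100000000000000000000 * d"
      if p: "primitive (\<lambda>x. phi6_force (u x) + f x) v" and f: "integrable lebesgue (\<lambda>x. (f x)\<^sup>2)"
        "(LINT x|lebesgue. (f x)\<^sup>2) \<le> d\<^sup>2" and d: "0 < d" "d \<le> 1" for f d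
    proof -
      interpret nk: near_kink_pair u v f y1 y2 d N
      proof
        show "(\<lambda>x. (f x)\<^sup>2) integrable_on {a..b}" for a b by (rule integral_le_LINT(1)[OF f(1)]) simp
        show "integral {a..b} (\<lambda>x. (f x)\<^sup>2) \<le> d\<^sup>2" for a b
          using integral_le_LINT(2)[OF f(1), of a b] f(2) by simp
        show "15000 \<le> y2 - y1" using z by simp
      qed (use du p d small z1 z2 N_bound in \<open>auto simp: q_def\<close>)
      have qq: "nk.q = q" by (simp add: nk.q_def q_def)
      \<comment> \<open>With \<open>N\<close> the full integral, the bound over finite intervals
        becomes a bound of \<open>N\<close> by \<open>N / 2\<close> plus terms in \<open>d\<close>
        and \<open>q\<close>.\<close>
      have "(LINT x|lebesgue. (nk.g x)\<^sup>2 + (nk.g' x)\<^sup>2) \<le> N / 2 + 300000000 * (d\<^sup>2 + nk.q\<^sup>2)"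
      proof (rule integrable_bounded_integrals(2))
        show "continuous_on UNIV (\<lambda>x. (nk.g x)\<^sup>2 + (nk.g' x)\<^sup>2)"
          by (intro continuous_intros nk.g_continuous nk.g'_continuous)
        show "integral {a..b} (\<lambda>x. (nk.g x)\<^sup>2 + (nk.g' x)\<^sup>2) \<le> N / 2 + 300000000 * (d\<^sup>2 + nk.q\<^sup>2)" if "a \<le> b" for a b
          using nk.H1_bound[OF that] by (simp add: nk.I_def)
      qed simp
      moreover have "(LINT x|lebesgue. (nk.g x)\<^sup>2 + (nk.g' x)\<^sup>2) = N"
        unfolding N_def nk.g_def nk.g'_def by (rule Bochner_Integration.integral_add[OF iy1 iy2])
      ultimately have "N \<le> N / 2 + 300000000 * (d\<^sup>2 + nk.q\<^sup>2)" by simp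
      moreover have "nk.q \<le> 1 / 240000000000000"
      proof -
        have "q \<le> 1 / (1 + (y2 - y1))" unfolding q_def by (rule exp_minus_sqrt2_le) (use z in simp)
        also have "\<dots> \<le> 1 / 240000000000000" using z by (intro divide_left_mono) auto
        finally show ?thesis by (simp add: qq)
      qed
      ultimately show ?thesis using nk.final_bound by (simp add: qq)
    qed
    show "\<exists>y1 y2. integrable lebesgue (\<lambda>x. (u x - kink_pair y1 y2 x)\<^sup>2) \<and>
        integrable lebesgue (\<lambda>x. (v x - kink_pair_deriv y1 y2 x)\<^sup>2) \<and>
        (\<forall>f d. primitive (\<lambda>x. phi6_force (u x) + f x) v \<longrightarrow> integrable lebesgue (\<lambda>x. (f x)\<^sup>2) \<longrightarrow>
           (LINT x|lebesgue. (f x)\<^sup>2) \<le> d\<^sup>2 \<longrightarrow> 0 < d \<longrightarrow> d \<le> 1 \<longrightarrow>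
           sqrt ((LINT x|lebesgue. (u x - kink_pair y1 y2 x)\<^sup>2) + (LINT x|lebesgue. (v x - kink_pair_deriv y1 y2 x)\<^sup>2))
             + exp (- sqrt 2 * (y2 - y1)) \<le> 100000000000000000000 * d)"
      by (rule exI[of _ y1], rule exI[of _ y2], intro conjI allI impI iy1 iy2 fin[unfolded N_def q_def])
  qed
qed

subsection \<open>From distributions to regular functions\<close>

lemma L2_fun_locally_integrable:
  assumes "f \<in> L2_fun"
  shows "locally_integrable f"
  unfolding locally_integrable_def
proof (intro allI)
  fix a b :: real
  have m: "f \<in> borel_measurable lebesgue" and i: "integrable lebesgue (\<lambda>x. (f x)\<^sup>2)"
    using assms by (auto simp: L2_fun_def)
  show "f absolutely_integrable_on {a..b}"
  proof (rule measurable_bounded_by_integrable_imp_absolutely_integrable)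
    show "f \<in> borel_measurable (lebesgue_on {a..b})" using m by (simp add: measurable_restrict_space1)
    show "(\<lambda>x. 1 + (f x)\<^sup>2) integrable_on {a..b}"
      by (intro integrable_add integral_le_LINT(1) i integrable_const_ivl) auto
    show "norm (f x) \<le> 1 + (f x)\<^sup>2" for x
      using zero_le_power2[of "\<bar>f x\<bar> - 1"] by (simp add: power2_eq_square algebra_simps)
  qed simp
qed

lemma continuous_lebesgue_measurable:
  fixes h :: "real \<Rightarrow> real"
  shows "continuous_on UNIV h \<Longrightarrow> h \<in> borel_measurable lebesgue"
  by (rule measurable_completion) (simp add: borel_measurable_continuous_onI)

lemma integrable_mult_test_fun:
  assumes a: "locally_integrable a" and \<phi>: "\<phi> \<in> test_fun"
  shows "integrable lebesgue (\<lambda>x. a x * \<phi> x)"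
proof -
  obtain R where R: "\<And>x. \<bar>x\<bar> \<ge> R \<Longrightarrow> \<phi> x = 0" using test_fun_support[OF \<phi>] by metis
  have "locally_integrable (\<lambda>x. a x * \<phi> x)"
    by (rule locally_integrable_mult_continuous[OF a test_fun_continuous[OF \<phi>]])
  then have "integrable lebesgue (\<lambda>x. indicator {-R..R} x *\<^sub>R (a x * \<phi> x))"
    using locally_integrableD unfolding set_integrable_def by blast
  moreover have "(\<lambda>x. indicator {-R..R} x *\<^sub>R (a x * \<phi> x)) = (\<lambda>x. a x * \<phi> x)"
    using R by (force simp: indicator_def)
  ultimately show ?thesis by simp
qed

lemma LINT_mult_AE_cong:
  fixes f g h :: "real \<Rightarrow> real"
  assumes "f \<in> borel_measurable lebesgue" "AE x in lebesgue. f x = g x" "continuous_on UNIV h"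
  shows "(LINT x|lebesgue. f x * h x) = (LINT x|lebesgue. g x * h x)"
proof (rule integral_cong_AE)
  have g: "g \<in> borel_measurable lebesgue" by (rule borel_measurable_AE[OF assms(1,2)])
  note h = continuous_lebesgue_measurable[OF assms(3)]
  show "(\<lambda>x. f x * h x) \<in> borel_measurable lebesgue" "(\<lambda>x. g x * h x) \<in> borel_measurable lebesgue"
    using assms(1) g h by (auto intro: borel_measurable_times)
  show "AE x in lebesgue. f x * h x = g x * h x" using assms(2) by (rule AE_mp) auto
qed

lemma LINT_square_AE_cong:
  fixes f g :: "real \<Rightarrow> real"
  assumes "f \<in> borel_measurable lebesgue" "AE x in lebesgue. f x = g x"
  shows "(LINT x|lebesgue. (f x)\<^sup>2) = (LINT x|lebesgue. (g x)\<^sup>2)"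
    "integrable lebesgue (\<lambda>x. (f x)\<^sup>2) = integrable lebesgue (\<lambda>x. (g x)\<^sup>2)"
proof -
  have g: "g \<in> borel_measurable lebesgue" by (rule borel_measurable_AE[OF assms])
  have m: "(\<lambda>x. (f x)\<^sup>2) \<in> borel_measurable lebesgue" "(\<lambda>x. (g x)\<^sup>2) \<in> borel_measurable lebesgue"
    using assms(1) g by (auto intro: borel_measurable_power)
  have e: "AE x in lebesgue. (f x)\<^sup>2 = (g x)\<^sup>2" using assms(2) by (rule AE_mp) auto
  show "(LINT x|lebesgue. (f x)\<^sup>2) = (LINT x|lebesgue. (g x)\<^sup>2)" by (rule integral_cong_AE[OF m e])
  show "integrable lebesgue (\<lambda>x. (f x)\<^sup>2) = integrable lebesgue (\<lambda>x. (g x)\<^sup>2)" by (rule integrable_cong_AE[OF m e])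
qed

lemma primitive_AE_cong:
  assumes F: "primitive f F" and e: "AE x in lebesgue. f x = g x" and g: "locally_integrable g"
  shows "primitive g F"
proof -
  have "negligible {x. f x \<noteq> g x}"
    using e unfolding completion.AE_iff_null_sets negligible_iff_null_sets by simp
  then have "integral {a..b} f = integral {a..b} g" for a b
    by (rule integral_spike) auto
  then show ?thesis using F g by (simp add: primitive_def)
qed

text \<open>Both functions have the same integrals against all bumps; as the bumps sharpen, the
  integrals of the difference over all intervals vanish.\<close>

lemma representative_unique:
  assumes "f \<in> L2_fun" "g \<in> L2_fun" "represents f T" "represents g T"
  shows "AE x in lebesgue. f x = g x"
proof -
  define h where "h x = f x - g x" for x
  have lf: "locally_integrable f" and lg: "locally_integrable g"
    using assms L2_fun_locally_integrable by auto
  have h: "locally_integrable h" unfolding h_def by (intro locally_integrable_diff lf lg)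
  have z: "integral {s..t} h = 0" if st: "s \<le> t" for s t
  proof -
    define A where "A = \<bar>s\<bar> + \<bar>t\<bar>"
    have A: "- A \<le> s" "t \<le> A" by (auto simp: A_def)
    have "integral {-A..A} (\<lambda>x. h x * bump s t n x) = 0" for n
    proof -
      have b0: "bump s t n x = 0" if "\<bar>x\<bar> > A" for x
        using that A by (intro bump_zero) linarith
      have b: "bump s t n \<in> test_fun" by (rule test_funI[OF bump_diff_times b0])
      have "(LINT x|lebesgue. h x * bump s t n x) = integral {-A..A} (\<lambda>x. h x * bump s t n x)"
        by (rule LINT_bounded_support)
           (auto intro!: locally_integrable_mult_continuous h bump_continuous simp: b0)
      moreover have "(LINT x|lebesgue. h x * bump s t n x)
          = (LINT x|lebesgue. f x * bump s t n x) - (LINT x|lebesgue. g x * bump s t n x)"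
        unfolding h_def left_diff_distrib
        by (rule Bochner_Integration.integral_diff[OF integrable_mult_test_fun[OF lf b] integrable_mult_test_fun[OF lg b]])
      moreover have "\<dots> = 0" using assms(3,4) b by (simp add: represents_def distrib_of_def)
      ultimately show ?thesis by simp
    qed
    then have "(\<lambda>n. 0) \<longlonglongrightarrow> integral {s..t} h"
      using bump_integral_tendsto[OF h A(1) st A(2)] by simp
    then show ?thesis using LIMSEQ_unique[OF _ tendsto_const] by metis
  qed
  have "AE x in lebesgue. h x = 0" by (rule zero_integrals_imp_AE_zero[OF h z])
  then show ?thesis by (rule AE_mp) (auto simp: h_def)
qed

lemma L2_norm_eq:
  assumes "f \<in> L2_fun" "represents f T"
  shows "L2_norm T = ennreal (L2_fun_norm f)"
proof -
  have same: "L2_fun_norm g = L2_fun_norm f" if "g \<in> L2_fun" "represents g T" for g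
    using LINT_square_AE_cong(1)[OF _ representative_unique[OF that(1) assms(1) that(2) assms(2)]] that(1)
    by (simp add: L2_fun_norm_def L2_fun_def)
  show ?thesis unfolding L2_norm_def
  proof (rule INF_eq_const)
    show "{g \<in> L2_fun. represents g T} \<noteq> {}" using assms by blast
    show "ennreal (L2_fun_norm g) = ennreal (L2_fun_norm f)" if "g \<in> {g \<in> L2_fun. represents g T}" for g
      by (rule arg_cong[OF same]) (use that in blast)+
  qed
qed

text \<open>By integration by parts \<open>h'\<close> is a candidate in the infimum, and every
  candidate bounds it from above.\<close>

lemma H1_norm_le:
  assumes f: "f \<in> borel_measurable lebesgue" "AE x in lebesgue. f x = h x"
    and dh: "\<And>x. (h has_real_derivative h' x) (at x)" and ch': "continuous_on UNIV h'"
    and i: "integrable lebesgue (\<lambda>x. (h x)\<^sup>2)" "integrable lebesgue (\<lambda>x. (h' x)\<^sup>2)"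
  shows "H1_norm f \<le> ennreal (sqrt ((LINT x|lebesgue. (h x)\<^sup>2) + (LINT x|lebesgue. (h' x)\<^sup>2)))"
proof -
  have fL: "f \<in> L2_fun" using f i(1) LINT_square_AE_cong(2)[OF f] by (simp add: L2_fun_def)
  have hL: "h' \<in> L2_fun" using i(2) continuous_lebesgue_measurable[OF ch'] by (simp add: L2_fun_def)
  have rep: "represents h' (distrib_deriv (distrib_of f))"
    unfolding represents_def
  proof
    fix \<phi> assume \<phi>: "\<phi> \<in> test_fun"
    have "(LINT x|lebesgue. f x * deriv \<phi> x) = (LINT x|lebesgue. h x * deriv \<phi> x)"
      by (rule LINT_mult_AE_cong[OF f test_fun_continuous[OF test_fun_deriv[OF \<phi>]]])
    then show "distrib_deriv (distrib_of f) \<phi> = distrib_of h' \<phi>"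
      using integral_by_parts_test_fun[OF primitive_deriv[OF dh ch'] \<phi>]
      by (simp add: distrib_deriv_def distrib_of_def)
  qed
  have "H1_norm f \<le> ennreal (sqrt ((L2_fun_norm f)\<^sup>2 + (L2_fun_norm h')\<^sup>2))"
    unfolding H1_norm_def using fL hL rep by (auto intro!: INF_lower)
  also have "(L2_fun_norm f)\<^sup>2 = (LINT x|lebesgue. (h x)\<^sup>2)"
    unfolding L2_fun_norm_def LINT_square_AE_cong(1)[OF f] by (simp add: integral_nonneg_AE)
  also have "(L2_fun_norm h')\<^sup>2 = (LINT x|lebesgue. (h' x)\<^sup>2)"
    unfolding L2_fun_norm_def by (simp add: integral_nonneg_AE)
  finally show ?thesis .
qed

text \<open>A bootstrap: the weak derivative \<open>w\<close> makes \<open>u\<close> almost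
  everywhere equal to a continuous \<open>U\<close>, so \<open>phi6_force U\<close> is continuous.
  The equation then gives \<open>U'\<close> the locally integrable weak derivative
  \<open>phi6_force U + f\<close>, hence a continuous representative \<open>v\<close>.\<close>

lemma phi6_op_regularity:
  assumes u: "u \<in> borel_measurable lebesgue"
    and f0: "(\<lambda>x. u x - kink_pair x1 x2 x) \<in> L2_fun" and w: "w \<in> L2_fun"
    and rw: "represents w (distrib_deriv (distrib_of (\<lambda>x. u x - kink_pair x1 x2 x)))"
    and f: "f \<in> L2_fun" and rf: "represents f (phi6_op u)"
  obtains U v where "AE x in lebesgue. u x = U x" "AE x in lebesgue. w x = v x - kink_pair_deriv x1 x2 x"
    "\<forall>x. (U has_real_derivative v x) (at x)" "primitive (\<lambda>x. phi6_force (U x) + f x) v"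
proof -
  note lw = L2_fun_locally_integrable[OF w] and lf = L2_fun_locally_integrable[OF f]
  obtain G where G: "primitive w G" "AE x in lebesgue. u x - kink_pair x1 x2 x = G x"
  proof (rule weak_derivative_primitive[OF L2_fun_locally_integrable[OF f0] lw])
    show "- (LINT x|lebesgue. (u x - kink_pair x1 x2 x) * deriv \<phi> x) = (LINT x|lebesgue. w x * \<phi> x)"
      if "\<phi> \<in> test_fun" for \<phi>
      using rw that by (simp add: represents_def distrib_deriv_def distrib_of_def)
  qed
  define U where "U x = G x + kink_pair x1 x2 x" for x
  define W where "W x = w x + kink_pair_deriv x1 x2 x" for x
  have uU: "AE x in lebesgue. u x = U x" using G(2) by (rule AE_mp) (auto simp: U_def)
  have pU: "primitive W U"
    unfolding W_def[abs_def] U_def[abs_def]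
    by (rule primitive_add[OF G(1) primitive_deriv[OF kink_pair_DERIV kink_pair_continuous(2)]])
  note cU = primitive_continuous[OF pU]
  have cF: "continuous_on UNIV (\<lambda>x. phi6_force (U x))"
    unfolding phi6_force_def by (intro continuous_intros cU)
  have lF: "locally_integrable (\<lambda>x. phi6_force (U x))" by (rule locally_integrable_continuous[OF cF])
  obtain v where v: "primitive (\<lambda>x. phi6_force (U x) + f x) v" "AE x in lebesgue. W x = v x"
  \<comment> \<open>Integrating by parts once turns the second distributional derivative of
    \<open>u\<close> into the weak derivative of \<open>W\<close>.\<close>
  proof (rule weak_derivative_primitive[OF primitiveD(1)[OF pU] locally_integrable_add[OF lF lf]])
    fix \<phi> assume \<phi>: "\<phi> \<in> test_fun"
    note \<phi>' = test_fun_deriv[OF \<phi>]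
    have "(LINT x|lebesgue. u x * deriv (deriv \<phi>) x) = (LINT x|lebesgue. U x * deriv (deriv \<phi>) x)"
      by (rule LINT_mult_AE_cong[OF u uU test_fun_continuous[OF test_fun_deriv[OF \<phi>']]])
    also have "\<dots> = - (LINT x|lebesgue. W x * deriv \<phi> x)" by (rule integral_by_parts_test_fun[OF pU \<phi>'])
    finally have 1: "(LINT x|lebesgue. u x * deriv (deriv \<phi>) x) = - (LINT x|lebesgue. W x * deriv \<phi> x)" .
    have "(LINT x|lebesgue. (- 2 * u x + 8 * u x ^ 3 - 6 * u x ^ 5) * \<phi> x)
        = (LINT x|lebesgue. (- phi6_force (U x)) * \<phi> x)"
    proof (rule LINT_mult_AE_cong[OF _ _ test_fun_continuous[OF \<phi>]])
      show "(\<lambda>x. - 2 * u x + 8 * u x ^ 3 - 6 * u x ^ 5) \<in> borel_measurable lebesgue"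
        using u by (intro borel_measurable_add borel_measurable_diff borel_measurable_times
            borel_measurable_power borel_measurable_const)
      show "AE x in lebesgue. - 2 * u x + 8 * u x ^ 3 - 6 * u x ^ 5 = - phi6_force (U x)"
        using uU by (rule AE_mp) (auto simp: phi6_force_def)
    qed
    then have 2: "distrib_of (\<lambda>x. - 2 * u x + 8 * u x ^ 3 - 6 * u x ^ 5) \<phi> = - (LINT x|lebesgue. phi6_force (U x) * \<phi> x)"
      by (simp add: distrib_of_def)
    have "phi6_op u \<phi> = (LINT x|lebesgue. f x * \<phi> x)"
      using rf \<phi> by (simp add: represents_def distrib_of_def)
    then have "- (LINT x|lebesgue. W x * deriv \<phi> x) = (LINT x|lebesgue. phi6_force (U x) * \<phi> x) + (LINT x|lebesgue. f x * \<phi> x)"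
      unfolding phi6_op_def 2 using 1 by (simp add: distrib_deriv_def distrib_of_def)
    also have "\<dots> = (LINT x|lebesgue. (phi6_force (U x) + f x) * \<phi> x)"
      unfolding distrib_right
      by (rule Bochner_Integration.integral_add[symmetric, OF integrable_mult_test_fun[OF lF \<phi>] integrable_mult_test_fun[OF lf \<phi>]])
    finally show "- (LINT x|lebesgue. W x * deriv \<phi> x) = (LINT x|lebesgue. (phi6_force (U x) + f x) * \<phi> x)" .
  qed
  note cv = primitive_continuous[OF v(1)]
  \<comment> \<open>Replacing \<open>W\<close> by its continuous version makes \<open>U\<close>
    differentiable everywhere.\<close>
  have "primitive v U" by (rule primitive_AE_cong[OF pU v(2) locally_integrable_continuous[OF cv]])
  then have "(U has_real_derivative v x) (at x)" for x by (rule primitive_imp_deriv[OF _ cv])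
  moreover have "AE x in lebesgue. w x = v x - kink_pair_deriv x1 x2 x"
    using v(2) by (rule AE_mp) (auto simp: W_def)
  ultimately show ?thesis using that uU v(1) by blast
qed

theorem theorem1p2:
  "\<exists>a \<epsilon> C :: real. a > 0 \<and> \<epsilon> > 0 \<and> C > 0 \<and>
     (\<forall>u \<in> Linf_fun.
        (\<exists>x1 x2 :: real. x2 - x1 > a \<and>
           H1_norm (\<lambda>x. u x - kink01 (x + x1) - kink10 (x + x2)) < ennreal \<epsilon>) \<longrightarrow>
        (\<exists>y1 y2 :: real.
           H1_norm (\<lambda>x. u x - kink01 (x + y1) - kink10 (x + y2))
             + ennreal (exp (- sqrt 2 * (y2 - y1)))
           \<le> ennreal C * L2_norm (phi6_op u)))"
proof -
  obtain a \<epsilon> :: real where a: "0 < a" and \<epsilon>: "0 < \<epsilon>" "\<epsilon> \<le> 1" and stab: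
    "stability_constants a \<epsilon> 100000000000000000000"
    using regular_stability .
  define C :: real where "C = 100000000000000000000"
  have C: "0 < C" "2 \<le> C" by (auto simp: C_def)
  have pair: "(\<lambda>x. u x - kink01 (x + y1) - kink10 (x + y2)) = (\<lambda>x. u x - kink_pair y1 y2 x)" for u y1 y2
    by (auto simp: kink_pair_def)
  show ?thesis
  proof (rule exI[of _ a], rule exI[of _ \<epsilon>], rule exI[of _ C], intro conjI ballI impI a \<epsilon>(1) C(1), unfold pair)
    fix u :: "real \<Rightarrow> real"
    assume "u \<in> Linf_fun"
    then have u: "u \<in> borel_measurable lebesgue" by (simp add: Linf_fun_def)
    assume "\<exists>x1 x2. x2 - x1 > a \<and> H1_norm (\<lambda>x. u x - kink_pair x1 x2 x) < ennreal \<epsilon>"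
    then obtain x1 x2 where far: "x2 - x1 > a" and near: "H1_norm (\<lambda>x. u x - kink_pair x1 x2 x) < ennreal \<epsilon>"
      by blast
    show "\<exists>y1 y2. H1_norm (\<lambda>x. u x - kink_pair y1 y2 x) + ennreal (exp (- sqrt 2 * (y2 - y1)))
        \<le> ennreal C * L2_norm (phi6_op u)"
    proof (cases "L2_norm (phi6_op u) < 1")
      \<comment> \<open>The norm may be infinite here. The given positions suffice, as the left side
        is at most \<open>1 + 1 \<le> C\<close>.\<close>
      case False
      have "H1_norm (\<lambda>x. u x - kink_pair x1 x2 x) \<le> ennreal 1"
        using near \<epsilon> ennreal_leI[OF \<epsilon>(2)] by (meson order_less_imp_le order_trans)
      moreover have "ennreal (exp (- sqrt 2 * (x2 - x1))) \<le> ennreal 1"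
        using far a by (intro ennreal_leI) simp
      ultimately have "H1_norm (\<lambda>x. u x - kink_pair x1 x2 x) + ennreal (exp (- sqrt 2 * (x2 - x1))) \<le> ennreal 1 + ennreal 1"
        by (rule add_mono)
      also have "\<dots> = ennreal 2" by (simp flip: ennreal_plus)
      also have "\<dots> \<le> ennreal C" by (rule ennreal_leI[OF C(2)])
      also have "\<dots> = ennreal C * 1" by simp
      also have "\<dots> \<le> ennreal C * L2_norm (phi6_op u)" using False by (intro mult_left_mono) auto
      finally show ?thesis by blast
    next
      case True
      then obtain f where f: "f \<in> L2_fun" "represents f (phi6_op u)" "ennreal (L2_fun_norm f) < 1"
        unfolding L2_norm_def INF_less_iff by blast
      have f0: "(\<lambda>x. u x - kink_pair x1 x2 x) \<in> L2_fun"
        using near by (auto simp: H1_norm_def split: if_splits)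
      obtain w where w: "w \<in> L2_fun" "represents w (distrib_deriv (distrib_of (\<lambda>x. u x - kink_pair x1 x2 x)))"
        "ennreal (sqrt ((L2_fun_norm (\<lambda>x. u x - kink_pair x1 x2 x))\<^sup>2 + (L2_fun_norm w)\<^sup>2)) < ennreal \<epsilon>"
        using near f0 unfolding H1_norm_def by (auto simp: INF_less_iff)
      obtain U v where uU: "AE x in lebesgue. u x = U x"
        and wv: "AE x in lebesgue. w x = v x - kink_pair_deriv x1 x2 x"
        and "\<forall>x. (U has_real_derivative v x) (at x)" and pv: "primitive (\<lambda>x. phi6_force (U x) + f x) v"
        using phi6_op_regularity[OF u f0 w(1,2) f(1,2)] .
      then have dU: "\<And>x. (U has_real_derivative v x) (at x)" by blast
      note cv = primitive_continuous[OF pv]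
      have m0: "(\<lambda>x. u x - kink_pair y1 y2 x) \<in> borel_measurable lebesgue" for y1 y2
        by (intro borel_measurable_diff u continuous_lebesgue_measurable kink_pair_continuous)
      have e0: "AE x in lebesgue. u x - kink_pair y1 y2 x = U x - kink_pair y1 y2 x" for y1 y2
        using uU by (rule AE_mp) auto
      have mw: "w \<in> borel_measurable lebesgue" using w(1) by (simp add: L2_fun_def)
      have i1: "integrable lebesgue (\<lambda>x. (U x - kink_pair x1 x2 x)\<^sup>2)"
        using f0 LINT_square_AE_cong(2)[OF m0 e0] by (simp add: L2_fun_def)
      have i2: "integrable lebesgue (\<lambda>x. (v x - kink_pair_deriv x1 x2 x)\<^sup>2)"
        using w(1) LINT_square_AE_cong(2)[OF mw wv] by (simp add: L2_fun_def)
      have dh: "((\<lambda>x. U x - kink_pair y1 y2 x) has_real_derivative v x - kink_pair_deriv y1 y2 x) (at x)" for y1 y2 x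
        by (rule DERIV_diff[OF dU kink_pair_DERIV])
      have ch: "continuous_on UNIV (\<lambda>x. v x - kink_pair_deriv y1 y2 x)" for y1 y2
        by (intro continuous_intros cv kink_pair_continuous)
      have "sqrt ((LINT x|lebesgue. (U x - kink_pair x1 x2 x)\<^sup>2) + (LINT x|lebesgue. (v x - kink_pair_deriv x1 x2 x)\<^sup>2)) < \<epsilon>"
        using w(3) unfolding L2_fun_norm_def LINT_square_AE_cong(1)[OF m0 e0] LINT_square_AE_cong(1)[OF mw wv]
        by (simp add: integral_nonneg_AE ennreal_less_iff)
      moreover have "\<bar>U x - kink_pair x1 x2 x\<bar>
          \<le> sqrt ((LINT x|lebesgue. (U x - kink_pair x1 x2 x)\<^sup>2) + (LINT x|lebesgue. (v x - kink_pair_deriv x1 x2 x)\<^sup>2))" for x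
        using real_le_rsqrt[of "\<bar>U x - kink_pair x1 x2 x\<bar>"] H1_controls_sup[OF dh ch i1 i2, of x] by simp
      ultimately have sup: "\<bar>U x - kink_pair x1 x2 x\<bar> < \<epsilon>" for x
        by (rule order.strict_trans1[rotated])
      obtain y1 y2 where y: "integrable lebesgue (\<lambda>x. (U x - kink_pair y1 y2 x)\<^sup>2)"
        "integrable lebesgue (\<lambda>x. (v x - kink_pair_deriv y1 y2 x)\<^sup>2)" and bound:
        "\<forall>f d. primitive (\<lambda>x. phi6_force (U x) + f x) v \<longrightarrow> integrable lebesgue (\<lambda>x. (f x)\<^sup>2) \<longrightarrow>
           (LINT x|lebesgue. (f x)\<^sup>2) \<le> d\<^sup>2 \<longrightarrow> 0 < d \<longrightarrow> d \<le> 1 \<longrightarrow>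
           sqrt ((LINT x|lebesgue. (U x - kink_pair y1 y2 x)\<^sup>2) + (LINT x|lebesgue. (v x - kink_pair_deriv y1 y2 x)\<^sup>2))
             + exp (- sqrt 2 * (y2 - y1)) \<le> C * d"
        using stab[unfolded stability_constants_def, rule_format, OF dU cv far sup i1 i2] unfolding C_def by blast
      define S where "S = sqrt ((LINT x|lebesgue. (U x - kink_pair y1 y2 x)\<^sup>2) + (LINT x|lebesgue. (v x - kink_pair_deriv y1 y2 x)\<^sup>2))"
      define n where "n = L2_fun_norm f"
      have n: "0 \<le> n" "n < 1" "(LINT x|lebesgue. (f x)\<^sup>2) = n\<^sup>2"
        using f(3) by (auto simp: n_def L2_fun_norm_def integral_nonneg_AE ennreal_less_one_iff)
      \<comment> \<open>The stability estimate demands \<open>0 < d\<close>, while \<open>n\<close>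
        may be 0. It is applied to every \<open>d\<close> strictly between \<open>n\<close> and 1,
        and density gives the bound at \<open>n\<close>.\<close>
      have "(S + exp (- sqrt 2 * (y2 - y1))) / C \<le> n"
      proof (rule dense_ge_bounded[OF n(2)])
        fix d assume d: "n < d" "d < 1"
        then have "n\<^sup>2 \<le> d\<^sup>2" using n by (intro power_mono) auto
        then have "S + exp (- sqrt 2 * (y2 - y1)) \<le> C * d"
          unfolding S_def using bound pv f(1) n d by (auto simp: L2_fun_def)
        then show "(S + exp (- sqrt 2 * (y2 - y1))) / C \<le> d" using C(1) by (simp add: field_simps)
      qed
      then have Sn: "S + exp (- sqrt 2 * (y2 - y1)) \<le> C * n" using C(1) by (simp add: field_simps)
      have S0: "0 \<le> S" unfolding S_def by (simp add: integral_nonneg_AE)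
      have "H1_norm (\<lambda>x. u x - kink_pair y1 y2 x) + ennreal (exp (- sqrt 2 * (y2 - y1)))
          \<le> ennreal S + ennreal (exp (- sqrt 2 * (y2 - y1)))"
        unfolding S_def by (intro add_right_mono H1_norm_le[OF m0 e0 dh ch y])
      also have "\<dots> = ennreal (S + exp (- sqrt 2 * (y2 - y1)))" using S0 by simp
      also have "\<dots> \<le> ennreal (C * n)" by (rule ennreal_leI[OF Sn])
      also have "\<dots> = ennreal C * L2_norm (phi6_op u)"
        unfolding L2_norm_eq[OF f(1,2)] n_def[symmetric] using C n by (simp add: ennreal_mult)
      finally show ?thesis by blast
    qed
  qed
qed

end
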